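(* Let $k,n,N$ be positive integers. There is a graded, $\mathfrak{gl}_n[z]$-equivariant surjective map $$\mathcal H_{kN}(kn,1)_{\mathfrak{sl}_k[z]}\twoheadrightarrow\mathcal H_N(n,k),$$ where $\mathcal H_{kN}(kn,1)_{\mathfrak{sl}_k[z]}=\mathcal H_{kN}(kn,1)/\mathfrak{sl}_k[z]\cdot\mathcal H_{kN}(kn,1)$ is the space of $\mathfrak{sl}_k[z]$-coinvariants.
   Context: For positive integers $M,p,\ell$ let $\mathbb C[X,A]$ be the polynomial ring in the entries of an $M\times M$ matrix $X=(X^i_j)$ and a $p\times M$ matrix $A=(A^a_i)$, and $$\mathcal H_M(p,\ell)=\{f\in\mathbb C[X,A]: f(gXg^{-1},Ag^{-1})=\det(g)^{-\ell}f(X,A)\ \forall g\in GL_M(\mathbb C)\},$$ graded by $\deg X=1$, $\deg A=0$. The Lie algebra $\mathfrak{gl}_p[z]=\mathfrak{gl}_p\otimes\mathbb C[z]$ acts on $\mathcal H_M(p,\ell)$ by $E^a_b\otimes z^m\mapsto\sum_{i,j}A^a_i(X^m)^i_j\,\partial/\partial A^b_j$. Writing $\mathbb C^{kn}=\mathbb C^n\otimes\mathbb C^k$ gives an inclusion $\mathfrak{gl}_n[z]\oplus\mathfrak{sl}_k[z]\subset\mathfrak{gl}_{kn}[z]$ ($x\otimes z^m\mapsto(x\otimes1_k)z^m$ for $x\in\mathfrak{gl}_n$, $y\otimes z^m\mapsto(1_n\otimes y)z^m$ for $y\in\mathfrak{sl}_k$), through which $\mathfrak{gl}_n[z]\oplus\mathfrak{sl}_k[z]$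 acts on $\mathcal H_{kN}(kn,1)$; since the two factors commute, $\mathfrak{gl}_n[z]$ acts on the coinvariants. *)

theory Defs
  imports "HOL-Analysis.Analysis" "HOL-Library.Poly_Mapping"
    "HOL-Computational_Algebra.Polynomial"
begin

text \<open>
  Dimensions are finite index types: \<open>'m\<close> has \<open>M\<close> elements and \<open>'p\<close> has \<open>p\<close> elements.
  Following the matrix convention of HOL-Analysis, the \<open>M \<times> M\<close> matrix \<open>X\<close> has type
  \<open>complex ^ 'm ^ 'm\<close>, the \<open>p \<times> M\<close> matrix \<open>A\<close> has type \<open>complex ^ 'm ^ 'p\<close>, and upper
  indices are row indices.
\<close>

datatype ('m, 'p) var = XVar 'm 'm | AVar 'p 'm

text \<open>Finitely supported coefficient functions on monomials; the product of the library
  type is convolution, so this is the polynomial ring itself.\<close>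

type_synonym ('m, 'p) cpoly = "(('m, 'p) var \<Rightarrow>\<^sub>0 nat) \<Rightarrow>\<^sub>0 complex"

definition pvar :: "('m, 'p) var \<Rightarrow> ('m, 'p) cpoly" where
  "pvar v = Poly_Mapping.single (Poly_Mapping.single v 1) 1"

definition pscale :: "complex \<Rightarrow> ('m, 'p) cpoly \<Rightarrow> ('m, 'p) cpoly" where
  "pscale c f = Poly_Mapping.single 0 c * f"

global_interpretation cpoly: vector_space pscale
  by unfold_locales
    (simp_all add: pscale_def distrib_left distrib_right single_add mult_single
      flip: mult.assoc)

primrec var_val ::
  "complex ^ 'm ^ 'm \<Rightarrow> complex ^ 'm ^ 'p \<Rightarrow> ('m::finite, 'p::finite) var \<Rightarrow> complex" where
  "var_val X A (XVar i j) = X $ i $ j"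
| "var_val X A (AVar a i) = A $ a $ i"

definition peval ::
  "('m::finite, 'p::finite) cpoly \<Rightarrow> complex ^ 'm ^ 'm \<Rightarrow> complex ^ 'm ^ 'p \<Rightarrow> complex" where
  "peval f X A = (\<Sum>\<mu>\<in>Poly_Mapping.keys f. Poly_Mapping.lookup f \<mu> *
     (\<Prod>v\<in>Poly_Mapping.keys \<mu>. var_val X A v ^ Poly_Mapping.lookup \<mu> v))"

text \<open>Monomials not containing \<open>v\<close> contribute 0 here, so the truncated subtraction of
  exponents is harmless.\<close>

definition pderiv_var :: "('m, 'p) var \<Rightarrow> ('m, 'p) cpoly \<Rightarrow> ('m, 'p) cpoly" where
  "pderiv_var v f = (\<Sum>\<mu>\<in>Poly_Mapping.keys f.
     Poly_Mapping.single (\<mu> - Poly_Mapping.single v 1)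
       (of_nat (Poly_Mapping.lookup \<mu> v) * Poly_Mapping.lookup f \<mu>))"

definition Xdegree :: "(('m::finite, 'p) var \<Rightarrow>\<^sub>0 nat) \<Rightarrow> nat" where
  "Xdegree \<mu> = (\<Sum>i\<in>UNIV. \<Sum>j\<in>UNIV. Poly_Mapping.lookup \<mu> (XVar i j))"

definition Xhomogeneous :: "nat \<Rightarrow> ('m::finite, 'p) cpoly \<Rightarrow> bool" where
  "Xhomogeneous d f \<longleftrightarrow> (\<forall>\<mu>\<in>Poly_Mapping.keys f. Xdegree \<mu> = d)"

definition covariants :: "nat \<Rightarrow> ('m::finite, 'p::finite) cpoly set" where
  "covariants l = {f. \<forall>g :: complex ^ 'm ^ 'm. invertible g \<longrightarrow>
     (\<forall>X A. peval f (g ** X ** matrix_inv g) (A ** matrix_inv g) =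
            det g powi (- int l) * peval f X A)}"

definition covariants_degree :: "nat \<Rightarrow> nat \<Rightarrow> ('m::finite, 'p::finite) cpoly set" where
  "covariants_degree l d = {f \<in> covariants l. Xhomogeneous d f}"

definition Xmat :: "('m::finite, 'p) cpoly ^ 'm ^ 'm" where
  "Xmat = (\<chi> i j. pvar (XVar i j))"

text \<open>Powers for the matrix product; the overloaded power on vectors is componentwise.\<close>

primrec matpow :: "'a::semiring_1 ^ 'm ^ 'm \<Rightarrow> nat \<Rightarrow> 'a ^ 'm ^ ('m::finite)" where
  "matpow B 0 = mat 1"
| "matpow B (Suc r) = B ** matpow B r"

definition E_act :: "'p \<Rightarrow> 'p \<Rightarrow> nat \<Rightarrow> ('m::finite, 'p) cpoly \<Rightarrow> ('m, 'p) cpoly" where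
  "E_act a b r f = (\<Sum>i\<in>UNIV. \<Sum>j\<in>UNIV.
     pvar (AVar a i) * matpow Xmat r $ i $ j * pderiv_var (AVar b j) f)"

text \<open>\<open>gl\<^sub>p \<otimes> C[z]\<close> is identified with the \<open>p \<times> p\<close> matrices over \<open>C[z]\<close>. The \<open>z\<^sup>r\<close>-coefficient
  of the \<open>(a, b)\<close> entry is the coefficient of \<open>E\<^sup>a\<^sub>b \<otimes> z\<^sup>r\<close>, where \<open>E\<^sup>a\<^sub>b\<close> is the matrix unit with
  entry 1 in row \<open>a\<close> and column \<open>b\<close>; with this convention the formula below respects
  commutators.\<close>

definition gl_act ::
  "complex poly ^ 'p ^ 'p \<Rightarrow> ('m::finite, 'p::finite) cpoly \<Rightarrow> ('m, 'p) cpoly" where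
  "gl_act x f = (\<Sum>a\<in>UNIV. \<Sum>b\<in>UNIV. \<Sum>r\<le>degree (x $ a $ b).
     pscale (coeff (x $ a $ b) r) (E_act a b r f))"

definition sl_current :: "(complex poly ^ 'k ^ 'k) set" where
  "sl_current = {y. trace y = 0}"

definition kronecker ::
  "'a::times ^ 'n ^ 'n \<Rightarrow> 'a ^ 'k ^ 'k \<Rightarrow> 'a ^ ('n::finite \<times> 'k::finite) ^ ('n \<times> 'k)" where
  "kronecker x y = (\<chi> u v. x $ fst u $ fst v * y $ snd u $ snd v)"

definition gl_n_act ::
  "complex poly ^ 'n ^ 'n \<Rightarrow> ('m::finite, 'n::finite \<times> 'k::finite) cpoly \<Rightarrow>
     ('m, 'n \<times> 'k) cpoly" where
  "gl_n_act x = gl_act (kronecker x (mat 1))"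

definition sl_k_act ::
  "complex poly ^ 'k ^ 'k \<Rightarrow> ('m::finite, 'n::finite \<times> 'k::finite) cpoly \<Rightarrow>
     ('m, 'n \<times> 'k) cpoly" where
  "sl_k_act y = gl_act (kronecker (mat 1) y)"

definition sl_image :: "nat \<Rightarrow> ('m::finite, 'n::finite \<times> 'k::finite) cpoly set" where
  "sl_image l = cpoly.span {sl_k_act y f | y f. y \<in> sl_current \<and> f \<in> covariants l}"

definition coinv_rel :: "nat \<Rightarrow> ('m::finite, 'n::finite \<times> 'k::finite) cpoly rel" where
  "coinv_rel l = {(f, g). f \<in> covariants l \<and> g \<in> covariants l \<and> f - g \<in> sl_image l}"

definition coinvariants :: "nat \<Rightarrow> ('m::finite, 'n::finite \<times> 'k::finite) cpoly set set" where
  "coinvariants l = covariants l // coinv_rel l"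

definition coinvariants_degree ::
  "nat \<Rightarrow> nat \<Rightarrow> ('m::finite, 'n::finite \<times> 'k::finite) cpoly set set" where
  "coinvariants_degree l d = (\<lambda>f. coinv_rel l `` {f}) ` covariants_degree l d"

text \<open>Operations on equivalence classes, induced from representatives in the style of
  \<^theory>\<open>HOL.Equiv_Relations\<close>: the union is over identical classes.\<close>

definition coinv_add ::
  "nat \<Rightarrow> ('m::finite, 'n::finite \<times> 'k::finite) cpoly set \<Rightarrow> ('m, 'n \<times> 'k) cpoly set \<Rightarrow>
     ('m, 'n \<times> 'k) cpoly set" where
  "coinv_add l S T = (\<Union>f\<in>S. \<Union>g\<in>T. coinv_rel l `` {f + g})"

definition coinv_scale ::
  "nat \<Rightarrow> complex \<Rightarrow> ('m::finite, 'n::finite \<times> 'k::finite) cpoly set \<Rightarrow>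
     ('m, 'n \<times> 'k) cpoly set" where
  "coinv_scale l c S = (\<Union>f\<in>S. coinv_rel l `` {pscale c f})"

definition coinv_gl_act ::
  "nat \<Rightarrow> complex poly ^ 'n ^ 'n \<Rightarrow> ('m::finite, 'n::finite \<times> 'k::finite) cpoly set \<Rightarrow>
     ('m, 'n \<times> 'k) cpoly set" where
  "coinv_gl_act l x S = (\<Union>f\<in>S. coinv_rel l `` {gl_n_act x f})"

end

theory Submission imports Defs begin

text \<open>
  The map sends the class of \<open>F\<close> to the polynomial \<open>(X, A) \<mapsto> F(X \<otimes> 1, A \<otimes> 1)\<close>. At such a point, the
  action of \<open>y \<otimes> z\<^sup>r\<close> with \<open>y\<close> traceless is the derivative of \<open>F\<close> along \<open>A \<mapsto> A (1 + t Y)\<close>, where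
  \<open>Y = X\<^sup>r \<otimes> y\<^sup>T\<close> commutes with \<open>X \<otimes> 1\<close> and has trace 0; by covariance this derivative is
  \<open>tr Y * F = 0\<close>.

  Surjectivity rests on the first fundamental theorem: covariants of weight \<open>k\<close> are linear
  combinations of products of traces \<open>tr(X\<^sup>m)\<close> and \<open>k\<close> determinants with rows of the form
  \<open>A\<^sup>a X\<^sup>e\<close>. Such a product lifts to a product of traces and one determinant of size \<open>k N\<close>, in which
  the rows of the \<open>\<kappa>\<close>-th determinant get the colour \<open>\<kappa>\<close>. For the fundamental theorem, a covariant \<open>f\<close>
  of degree \<open>d\<close> in \<open>X\<close> satisfies \<open>f(det(g) g\<^sup>-\<^sup>1 X g, A g) = det(g)\<^sup>k\<^sup>+\<^sup>d f(X, A)\<close>. Pairing both sides with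
  \<open>det\<^sup>k\<^sup>+\<^sup>d\<close> as polynomials in \<open>g\<close> (Cayley's Omega process) expresses \<open>f\<close> by contractions of copies
  of \<open>X\<close>, of rows of \<open>A\<close> and of \<open>k + 2 d\<close> antisymmetric tensors, and \<open>\<epsilon> \<epsilon> = det \<delta>\<close> cancels \<open>2 d\<close> of the
  latter. What remains is a product of traces and \<open>k\<close> determinants.
\<close>

section \<open>Polynomials and polynomial functions\<close>

text \<open>Covariance involves the inverse of \<open>g\<close>, whereas a pairing with a power of
  the determinant needs a polynomial in \<open>g\<close>. This is the purpose of the factor det(g)
  in front of g^-1 X g: by Cramer's rule the product is polynomial in \<open>g\<close>, at the price
  of \<open>d\<close> more determinants. The numbers then fit exactly. As a function of
  \<open>g\<close>, a monomial of degree d in X and k N in A is a combination of products of (k + d)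
  N linear forms, which is the degree of det^(k+d), and the d surplus tensors of the pairing meet
  the d tensors from Cramer's rule. The degree k N in A is itself forced by covariance under scalar
  matrices. The pairing is realised by finite alternating sums of values, so neither integration
  over a compact group nor differential operators in \<open>g\<close> occur. That det^(k+d) pairs
  with itself to something nonzero is a positivity argument. The span of the generators is never
  formed: an abstract closed property \<open>P\<close> stands for it.\<close>

definition mscale :: "complex \<Rightarrow> complex ^ 'n ^ 'm \<Rightarrow> complex ^ 'n ^ 'm" where
  "mscale c M = (\<chi> i j. c * M $ i $ j)"

lemma mscale_nth [simp]: "mscale c M $ i $ j = c * M $ i $ j"
  by (simp add: mscale_def)

lemma mscale_1 [simp]: "mscale 1 M = M"
  by (simp add: vec_eq_iff)

lemma UNIV_var: "(UNIV :: ('m, 'p) var set) = range (case_prod XVar) \<union> range (case_prod AVar)"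
proof (intro set_eqI iffI)
  fix v :: "('m, 'p) var"
  show "v \<in> range (case_prod XVar) \<union> range (case_prod AVar)"
    by (cases v) (auto simp: image_iff)
qed simp

instance var :: (finite, finite) finite
  by standard (simp add: UNIV_var)

text \<open>The product runs over all variables instead of the keys, so multiplicativity in the
  monomial needs no bookkeeping of supports.\<close>

definition mono_eval ::
  "(('m::finite, 'p::finite) var \<Rightarrow>\<^sub>0 nat) \<Rightarrow> complex ^ 'm ^ 'm \<Rightarrow> complex ^ 'm ^ 'p \<Rightarrow> complex" where
  "mono_eval \<mu> X A = (\<Prod>v\<in>UNIV. var_val X A v ^ Poly_Mapping.lookup \<mu> v)"

lemma mono_eval_keys:
  "(\<Prod>v\<in>Poly_Mapping.keys \<mu>. var_val X A v ^ Poly_Mapping.lookup \<mu> v) = mono_eval \<mu> X A"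
  unfolding mono_eval_def by (rule prod.mono_neutral_left) (auto simp: in_keys_iff)

lemma mono_eval_add: "mono_eval (\<mu> + \<nu>) X A = mono_eval \<mu> X A * mono_eval \<nu> X A"
  by (simp add: mono_eval_def lookup_add power_add prod.distrib)

lemma mono_eval_0 [simp]: "mono_eval 0 X A = 1"
  by (simp add: mono_eval_def)

lemma mono_eval_single: "mono_eval (Poly_Mapping.single v n) X A = var_val X A v ^ n"
proof -
  have "mono_eval (Poly_Mapping.single v n) X A =
      (\<Prod>w\<in>UNIV. if w = v then var_val X A v ^ n else 1)"
    unfolding mono_eval_def by (rule prod.cong) (auto simp: lookup_single)
  then show ?thesis by simp
qed

lemma peval_superset:
  assumes "finite K" "Poly_Mapping.keys f \<subseteq> K"
  shows "peval f X A = (\<Sum>\<mu>\<in>K. Poly_Mapping.lookup f \<mu> * mono_eval \<mu> X A)"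
  unfolding peval_def mono_eval_keys using assms
  by (intro sum.mono_neutral_left) (auto simp: in_keys_iff)

lemma peval_mono_eval:
  "peval f X A = (\<Sum>\<mu>\<in>Poly_Mapping.keys f. Poly_Mapping.lookup f \<mu> * mono_eval \<mu> X A)"
  by (rule peval_superset) auto

lemma peval_0 [simp]: "peval 0 X A = 0"
  by (simp add: peval_def)

lemma peval_add [simp]: "peval (f + g) X A = peval f X A + peval g X A"
proof -
  let ?K = "Poly_Mapping.keys f \<union> Poly_Mapping.keys g"
  have "Poly_Mapping.keys (f + g) \<subseteq> ?K" by (rule keys_add)
  then show ?thesis
    by (simp add: peval_superset[of ?K] lookup_add distrib_right sum.distrib)
qed

lemma peval_sum [simp]: "peval (sum f I) X A = (\<Sum>i\<in>I. peval (f i) X A)"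
  by (induct I rule: infinite_finite_induct) auto

lemma peval_single: "peval (Poly_Mapping.single \<mu> c) X A = c * mono_eval \<mu> X A"
  by (subst peval_superset[of "{\<mu>}"]) auto

lemma poly_mapping_expand:
  "f = (\<Sum>\<mu>\<in>Poly_Mapping.keys f. Poly_Mapping.single \<mu> (Poly_Mapping.lookup f \<mu>))"
  by (rule poly_mapping_eqI) (simp add: lookup_sum lookup_single when_def in_keys_iff)

lemma peval_mult [simp]: "peval (f * g) X A = peval f X A * peval g X A"
proof -
  have "f * g = (\<Sum>\<mu>\<in>Poly_Mapping.keys f. \<Sum>\<nu>\<in>Poly_Mapping.keys g.
      Poly_Mapping.single (\<mu> + \<nu>) (Poly_Mapping.lookup f \<mu> * Poly_Mapping.lookup g \<nu>))"
    by (subst (1) poly_mapping_expand[of f], subst (1) poly_mapping_expand[of g])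
      (simp add: sum_product mult_single)
  then show ?thesis
    by (simp add: peval_single mono_eval_add)
      (simp add: peval_mono_eval sum_product mult_ac)
qed

lemma peval_1 [simp]: "peval 1 X A = 1"
  using peval_single[of 0 1 X A] by simp

lemma peval_pscale [simp]: "peval (pscale c f) X A = c * peval f X A"
  by (simp add: pscale_def peval_single)

lemma peval_pvar [simp]: "peval (pvar v) X A = var_val X A v"
  by (simp add: pvar_def peval_single mono_eval_single)

lemma peval_uminus [simp]: "peval (- f) X A = - peval f X A"
proof -
  have "peval (f + - f) X A = 0" by simp
  then show ?thesis unfolding peval_add by (simp add: eq_neg_iff_add_eq_0 add.commute)
qed

lemma peval_diff [simp]: "peval (f - g) X A = peval f X A - peval g X A"
  using peval_add[of f "- g" X A] by simp

text \<open>A polynomial in \<open>t\<close> that vanishes at all \<open>t \<noteq> 0\<close> has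
  infinitely many roots. Excluding 0 allows \<open>t\<close> to be the scalar of an invertible
  matrix; the conclusion projects a sum onto the terms of one exponent.\<close>

lemma sum_monomials_coeff:
  fixes c :: "'i \<Rightarrow> complex"
  assumes "finite K" and eq: "\<And>t. t \<noteq> 0 \<Longrightarrow> (\<Sum>i\<in>K. c i * t ^ e i) = b * t ^ m"
  shows "(\<Sum>i\<in>{i\<in>K. e i = n}. c i) = (if n = m then b else 0)"
proof -
  define P where "P = (\<Sum>i\<in>K. monom (c i) (e i)) - monom b m"
  have "poly P t = 0" if "t \<noteq> 0" for t
    using eq[OF that] by (simp add: P_def poly_sum poly_monom)
  then have sub: "UNIV - {0} \<subseteq> {t. poly P t = 0}" by auto
  have "infinite (UNIV - {0 :: complex})" by (simp add: infinite_UNIV_char_0)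
  then have "P = 0" using sub poly_roots_finite[of P] finite_subset by blast
  then have "coeff P n = 0" by simp
  then show ?thesis
    using \<open>finite K\<close> by (simp add: P_def coeff_sum sum.If_cases Int_def conj_commute split: if_splits)
qed

text \<open>Induction on the variables: as a polynomial in \<open>x w\<close> the sum has vanishing
  coefficients, each of which is a sum of the same kind over fewer variables. The exponents are
  arbitrary functions, so several members of \<open>K\<close> may agree on \<open>V\<close>.\<close>

lemma monomials_independent:
  fixes c :: "('v \<Rightarrow> nat) \<Rightarrow> complex"
  assumes "finite V" "finite K"
    and "\<And>x. (\<Sum>\<mu>\<in>K. c \<mu> * (\<Prod>v\<in>V. x v ^ \<mu> v)) = 0"
  shows "(\<Sum>\<mu>\<in>{\<mu>\<in>K. \<forall>v\<in>V. \<mu> v = \<nu> v}. c \<mu>) = 0"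
  using assms
proof (induct V arbitrary: K rule: finite_induct)
  case empty
  then show ?case by simp
next
  case (insert w V)
  \<comment> \<open>The right-hand side has the form of \<open>sum_monomials_coeff\<close> for
    \<open>b = 0\<close> and \<open>m = 0\<close>.\<close>
  have *: "(\<Sum>\<mu>\<in>{\<mu>\<in>K. \<mu> w = \<nu> w}. c \<mu> * (\<Prod>v\<in>V. x v ^ \<mu> v)) = (if \<nu> w = 0 then 0 else 0)" for x
  proof (rule sum_monomials_coeff[OF \<open>finite K\<close>])
    fix t :: complex
    have "(\<Prod>v\<in>V. (if v = w then t else x v) ^ \<mu> v) = (\<Prod>v\<in>V. x v ^ \<mu> v)" for \<mu>
      using insert.hyps by (intro prod.cong) auto
    then show "(\<Sum>\<mu>\<in>K. c \<mu> * (\<Prod>v\<in>V. x v ^ \<mu> v) * t ^ \<mu> w) = 0 * t ^ 0"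
      using insert.prems(2)[of "\<lambda>v. if v = w then t else x v"] insert.hyps
      by (simp add: mult_ac)
  qed
  have "(\<Sum>\<mu>\<in>{\<mu> \<in> {\<mu>\<in>K. \<mu> w = \<nu> w}. \<forall>v\<in>V. \<mu> v = \<nu> v}. c \<mu>) = 0"
    using insert.prems(1) * by (intro insert.hyps(3)) auto
  moreover have "{\<mu> \<in> {\<mu>\<in>K. \<mu> w = \<nu> w}. \<forall>v\<in>V. \<mu> v = \<nu> v} = {\<mu>\<in>K. \<forall>v\<in>insert w V. \<mu> v = \<nu> v}"
    by auto
  ultimately show ?case by simp
qed

text \<open>Over an infinite field polynomials are determined by their values; later identities
  between polynomials are therefore checked pointwise.\<close>

lemma peval_inject:
  assumes "\<And>X A. peval f X A = peval g X A"
  shows "f = g"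
proof -
  define h where "h = f - g"
  let ?K = "Poly_Mapping.lookup ` Poly_Mapping.keys h"
  let ?c = "\<lambda>\<mu>. Poly_Mapping.lookup h (Abs_poly_mapping \<mu>)"
  have "(\<Sum>\<mu>\<in>?K. ?c \<mu> * (\<Prod>v\<in>UNIV. x v ^ \<mu> v)) = 0" for x
  proof -
    have "peval h (\<chi> i j. x (XVar i j)) (\<chi> a i. x (AVar a i)) = 0"
      using assms by (simp add: h_def)
    moreover have "var_val (\<chi> i j. x (XVar i j)) (\<chi> a i. x (AVar a i)) v = x v" for v
      by (cases v) auto
    ultimately show ?thesis
      by (simp add: peval_mono_eval mono_eval_def sum.reindex inj_on_def lookup_inverse
          Poly_Mapping.lookup_inject)
  qed
  from monomials_independent[OF _ _ this]
  have *: "(\<Sum>\<mu>\<in>{\<mu>\<in>?K. \<forall>v\<in>UNIV. \<mu> v = \<nu> v}. ?c \<mu>) = 0" for \<nu>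
    by simp
  have "\<mu> \<notin> Poly_Mapping.keys h" for \<mu>
  proof
    assume \<mu>: "\<mu> \<in> Poly_Mapping.keys h"
    then have "{\<nu>\<in>?K. \<forall>v\<in>UNIV. \<nu> v = Poly_Mapping.lookup \<mu> v} = {Poly_Mapping.lookup \<mu>}"
      by (auto simp: fun_eq_iff)
    with *[of "Poly_Mapping.lookup \<mu>"] \<mu> show False
      by (simp add: lookup_inverse in_keys_iff)
  qed
  then have "h = 0" using keys_eq_empty by blast
  then show ?thesis by (simp add: h_def)
qed

text \<open>The rules \<open>polyfun_intros\<close> derive the existence of a polynomial behind a
  formula from the shape of the formula, without writing the polynomial down.\<close>

definition polyfun :: "(complex ^ 'm ^ 'm \<Rightarrow> complex ^ 'm ^ 'p \<Rightarrow> complex) \<Rightarrow> bool" where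
  "polyfun \<phi> \<longleftrightarrow> (\<exists>f :: ('m::finite, 'p::finite) cpoly. \<forall>X A. \<phi> X A = peval f X A)"

named_theorems polyfun_intros

lemma polyfun_peval [polyfun_intros]: "polyfun (peval f)"
  unfolding polyfun_def by auto

lemma polyfun_const [polyfun_intros]: "polyfun (\<lambda>X A. c)"
  unfolding polyfun_def by (rule exI[of _ "pscale c 1"]) simp

lemma polyfun_X [polyfun_intros]: "polyfun (\<lambda>X A. X $ i $ j)"
  unfolding polyfun_def by (rule exI[of _ "pvar (XVar i j)"]) simp

lemma polyfun_A [polyfun_intros]: "polyfun (\<lambda>X A. A $ a $ j)"
  unfolding polyfun_def by (rule exI[of _ "pvar (AVar a j)"]) simp

lemma polyfun_add [polyfun_intros]:
  assumes "polyfun \<phi>" "polyfun \<psi>" shows "polyfun (\<lambda>X A. \<phi> X A + \<psi> X A)"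
proof -
  obtain f g where "\<forall>X A. \<phi> X A = peval f X A" "\<forall>X A. \<psi> X A = peval g X A"
    using assms unfolding polyfun_def by auto
  then have "\<forall>X A. \<phi> X A + \<psi> X A = peval (f + g) X A" by simp
  then show ?thesis unfolding polyfun_def by blast
qed

lemma polyfun_mult [polyfun_intros]:
  assumes "polyfun \<phi>" "polyfun \<psi>" shows "polyfun (\<lambda>X A. \<phi> X A * \<psi> X A)"
proof -
  obtain f g where "\<forall>X A. \<phi> X A = peval f X A" "\<forall>X A. \<psi> X A = peval g X A"
    using assms unfolding polyfun_def by auto
  then have "\<forall>X A. \<phi> X A * \<psi> X A = peval (f * g) X A" by simp
  then show ?thesis unfolding polyfun_def by blast
qed

lemma polyfun_sum [polyfun_intros]:
  "(\<And>i. i \<in> I \<Longrightarrow> polyfun (\<phi> i)) \<Longrightarrow> polyfun (\<lambda>X A. \<Sum>i\<in>I. \<phi> i X A)"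
  by (induct I rule: infinite_finite_induct) (auto intro: polyfun_intros)

lemma polyfun_prod [polyfun_intros]:
  "(\<And>i. i \<in> I \<Longrightarrow> polyfun (\<phi> i)) \<Longrightarrow> polyfun (\<lambda>X A. \<Prod>i\<in>I. \<phi> i X A)"
  by (induct I rule: infinite_finite_induct) (auto intro: polyfun_intros)

lemma polyfun_power [polyfun_intros]:
  "polyfun \<phi> \<Longrightarrow> polyfun (\<lambda>X A. \<phi> X A ^ n)"
  by (induct n) (auto intro: polyfun_intros)

lemma polyfun_det [polyfun_intros]:
  "(\<And>i j. polyfun (\<lambda>X A. M X A $ i $ j)) \<Longrightarrow> polyfun (\<lambda>X A. det (M X A))"
  unfolding det_def by (intro polyfun_intros) auto

lemma polyfun_matmul [polyfun_intros]:
  assumes "\<And>i j. polyfun (\<lambda>X A. M X A $ i $ j)" "\<And>i j. polyfun (\<lambda>X A. N X A $ i $ j)"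
  shows "polyfun (\<lambda>X A. (M X A ** N X A) $ i $ j)"
  unfolding matrix_matrix_mult_def by (simp, intro polyfun_intros assms)

lemma polyfun_matpow [polyfun_intros]:
  assumes "\<And>i j. polyfun (\<lambda>X A. M X A $ i $ j)"
  shows "polyfun (\<lambda>X A. matpow (M X A) r $ i $ j)"
proof (induct r arbitrary: i j)
  case 0
  show ?case unfolding matpow.simps mat_def by (auto intro: polyfun_intros)
next
  case (Suc r)
  show ?case unfolding matpow.simps by (intro polyfun_intros assms Suc)
qed

lemma polyfun_prod_list [polyfun_intros]:
  "(\<And>i. i \<in> set is \<Longrightarrow> polyfun (\<phi> i)) \<Longrightarrow> polyfun (\<lambda>X A. \<Prod>i\<leftarrow>is. \<phi> i X A)"
  by (induct "is") (auto intro: polyfun_intros)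

lemma peval_matpow_Xmat [simp]:
  "peval (matpow Xmat r $ i $ j) X A = matpow X r $ i $ j"
proof (induct r arbitrary: i j)
  case 0
  show ?case by (simp add: mat_def)
next
  case (Suc r)
  then show ?case by (simp add: matrix_matrix_mult_def Xmat_def)
qed

lemma prod_UNIV_var:
  fixes h :: "('m::finite, 'p::finite) var \<Rightarrow> 'a::comm_monoid_mult"
  shows "(\<Prod>v\<in>UNIV. h v) = (\<Prod>i\<in>UNIV. \<Prod>j\<in>UNIV. h (XVar i j)) * (\<Prod>a\<in>UNIV. \<Prod>i\<in>UNIV. h (AVar a i))"
proof -
  have "(\<Prod>v\<in>UNIV. h v) = (\<Prod>v\<in>range (case_prod XVar). h v) * (\<Prod>v\<in>range (case_prod AVar). h v)"
    unfolding UNIV_var by (rule prod.union_disjoint) auto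
  also have "(\<Prod>v\<in>range (case_prod XVar). h v) = (\<Prod>i\<in>UNIV. \<Prod>j\<in>UNIV. h (XVar i j))"
    by (subst prod.reindex) (auto simp: inj_def prod.cartesian_product intro!: prod.cong)
  also have "(\<Prod>v\<in>range (case_prod AVar). h v) = (\<Prod>a\<in>UNIV. \<Prod>i\<in>UNIV. h (AVar a i))"
    by (subst prod.reindex) (auto simp: inj_def prod.cartesian_product intro!: prod.cong)
  finally show ?thesis .
qed

lemma sum_UNIV_var:
  fixes h :: "('m::finite, 'p::finite) var \<Rightarrow> 'a::comm_monoid_add"
  shows "(\<Sum>v\<in>UNIV. h v) = (\<Sum>i\<in>UNIV. \<Sum>j\<in>UNIV. h (XVar i j)) + (\<Sum>a\<in>UNIV. \<Sum>i\<in>UNIV. h (AVar a i))"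
proof -
  have "(\<Sum>v\<in>UNIV. h v) = (\<Sum>v\<in>range (case_prod XVar). h v) + (\<Sum>v\<in>range (case_prod AVar). h v)"
    unfolding UNIV_var by (rule sum.union_disjoint) auto
  also have "(\<Sum>v\<in>range (case_prod XVar). h v) = (\<Sum>i\<in>UNIV. \<Sum>j\<in>UNIV. h (XVar i j))"
    by (subst sum.reindex) (auto simp: inj_def sum.cartesian_product intro!: sum.cong)
  also have "(\<Sum>v\<in>range (case_prod AVar). h v) = (\<Sum>a\<in>UNIV. \<Sum>i\<in>UNIV. h (AVar a i))"
    by (subst sum.reindex) (auto simp: inj_def sum.cartesian_product intro!: sum.cong)
  finally show ?thesis .
qed

section \<open>Homogeneity as behaviour under scaling\<close>

definition Adegree :: "(('m::finite, 'p::finite) var \<Rightarrow>\<^sub>0 nat) \<Rightarrow> nat" where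
  "Adegree \<mu> = (\<Sum>a\<in>UNIV. \<Sum>i\<in>UNIV. Poly_Mapping.lookup \<mu> (AVar a i))"

lemma mono_eval_scale:
  "mono_eval \<mu> (mscale s X) (mscale t A) =
    s ^ Xdegree \<mu> * t ^ Adegree \<mu> * mono_eval \<mu> X A"
  by (simp add: mono_eval_def prod_UNIV_var power_mult_distrib prod.distrib power_sum
      Xdegree_def Adegree_def mult_ac)

lemma mono_eval_scale_X:
  "mono_eval \<mu> (mscale s X) A = s ^ Xdegree \<mu> * mono_eval \<mu> X A"
  using mono_eval_scale[of \<mu> s X 1 A] by simp

lemma mono_eval_scale_A:
  "mono_eval \<mu> X (mscale t A) = t ^ Adegree \<mu> * mono_eval \<mu> X A"
  using mono_eval_scale[of \<mu> 1 X t A] by simp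

text \<open>For the converse, comparing powers of \<open>s\<close> shows that the part of any other
  degree vanishes as a function, hence as a polynomial. The pointwise form passes through
  substitutions such as \<open>deflate\<close>.\<close>

lemma Xhomogeneous_iff:
  "Xhomogeneous d f \<longleftrightarrow>
    (\<forall>s X A. s \<noteq> 0 \<longrightarrow> peval f (mscale s X) A = s ^ d * peval f X A)"
proof
  assume "Xhomogeneous d f"
  then show "\<forall>s X A. s \<noteq> 0 \<longrightarrow> peval f (mscale s X) A = s ^ d * peval f X A"
    by (simp add: Xhomogeneous_def peval_mono_eval mono_eval_scale_X sum_distrib_left mult_ac)
next
  assume hom: "\<forall>s X A. s \<noteq> 0 \<longrightarrow> peval f (mscale s X) A = s ^ d * peval f X A"
  show "Xhomogeneous d f"
    unfolding Xhomogeneous_def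
  proof (rule ccontr)
    assume "\<not> (\<forall>\<mu>\<in>Poly_Mapping.keys f. Xdegree \<mu> = d)"
    then obtain \<nu> where \<nu>: "\<nu> \<in> Poly_Mapping.keys f" "Xdegree \<nu> \<noteq> d" by auto
    let ?K = "{\<mu>\<in>Poly_Mapping.keys f. Xdegree \<mu> = Xdegree \<nu>}"
    define g where "g = (\<Sum>\<mu>\<in>?K. Poly_Mapping.single \<mu> (Poly_Mapping.lookup f \<mu>))"
    have "peval g X A = peval 0 X A" for X A
    proof -
      have "(\<Sum>\<mu>\<in>?K. Poly_Mapping.lookup f \<mu> * mono_eval \<mu> X A) =
          (if Xdegree \<nu> = d then peval f X A else 0)"
      proof (rule sum_monomials_coeff)
        fix t :: complex assume "t \<noteq> 0"
        with hom have "peval f (mscale t X) A = t ^ d * peval f X A" by blast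
        then show "(\<Sum>\<mu>\<in>Poly_Mapping.keys f. Poly_Mapping.lookup f \<mu> * mono_eval \<mu> X A * t ^ Xdegree \<mu>)
            = peval f X A * t ^ d"
          by (simp add: peval_mono_eval[of f "mscale t X"] mono_eval_scale_X mult_ac)
      qed simp
      then show ?thesis using \<nu> by (simp add: g_def peval_single)
    qed
    then have "g = 0" by (rule peval_inject)
    then have "Poly_Mapping.lookup g \<nu> = 0" by simp
    then have "Poly_Mapping.lookup f \<nu> = 0"
      using \<nu> by (simp add: g_def lookup_sum lookup_single when_def)
    with \<nu> show False by (simp add: in_keys_iff)
  qed
qed

section \<open>Formal partial derivatives as analytic derivatives\<close>

lemma mono_eval_remove:
  assumes "Poly_Mapping.lookup \<mu> v \<noteq> 0"
  shows "mono_eval (\<mu> - Poly_Mapping.single v 1) X A =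
    var_val X A v ^ (Poly_Mapping.lookup \<mu> v - 1) *
      (\<Prod>w\<in>UNIV - {v}. var_val X A w ^ Poly_Mapping.lookup \<mu> w)"
  unfolding mono_eval_def
  by (subst prod.remove[of _ v]) (auto simp: lookup_minus lookup_single intro!: prod.cong)

lemma peval_pderiv_var:
  "peval (pderiv_var v f) X A = (\<Sum>\<mu>\<in>Poly_Mapping.keys f. Poly_Mapping.lookup f \<mu> *
     (of_nat (Poly_Mapping.lookup \<mu> v) * var_val X A v ^ (Poly_Mapping.lookup \<mu> v - 1) *
       (\<Prod>w\<in>UNIV - {v}. var_val X A w ^ Poly_Mapping.lookup \<mu> w)))"
  unfolding pderiv_var_def peval_sum
proof (rule sum.cong[OF refl], goal_cases)
  case (1 \<mu>)
  show ?case
    by (cases "Poly_Mapping.lookup \<mu> v = 0")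
      (simp_all add: peval_single mono_eval_remove[simplified] del: single_one)
qed

text \<open>Bridge from the formal \<open>pderiv_var\<close> to calculus: the Lie algebra action
  becomes a derivative along a line, and identities for it follow from uniqueness of
  derivatives.\<close>

lemma has_field_derivative_peval:
  "((\<lambda>t. peval f X (A + mscale t B)) has_field_derivative
     (\<Sum>b\<in>UNIV. \<Sum>j\<in>UNIV. B $ b $ j * peval (pderiv_var (AVar b j) f) X A)) (at 0)"
proof -
  let ?val = "\<lambda>t v. var_val X (A + mscale t B) v"
  \<comment> \<open>Velocity of each variable along the line: 0 for the entries of \<open>X\<close>,
    the entry of \<open>B\<close> for those of \<open>A\<close>.\<close>
  let ?d = "\<lambda>v. var_val 0 B v"
  have val0: "?val 0 v = var_val X A v" for v
    by (cases v) auto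
  have val: "((\<lambda>t. ?val t v) has_field_derivative ?d v) (at 0)" for v
    by (cases v) (auto intro!: derivative_eq_intros)
  have "((\<lambda>t. mono_eval \<mu> X (A + mscale t B)) has_field_derivative
      (\<Sum>v\<in>UNIV. ?d v * (of_nat (Poly_Mapping.lookup \<mu> v) * var_val X A v ^ (Poly_Mapping.lookup \<mu> v - 1) *
       (\<Prod>w\<in>UNIV - {v}. var_val X A w ^ Poly_Mapping.lookup \<mu> w)))) (at 0)" for \<mu>
  proof -
    have "((\<lambda>t. mono_eval \<mu> X (A + mscale t B)) has_field_derivative
        (\<Sum>v\<in>UNIV. of_nat (Poly_Mapping.lookup \<mu> v) *
          (?d v * ?val 0 v ^ (Poly_Mapping.lookup \<mu> v - Suc 0)) *
          (\<Prod>w\<in>UNIV - {v}. ?val 0 w ^ Poly_Mapping.lookup \<mu> w))) (at 0)"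
      unfolding mono_eval_def by (intro has_field_derivative_prod DERIV_power val)
    then show ?thesis by (simp add: val0 mult_ac)
  qed
  then have "((\<lambda>t. peval f X (A + mscale t B)) has_field_derivative
      (\<Sum>\<mu>\<in>Poly_Mapping.keys f. Poly_Mapping.lookup f \<mu> * (\<Sum>v\<in>UNIV. ?d v * (of_nat (Poly_Mapping.lookup \<mu> v) * var_val X A v ^ (Poly_Mapping.lookup \<mu> v - 1) *
       (\<Prod>w\<in>UNIV - {v}. var_val X A w ^ Poly_Mapping.lookup \<mu> w))))) (at 0)"
    unfolding peval_mono_eval by (intro DERIV_sum DERIV_cmult)
  also have "(\<Sum>\<mu>\<in>Poly_Mapping.keys f. Poly_Mapping.lookup f \<mu> * (\<Sum>v\<in>UNIV. ?d v * (of_nat (Poly_Mapping.lookup \<mu> v) * var_val X A v ^ (Poly_Mapping.lookup \<mu> v - 1) *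
       (\<Prod>w\<in>UNIV - {v}. var_val X A w ^ Poly_Mapping.lookup \<mu> w)))) =
      (\<Sum>v\<in>UNIV. ?d v * peval (pderiv_var v f) X A)"
    unfolding peval_pderiv_var sum_distrib_left by (subst sum.swap) (simp add: mult_ac)
  also have "\<dots> = (\<Sum>b\<in>UNIV. \<Sum>j\<in>UNIV. B $ b $ j * peval (pderiv_var (AVar b j) f) X A)"
    by (simp add: sum_UNIV_var)
  finally show ?thesis .
qed

section \<open>Determinants and antisymmetric tensors\<close>

lemma prod_if_one_zero:
  "finite A \<Longrightarrow> (\<Prod>i\<in>A. if P i then 1 else 0) = (if \<forall>i\<in>A. P i then 1 else (0 :: 'a::comm_semiring_1))"
  by (induct A rule: finite_induct) auto

text \<open>The Levi-Civita symbol, extended to arbitrary functions. Being the determinant of a 0-1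
  matrix, it can be multiplied by means of \<open>det_mul\<close>.\<close>

definition eps :: "('a::finite \<Rightarrow> 'a) \<Rightarrow> complex" where
  "eps x = det (\<chi> i j. if x i = j then 1 else 0)"

lemma eps_eq_sign: "eps x = (if x permutes UNIV then of_int (sign x) else 0)"
proof -
  have "eps x = (\<Sum>p | p permutes UNIV. of_int (sign p) * (if x = p then 1 else 0))"
    unfolding eps_def det_def by (simp add: prod_if_one_zero fun_eq_iff)
  also have "\<dots> = (\<Sum>p | p permutes UNIV. if p = x then of_int (sign p) else 0)"
    by (intro sum.cong) auto
  also have "\<dots> = (if x permutes UNIV then of_int (sign x) else 0)"
    by (simp add: finite_permutations)
  finally show ?thesis .
qed

lemma det_eps: "det M = (\<Sum>x\<in>UNIV. eps x * (\<Prod>c\<in>UNIV. M $ c $ x c))"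
proof -
  have "det M = (\<Sum>p\<in>{p. p permutes UNIV}. eps p * (\<Prod>c\<in>UNIV. M $ c $ p c))"
    unfolding det_def by (intro sum.cong) (auto simp: eps_eq_sign)
  also have "\<dots> = (\<Sum>x\<in>UNIV. eps x * (\<Prod>c\<in>UNIV. M $ c $ x c))"
    by (intro sum.mono_neutral_left) (auto simp: eps_eq_sign)
  finally show ?thesis .
qed

text \<open>The identity \<epsilon> \<epsilon> = det \<delta>: the matrix of \<open>x\<close> times
  the transposed matrix of \<open>y\<close> has a 1 exactly where \<open>x i = y j\<close>, and its
  determinant is expanded over \<open>\<pi>\<close>.\<close>

lemma eps_mult:
  "eps x * eps y = (\<Sum>\<pi> | \<pi> permutes UNIV. of_int (sign \<pi>) * (if x = y \<circ> \<pi> then 1 else 0))"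
proof -
  let ?E = "\<lambda>x :: 'a \<Rightarrow> 'a. (\<chi> i j. if x i = j then 1 else 0) :: complex ^ 'a ^ 'a"
  have "eps x * eps y = det (?E x ** transpose (?E y))"
    by (simp add: eps_def det_mul)
  also have "?E x ** transpose (?E y) = (\<chi> i j. if x i = y j then 1 else 0)"
  proof -
    have "(\<Sum>k\<in>UNIV. (if x i = k then 1 else 0) * (if y j = k then 1 else 0)) =
        (\<Sum>k\<in>UNIV. if k = x i then (if x i = y j then 1 else 0) else (0::complex))" for i j
      by (intro sum.cong) auto
    then show ?thesis
      by (simp add: vec_eq_iff matrix_matrix_mult_def transpose_def)
  qed
  also have "det \<dots> = (\<Sum>\<pi> | \<pi> permutes UNIV. of_int (sign \<pi>) * (if x = y \<circ> \<pi> then 1 else 0))"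
    unfolding det_def by (simp add: prod_if_one_zero fun_eq_iff)
  finally show ?thesis .
qed

lemma sum_PiE_curry:
  "(\<Sum>g\<in>PiE B (\<lambda>_. UNIV :: ('c \<Rightarrow> 'a) set). F g) =
    (\<Sum>x\<in>PiE (B \<times> UNIV) (\<lambda>_. UNIV). F (\<lambda>b\<in>B. \<lambda>c. x (b, c)))"
proof (rule sum.reindex_bij_witness[of _ "\<lambda>x. \<lambda>b\<in>B. \<lambda>c. x (b, c)" "\<lambda>g. \<lambda>v\<in>B \<times> UNIV. g (fst v) (snd v)"])
  fix g assume "g \<in> PiE B (\<lambda>_. UNIV :: ('c \<Rightarrow> 'a) set)"
  then show eq: "(\<lambda>b\<in>B. \<lambda>c. (\<lambda>v\<in>B \<times> UNIV. g (fst v) (snd v)) (b, c)) = g"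
    by (auto simp: fun_eq_iff PiE_def extensional_def)
  then show "F (\<lambda>b\<in>B. \<lambda>c. (\<lambda>v\<in>B \<times> UNIV. g (fst v) (snd v)) (b, c)) = F g"
    by (rule arg_cong)
qed (auto simp: fun_eq_iff PiE_def extensional_def)

text \<open>All determinants are expanded at once, with one index assignment for the union of their
  rows; such assignments later become the indices on the wires of a network.\<close>

lemma prod_det:
  assumes "finite B"
  shows "(\<Prod>b\<in>B. det (M b)) = (\<Sum>x\<in>PiE (B \<times> UNIV) (\<lambda>_. UNIV).
    (\<Prod>b\<in>B. eps (\<lambda>c. x (b, c))) * (\<Prod>v\<in>B \<times> UNIV. M (fst v) $ snd v $ x v))"
proof -
  have "(\<Prod>b\<in>B. det (M b)) = (\<Sum>g\<in>PiE B (\<lambda>_. UNIV). \<Prod>b\<in>B. eps (g b) * (\<Prod>c\<in>UNIV. M b $ c $ g b c))"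
    unfolding det_eps using assms by (subst prod_sum_PiE) auto
  also have "\<dots> = (\<Sum>x\<in>PiE (B \<times> UNIV) (\<lambda>_. UNIV).
    (\<Prod>b\<in>B. eps (\<lambda>c. x (b, c))) * (\<Prod>v\<in>B \<times> UNIV. M (fst v) $ snd v $ x v))"
    unfolding sum_PiE_curry
    by (intro sum.cong) (simp_all add: prod.distrib prod.cartesian_product split_def)
  finally show ?thesis .
qed

lemma prod_det_columns:
  assumes "finite B"
  shows "(\<Prod>b\<in>B. det (M b)) = (\<Sum>x\<in>PiE (B \<times> UNIV) (\<lambda>_. UNIV).
    (\<Prod>b\<in>B. eps (\<lambda>c. x (b, c))) * (\<Prod>v\<in>B \<times> UNIV. M (fst v) $ x v $ snd v))"
  using prod_det[OF assms, of "\<lambda>b. transpose (M b)"] by (simp only: det_transpose) (simp add: transpose_def)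

section \<open>Permanents by inclusion-exclusion\<close>

lemma sum_Pow_alternating:
  assumes "finite D"
  shows "(\<Sum>V\<in>Pow D. (- 1) ^ card V) = (if D = {} then 1 else (0 :: complex))"
  using prod_add[OF assms, of "\<lambda>_. - 1" "\<lambda>_. 1 :: complex"] assms
  by (cases "D = {}") (auto simp: power_0_left)

text \<open>Ryser's formula. Expanding the products gives maps \<open>g\<close> from
  \<open>S\<close> into \<open>U\<close>; the alternating sum over the sets \<open>U\<close> that
  contain the image of \<open>g\<close> vanishes unless this image is all of
  \<open>S\<close>.\<close>

lemma permanent_by_inclusion_exclusion:
  fixes h :: "'s \<Rightarrow> 's \<Rightarrow> complex"
  assumes "finite S"
  shows "(\<Sum>U\<in>Pow S. (- 1) ^ card (S - U) * (\<Prod>v\<in>S. \<Sum>q\<in>U. h v q)) =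
    (\<Sum>\<beta> | \<beta> permutes S. \<Prod>v\<in>S. h v (\<beta> v))"
proof -
  let ?G = "PiE S (\<lambda>_. S)"
  have fin: "finite ?G" using assms by (simp add: finite_PiE)
  have "(\<Prod>v\<in>S. \<Sum>q\<in>U. h v q) = (\<Sum>g\<in>?G. if g ` S \<subseteq> U then \<Prod>v\<in>S. h v (g v) else 0)"
    if "U \<in> Pow S" for U
  proof -
    have "finite U" using that assms finite_subset by auto
    then have "(\<Prod>v\<in>S. \<Sum>q\<in>U. h v q) = (\<Sum>g\<in>PiE S (\<lambda>_. U). \<Prod>v\<in>S. h v (g v))"
      using assms by (subst prod_sum_PiE) auto
    also have "PiE S (\<lambda>_. U) = {g\<in>?G. g ` S \<subseteq> U}"
      using that by (auto simp: PiE_def extensional_def image_subset_iff)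
    also have "(\<Sum>g\<in>\<dots>. \<Prod>v\<in>S. h v (g v)) = (\<Sum>g\<in>?G. if g ` S \<subseteq> U then \<Prod>v\<in>S. h v (g v) else 0)"
      using fin by (rule sum.inter_filter)
    finally show ?thesis .
  qed
  then have "(\<Sum>U\<in>Pow S. (- 1) ^ card (S - U) * (\<Prod>v\<in>S. \<Sum>q\<in>U. h v q)) =
      (\<Sum>g\<in>?G. \<Sum>U\<in>Pow S. (- 1) ^ card (S - U) * (if g ` S \<subseteq> U then \<Prod>v\<in>S. h v (g v) else 0))"
    by (subst sum.swap) (simp add: sum_distrib_left)
  also have "\<dots> = (\<Sum>g\<in>?G. if g ` S = S then \<Prod>v\<in>S. h v (g v) else 0)"
  proof (rule sum.cong[OF refl])
    fix g assume g: "g \<in> ?G"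
    have "(\<Sum>U\<in>Pow S. (- 1) ^ card (S - U) * (if g ` S \<subseteq> U then \<Prod>v\<in>S. h v (g v) else 0)) =
        (\<Sum>U\<in>{U\<in>Pow S. g ` S \<subseteq> U}. (- 1) ^ card (S - U) * (\<Prod>v\<in>S. h v (g v)))"
      using assms by (subst sum.inter_filter) (auto intro!: sum.cong)
    \<comment> \<open>Passing to the complement \<open>V = S - U\<close> makes this an alternating
      sum over all subsets of the points missed by \<open>g\<close>.\<close>
    also have "\<dots> = (\<Sum>V\<in>Pow (S - g ` S). (- 1) ^ card V * (\<Prod>v\<in>S. h v (g v)))"
      using g by (intro sum.reindex_bij_witness[of _ "\<lambda>V. S - V" "\<lambda>U. S - U"])
        (auto simp: double_diff PiE_iff)
    also have "\<dots> = (if S - g ` S = {} then 1 else 0) * (\<Prod>v\<in>S. h v (g v))"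
      using assms by (simp add: sum_Pow_alternating flip: sum_distrib_right)
    also have "\<dots> = (if g ` S = S then \<Prod>v\<in>S. h v (g v) else 0)"
      using g by (auto simp: PiE_iff)
    finally show "(\<Sum>U\<in>Pow S. (- 1) ^ card (S - U) * (if g ` S \<subseteq> U then \<Prod>v\<in>S. h v (g v) else 0)) =
        (if g ` S = S then \<Prod>v\<in>S. h v (g v) else 0)" .
  qed
  also have "\<dots> = (\<Sum>g\<in>{g\<in>?G. g ` S = S}. \<Prod>v\<in>S. h v (g v))"
    using fin by (simp add: sum.inter_filter)
  also have "\<dots> = (\<Sum>\<beta> | \<beta> permutes S. \<Prod>v\<in>S. h v (\<beta> v))"
  proof (rule sum.reindex_bij_witness[of _ "\<lambda>\<beta>. restrict \<beta> S" "\<lambda>g x. if x \<in> S then g x else x"])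
    fix g assume "g \<in> {g\<in>?G. g ` S = S}"
    then have g: "g \<in> ?G" "g ` S = S" by auto
    then have "bij_betw g S S"
      using assms by (simp add: bij_betw_def finite_surj_inj)
    then have "bij_betw (\<lambda>x. if x \<in> S then g x else x) S S"
      by (simp cong: bij_betw_cong)
    then show "(\<lambda>x. if x \<in> S then g x else x) \<in> {\<beta>. \<beta> permutes S}"
      by (auto intro: bij_imp_permutes)
    show "restrict (\<lambda>x. if x \<in> S then g x else x) S = g"
      using g by (auto simp: fun_eq_iff PiE_iff extensional_def)
  next
    fix \<beta> assume "\<beta> \<in> {\<beta>. \<beta> permutes S}"
    then show "(\<lambda>x. if x \<in> S then restrict \<beta> S x else x) = \<beta>"
      "restrict \<beta> S \<in> {g\<in>?G. g ` S = S}"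
      by (auto simp: fun_eq_iff permutes_not_in permutes_in_image permutes_image)
  qed (auto intro!: prod.cong)
  finally show ?thesis .
qed

section \<open>Determinants of block diagonal matrices\<close>

definition block_perm :: "'k \<Rightarrow> ('a \<Rightarrow> 'a) \<Rightarrow> 'a \<times> 'k \<Rightarrow> 'a \<times> 'k" where
  "block_perm \<kappa> \<pi> u = (if snd u = \<kappa> then (\<pi> (fst u), \<kappa>) else u)"

lemma block_perm_permutes:
  assumes "\<pi> permutes (UNIV :: 'a::finite set)"
  shows "block_perm (\<kappa> :: 'k::finite) \<pi> permutes UNIV"
proof -
  have "inj \<pi>" using assms permutes_inj by blast
  then have "inj (block_perm \<kappa> \<pi>)"
    by (intro injI) (auto simp: block_perm_def prod_eq_iff split: if_splits dest: injD)
  then show ?thesis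
    by (intro bij_imp_permutes) (auto simp: bij_def finite_UNIV_inj_surj)
qed

text \<open>A transposition placed on one slice is still a transposition, so the sign can be
  followed through a decomposition of \<open>\<pi>\<close> into transpositions.\<close>

lemma sign_block_perm:
  assumes "\<pi> permutes (UNIV :: 'a::finite set)"
  shows "sign (block_perm (\<kappa> :: 'k::finite) \<pi>) = sign \<pi>"
  using assms finite
proof (induct \<pi> rule: permutes_induct)
  case id
  have "block_perm \<kappa> (id :: 'a \<Rightarrow> 'a) = id" by (auto simp: block_perm_def fun_eq_iff)
  then show ?case by (simp only: sign_id)
next
  case (swap a b p)
  have "block_perm \<kappa> (Transposition.transpose a b \<circ> p) =
      Transposition.transpose (a, \<kappa>) (b, \<kappa>) \<circ> block_perm \<kappa> p"
    by (auto simp: block_perm_def fun_eq_iff Transposition.transpose_def)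
  moreover have "permutation (block_perm \<kappa> p)" "permutation p"
    using swap block_perm_permutes permutation_permutes by (auto intro!: permutes_imp_permutation[of UNIV])
  ultimately show ?case
    using swap by (simp add: sign_compose permutation_swap_id sign_swap_id del: o_apply comp_apply)
qed

text \<open>A colour-preserving permutation is the product of its restrictions to the slices, and
  its sign the product of theirs. If some slice is not a permutation, the whole map is not
  injective.\<close>

lemma eps_block: "eps (\<lambda>u :: 'a::finite \<times> 'k::finite. (y (snd u) (fst u), snd u)) = (\<Prod>\<kappa>\<in>UNIV. eps (y \<kappa>))"
proof (cases "\<forall>\<kappa>. y \<kappa> permutes UNIV")
  case True
  let ?X = "\<lambda>K u. if snd u \<in> K then (y (snd u) (fst u), snd u) else u"
  have "?X K permutes UNIV \<and> sign (?X K) = (\<Prod>\<kappa>\<in>K. sign (y \<kappa>))" for K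
  proof (induct K rule: infinite_finite_induct)
    case empty
    then show ?case by (simp flip: id_def add: permutes_id)
  next
    case (insert \<kappa> K)
    have "?X (insert \<kappa> K) = block_perm \<kappa> (y \<kappa>) \<circ> ?X K"
      using insert by (auto simp: block_perm_def fun_eq_iff)
    moreover have "permutation (block_perm \<kappa> (y \<kappa>))" "permutation (?X K)"
      using insert True block_perm_permutes by (auto intro!: permutes_imp_permutation[of UNIV])
    ultimately show ?case
      using insert True by (simp add: sign_compose sign_block_perm block_perm_permutes permutes_compose)
  qed simp
  from this[of UNIV] show ?thesis
    using True by (simp add: eps_eq_sign)
next
  case False
  then obtain \<kappa> where \<kappa>: "\<not> y \<kappa> permutes UNIV" by blast
  have "\<not> (\<lambda>u. (y (snd u) (fst u), snd u)) permutes UNIV"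
  proof
    assume "(\<lambda>u. (y (snd u) (fst u), snd u)) permutes UNIV"
    then have "inj (\<lambda>u. (y (snd u) (fst u), snd u))" using permutes_inj by blast
    then have "inj (y \<kappa>)" by (force simp: inj_def)
    then have "y \<kappa> permutes UNIV"
      by (intro bij_imp_permutes) (auto simp: bij_def finite_UNIV_inj_surj)
    with \<kappa> show False by simp
  qed
  moreover have "eps (y \<kappa>) = 0" using \<kappa> by (simp add: eps_eq_sign)
  then have "(\<Prod>\<kappa>\<in>UNIV. eps (y \<kappa>)) = 0" by (intro prod_zero) auto
  ultimately show ?thesis by (simp add: eps_eq_sign)
qed

text \<open>An index function that changes the colour somewhere hits a zero entry. A
  colour-preserving one amounts to one index function per colour, and \<open>eps_block\<close>
  splits its sign.\<close>

lemma det_block: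
  fixes M :: "'k::finite \<Rightarrow> complex ^ 'a ^ ('a::finite)"
  shows "det (\<chi> u v. if snd u = snd v then M (snd u) $ fst u $ fst v else 0) = (\<Prod>\<kappa>\<in>UNIV. det (M \<kappa>))"
proof -
  let ?X = "\<lambda>x :: 'k \<times> 'a \<Rightarrow> 'a. \<lambda>u :: 'a \<times> 'k. (x (snd u, fst u), snd u)"
  have "inj ?X" by (auto simp: inj_def fun_eq_iff)
  have "det (\<chi> u v. if snd u = snd v then M (snd u) $ fst u $ fst v else 0) =
      (\<Sum>X\<in>UNIV. eps X * (\<Prod>u\<in>UNIV. if snd u = snd (X u) then M (snd u) $ fst u $ fst (X u) else 0))"
    by (simp add: det_eps)
  also have "\<dots> = (\<Sum>X\<in>range ?X. eps X * (\<Prod>u\<in>UNIV. if snd u = snd (X u) then M (snd u) $ fst u $ fst (X u) else 0))"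
  proof (rule sum.mono_neutral_right)
    show "\<forall>X\<in>UNIV - range ?X. eps X *
        (\<Prod>u\<in>UNIV. if snd u = snd (X u) then M (snd u) $ fst u $ fst (X u) else 0) = 0"
    proof
      fix X assume "X \<in> UNIV - range ?X"
      then have "X \<noteq> ?X (\<lambda>(\<kappa>, c). fst (X (c, \<kappa>)))" by blast
      then obtain u where "snd u \<noteq> snd (X u)" by (fastforce simp: fun_eq_iff prod_eq_iff)
      then have "\<exists>u\<in>UNIV. (if snd u = snd (X u) then M (snd u) $ fst u $ fst (X u) else 0) = 0"
        by (intro bexI[of _ u]) auto
      then have "(\<Prod>u\<in>UNIV. if snd u = snd (X u) then M (snd u) $ fst u $ fst (X u) else 0) = 0"
        by (intro prod_zero) auto
      then show "eps X * (\<Prod>u\<in>UNIV. if snd u = snd (X u) then M (snd u) $ fst u $ fst (X u) else 0) = 0"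
        by simp
    qed
  qed auto
  also have "\<dots> = (\<Sum>x\<in>UNIV. eps (?X x) * (\<Prod>u\<in>UNIV. M (snd u) $ fst u $ x (snd u, fst u)))"
    using \<open>inj ?X\<close> by (simp add: sum.reindex)
  also have "\<dots> = (\<Sum>x\<in>UNIV. (\<Prod>\<kappa>\<in>UNIV. eps (\<lambda>c. x (\<kappa>, c))) * (\<Prod>v\<in>UNIV. M (fst v) $ snd v $ x v))"
  proof (rule sum.cong[OF refl])
    fix x :: "'k \<times> 'a \<Rightarrow> 'a"
    have "(\<Prod>u\<in>UNIV. M (snd u) $ fst u $ x (snd u, fst u)) = (\<Prod>v\<in>UNIV. M (fst v) $ snd v $ x v)"
      by (rule prod.reindex_bij_witness[of _ prod.swap prod.swap]) auto
    then show "eps (?X x) * (\<Prod>u\<in>UNIV. M (snd u) $ fst u $ x (snd u, fst u)) =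
        (\<Prod>\<kappa>\<in>UNIV. eps (\<lambda>c. x (\<kappa>, c))) * (\<Prod>v\<in>UNIV. M (fst v) $ snd v $ x v)"
      using eps_block[of "\<lambda>\<kappa> c. x (\<kappa>, c)"] by simp
  qed
  also have "\<dots> = (\<Prod>\<kappa>\<in>UNIV. det (M \<kappa>))"
    by (subst prod_det) (auto simp: PiE_UNIV_domain)
  finally show ?thesis .
qed

section \<open>Contractions of matrices and rows with antisymmetric tensors\<close>

lemma sum_PiE_insert:
  assumes "s \<notin> S"
  shows "(\<Sum>x\<in>PiE (insert s S) (\<lambda>_. UNIV). F x) = (\<Sum>x\<in>PiE S (\<lambda>_. UNIV). \<Sum>z\<in>UNIV. F (x(s := z)))"
proof -
  have "(\<Sum>x\<in>PiE (insert s S) (\<lambda>_. UNIV). F x) =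
      (\<Sum>(x, z)\<in>PiE S (\<lambda>_. UNIV) \<times> UNIV. F (x(s := z)))"
    using assms
    by (intro sum.reindex_bij_witness[of _ "\<lambda>(x, z). x(s := z)" "\<lambda>x. (x(s := undefined), x s)"])
      (auto simp: PiE_def extensional_def)
  then show ?thesis by (simp add: sum.cartesian_product)
qed

text \<open>A tensor network with wires \<open>R \<union> T\<close>: the wire \<open>r \<in> R\<close> starts at the column index of the matrix
  \<open>M r\<close>, the wire \<open>t \<in> T\<close> at the row vector \<open>L t\<close>. Wires of the form \<open>p r\<close> end at the row index of
  \<open>M r\<close>, those of the form \<open>q \<kappa> c\<close> at the \<open>\<kappa>\<close>-th antisymmetric tensor.\<close>

definition contraction ::
  "('k::finite \<Rightarrow> 'N \<Rightarrow> 's) \<Rightarrow> ('s \<Rightarrow> 's) \<Rightarrow> 's set \<Rightarrow> 's set \<Rightarrow>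
    ('s \<Rightarrow> complex ^ 'N ^ 'N) \<Rightarrow> ('s \<Rightarrow> complex ^ ('N::finite)) \<Rightarrow> complex" where
  "contraction q p R T M L = (\<Sum>x\<in>PiE (R \<union> T) (\<lambda>_. UNIV).
     (\<Prod>\<kappa>\<in>UNIV. eps (\<lambda>c. x (q \<kappa> c))) * (\<Prod>r\<in>R. M r $ x (p r) $ x r) * (\<Prod>t\<in>T. L t $ x t))"

text \<open>Each wire has exactly one end: \<open>p\<close> and \<open>q\<close> together are a
  bijection from the matrices and the slots of the tensors onto the wires. In particular there are
  as many rows in \<open>T\<close> as slots.\<close>

definition network :: "('k::finite \<Rightarrow> 'N::finite \<Rightarrow> 's) \<Rightarrow> ('s \<Rightarrow> 's) \<Rightarrow> 's set \<Rightarrow> 's set \<Rightarrow> bool" where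
  "network q p R T \<longleftrightarrow> finite R \<and> finite T \<and> R \<inter> T = {} \<and> inj_on p R \<and> inj (case_prod q) \<and>
     p ` R \<inter> range (case_prod q) = {} \<and> p ` R \<union> range (case_prod q) = R \<union> T"

text \<open>The wire \<open>r\<close> occurs only in the entry of \<open>M r\<close>, as row and as
  column index; summing over its index leaves the trace.\<close>

lemma contraction_loop:
  assumes net: "network q p R T" and r: "r \<in> R" "p r = r"
  shows "contraction q p R T M L = trace (M r) * contraction q p (R - {r}) T M L"
proof -
  let ?S = "(R - {r}) \<union> T"
  have S: "R \<union> T = insert r ?S" "r \<notin> ?S" and fin: "finite R" and "r \<notin> T"
    using net r by (auto simp: network_def)
  have q: "q \<kappa> c \<noteq> r" for \<kappa> c
    using net r unfolding network_def by (metis IntI case_prod_conv empty_iff imageI rangeI)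
  have p: "p r' \<noteq> r" if "r' \<in> R - {r}" for r'
    using net r that unfolding network_def inj_on_def by (metis DiffE singletonI)
  have "(\<Prod>\<kappa>\<in>UNIV. eps (\<lambda>c. (x(r := z)) (q \<kappa> c))) * (\<Prod>r'\<in>R. M r' $ (x(r := z)) (p r') $ (x(r := z)) r')
       * (\<Prod>t\<in>T. L t $ (x(r := z)) t) =
      M r $ z $ z * ((\<Prod>\<kappa>\<in>UNIV. eps (\<lambda>c. x (q \<kappa> c))) * (\<Prod>r'\<in>R - {r}. M r' $ x (p r') $ x r')
       * (\<Prod>t\<in>T. L t $ x t))" for x z
  proof -
    have "(\<Prod>r'\<in>R. M r' $ (x(r := z)) (p r') $ (x(r := z)) r') =
        M r $ z $ z * (\<Prod>r'\<in>R - {r}. M r' $ x (p r') $ x r')"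
      using fin r p by (subst prod.remove[of _ r]) (auto intro!: prod.cong)
    moreover have "(\<Prod>t\<in>T. L t $ (x(r := z)) t) = (\<Prod>t\<in>T. L t $ x t)"
      using \<open>r \<notin> T\<close> by (intro prod.cong) auto
    ultimately show ?thesis using q by (simp add: mult_ac)
  qed
  then show ?thesis
    unfolding contraction_def S(1) sum_PiE_insert[OF S(2)]
    by (simp add: trace_def flip: sum_distrib_left sum_distrib_right)
qed

lemma network_remove:
  assumes net: "network q p R T" and p': "inj_on p' (R - {s})" "p' ` (R - {s}) = p ` R - {s}"
    and s: "s \<in> R" "s \<in> p ` R"
  shows "network q p' (R - {s}) T"
proof -
  define Q where "Q = range (case_prod q)"
  have *: "p ` R \<inter> Q = {}" "p ` R \<union> Q = R \<union> T" "R \<inter> T = {}"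
    using net by (simp_all add: network_def Q_def)
  have "s \<notin> Q" "s \<notin> T" using * s by blast+
  then have "(p ` R - {s}) \<union> Q = (R - {s}) \<union> T" "(p ` R - {s}) \<inter> Q = {}" "(R - {s}) \<inter> T = {}"
    using * by blast+
  then show ?thesis
    using net p' by (simp add: network_def Q_def)
qed

lemma network_loop:
  assumes "network q p R T" "r \<in> R" "p r = r"
  shows "network q p (R - {r}) T"
proof -
  have "p ` (R - {r}) = p ` R - {r}" using assms by (auto simp: network_def inj_on_def)
  moreover have "inj_on p (R - {r})" using assms by (auto simp: network_def inj_on_def)
  moreover have "r \<in> p ` R" using assms by force
  ultimately show ?thesis using assms by (intro network_remove)
qed

text \<open>The wire \<open>s\<close> occurs only as column index of \<open>M s\<close> and as row
  index of \<open>M r\<close>, so summing over its index performs the matrix product, which takes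
  over the name \<open>r\<close>.\<close>

lemma contraction_merge:
  assumes net: "network q p R T" and r: "r \<in> R" "p r = s" "s \<in> R" "s \<noteq> r"
  shows "contraction q p R T M L =
    contraction q (p(r := p s)) (R - {s}) T (M(r := M s ** M r)) L"
proof -
  let ?S = "(R - {s}) \<union> T"
  let ?p = "p(r := p s)" and ?M = "M(r := M s ** M r)"
  have S: "R \<union> T = insert s ?S" "s \<notin> ?S" and fin: "finite R" and "s \<notin> T"
    using net r by (auto simp: network_def)
  have q: "q \<kappa> c \<noteq> s" for \<kappa> c
    using net r unfolding network_def by (metis IntI case_prod_conv empty_iff imageI rangeI)
  have p: "p r' \<noteq> s" if "r' \<in> R" "r' \<noteq> r" for r'
    using net r that unfolding network_def inj_on_def by metis
  have "(\<Sum>z\<in>UNIV. (\<Prod>\<kappa>\<in>UNIV. eps (\<lambda>c. (x(s := z)) (q \<kappa> c))) *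
        (\<Prod>r'\<in>R. M r' $ (x(s := z)) (p r') $ (x(s := z)) r') * (\<Prod>t\<in>T. L t $ (x(s := z)) t)) =
      (\<Prod>\<kappa>\<in>UNIV. eps (\<lambda>c. x (q \<kappa> c))) * (\<Prod>r'\<in>R - {s}. ?M r' $ x (?p r') $ x r')
       * (\<Prod>t\<in>T. L t $ x t)" for x
  proof -
    have "(\<Prod>r'\<in>R. M r' $ (x(s := z)) (p r') $ (x(s := z)) r') =
        M s $ x (p s) $ z * M r $ z $ x r * (\<Prod>r'\<in>R - {s} - {r}. M r' $ x (p r') $ x r')" for z
    proof -
      have "(\<Prod>r'\<in>R. M r' $ (x(s := z)) (p r') $ (x(s := z)) r') =
        M s $ x (p s) $ z * (M r $ z $ x r * (\<Prod>r'\<in>R - {s} - {r}. M r' $ (x(s := z)) (p r') $ (x(s := z)) r'))"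
        using fin r p by (subst prod.remove[of _ s], simp, simp, subst prod.remove[of _ r]) auto
      also have "(\<Prod>r'\<in>R - {s} - {r}. M r' $ (x(s := z)) (p r') $ (x(s := z)) r') =
          (\<Prod>r'\<in>R - {s} - {r}. M r' $ x (p r') $ x r')"
        using p by (intro prod.cong) auto
      finally show ?thesis by (simp add: mult_ac)
    qed
    moreover have "(\<Prod>t\<in>T. L t $ (x(s := z)) t) = (\<Prod>t\<in>T. L t $ x t)" for z
      using \<open>s \<notin> T\<close> by (intro prod.cong) auto
    moreover have "(\<Prod>r'\<in>R - {s}. ?M r' $ x (?p r') $ x r') =
        (\<Sum>z\<in>UNIV. M s $ x (p s) $ z * M r $ z $ x r) * (\<Prod>r'\<in>R - {s} - {r}. M r' $ x (p r') $ x r')"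
      using fin r by (subst prod.remove[of _ r]) (auto simp: matrix_matrix_mult_def intro!: prod.cong)
    ultimately show ?thesis using q by (simp add: sum_distrib_left sum_distrib_right mult_ac)
  qed
  then show ?thesis
    unfolding contraction_def S(1) sum_PiE_insert[OF S(2)] by simp
qed

lemma network_merge:
  assumes net: "network q p R T" and r: "r \<in> R" "p r = s" "s \<in> R" "s \<noteq> r"
  shows "network q (p(r := p s)) (R - {s}) T"
proof -
  have p: "inj_on p R" using net by (simp add: network_def)
  have inj: "inj_on (p(r := p s)) (R - {s})"
    using p r by (auto simp: inj_on_def)
  have "(p(r := p s)) ` (R - {s}) = p ` R - {s}"
  proof -
    have "(p(r := p s)) ` (R - {s}) = insert (p s) (p ` (R - {s, r}))"
      using r by (auto simp: image_iff)
    also have "\<dots> = p ` (R - {r})" using r by auto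
    also have "\<dots> = p ` R - {s}" using p r by (auto simp: inj_on_def)
    finally show ?thesis .
  qed
  moreover have "s \<in> p ` R" using r by blast
  ultimately show ?thesis using net inj r by (intro network_remove)
qed

text \<open>Summing over the index of \<open>t\<close> multiplies the row \<open>L t\<close> by
  \<open>M r\<close>. The product is a row at which the wire \<open>r\<close> now starts, so
  \<open>r\<close> moves from \<open>R\<close> to \<open>T\<close>.\<close>

lemma contraction_absorb:
  assumes net: "network q p R T" and r: "r \<in> R" "p r = t" "t \<in> T"
  shows "contraction q p R T M L =
    contraction q p (R - {r}) (insert r (T - {t})) M (L(r := \<chi> j. \<Sum>i\<in>UNIV. L t $ i * M r $ i $ j))"
proof -
  let ?S = "(R - {r}) \<union> insert r (T - {t})"
  let ?L = "L(r := \<chi> j. \<Sum>i\<in>UNIV. L t $ i * M r $ i $ j)"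
  have S: "R \<union> T = insert t ?S" "t \<notin> ?S" and fin: "finite R" "finite T" and "t \<notin> R" "r \<notin> T"
    using net r by (auto simp: network_def)
  have q: "q \<kappa> c \<noteq> t" for \<kappa> c
    using net r unfolding network_def by (metis IntI case_prod_conv empty_iff imageI rangeI)
  have p: "p r' \<noteq> t" if "r' \<in> R" "r' \<noteq> r" for r'
    using net r that unfolding network_def inj_on_def by metis
  have "(\<Sum>z\<in>UNIV. (\<Prod>\<kappa>\<in>UNIV. eps (\<lambda>c. (x(t := z)) (q \<kappa> c))) *
        (\<Prod>r'\<in>R. M r' $ (x(t := z)) (p r') $ (x(t := z)) r') * (\<Prod>t'\<in>T. L t' $ (x(t := z)) t')) =
      (\<Prod>\<kappa>\<in>UNIV. eps (\<lambda>c. x (q \<kappa> c))) * (\<Prod>r'\<in>R - {r}. M r' $ x (p r') $ x r')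
       * (\<Prod>t'\<in>insert r (T - {t}). ?L t' $ x t')" for x
  proof -
    have "(\<Prod>r'\<in>R. M r' $ (x(t := z)) (p r') $ (x(t := z)) r') =
        M r $ z $ x r * (\<Prod>r'\<in>R - {r}. M r' $ x (p r') $ x r')" for z
    proof -
      have "(\<Prod>r'\<in>R - {r}. M r' $ (x(t := z)) (p r') $ (x(t := z)) r') =
          (\<Prod>r'\<in>R - {r}. M r' $ x (p r') $ x r')"
        using p \<open>t \<notin> R\<close> by (intro prod.cong) auto
      then show ?thesis
        using fin r \<open>t \<notin> R\<close> by (subst prod.remove[of _ r]) auto
    qed
    moreover have "(\<Prod>t'\<in>T. L t' $ (x(t := z)) t') = L t $ z * (\<Prod>t'\<in>T - {t}. L t' $ x t')" for z
      using fin r by (subst prod.remove[of _ t]) (auto intro!: prod.cong)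
    moreover have "(\<Prod>t'\<in>insert r (T - {t}). ?L t' $ x t') =
        (\<Sum>z\<in>UNIV. L t $ z * M r $ z $ x r) * (\<Prod>t'\<in>T - {t}. L t' $ x t')"
    proof -
      have "(\<Prod>t'\<in>T - {t}. ?L t' $ x t') = (\<Prod>t'\<in>T - {t}. L t' $ x t')"
        using \<open>r \<notin> T\<close> by (intro prod.cong) auto
      then show ?thesis
        using fin \<open>r \<notin> T\<close> by (subst prod.insert) auto
    qed
    ultimately show ?thesis using q by (simp add: sum_distrib_left sum_distrib_right mult_ac)
  qed
  then show ?thesis
    unfolding contraction_def S(1) sum_PiE_insert[OF S(2)] by simp
qed

lemma network_absorb:
  assumes net: "network q p R T" and r: "r \<in> R" "p r = t" "t \<in> T"
  shows "network q p (R - {r}) (insert r (T - {t}))"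
proof -
  have "p ` (R - {r}) = p ` R - {t}" using net r by (auto simp: network_def inj_on_def)
  moreover have "inj_on p (R - {r})" using net by (auto simp: network_def inj_on_def)
  moreover have "t \<notin> range (case_prod q)" "r \<notin> T" "t \<in> p ` R" "t \<notin> R"
    using net r unfolding network_def by blast+
  moreover have "finite (R - {r})" "finite (insert r (T - {t}))"
    using net by (auto simp: network_def)
  ultimately show ?thesis using net r unfolding network_def by blast
qed

text \<open>Without matrices the wires are exactly the slots of the tensors, and the sum is the
  Leibniz expansion of the determinants.\<close>

lemma contraction_base:
  fixes q :: "'k::finite \<Rightarrow> 'N::finite \<Rightarrow> 's"
  assumes "network q p {} T"
  shows "contraction q p {} T M L = (\<Prod>\<kappa>\<in>UNIV. det (\<chi> c. L (q \<kappa> c)))"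
proof -
  have T: "T = range (case_prod q)" and inj: "inj (case_prod q)"
    using assms by (auto simp: network_def)
  let ?i = "the_inv (case_prod q)"
  have q: "?i (q \<kappa> c) = (\<kappa>, c)" for \<kappa> c
    using the_inv_f_f[OF inj, of "(\<kappa>, c)"] by simp
  have "contraction q p {} T M L =
      (\<Sum>x\<in>UNIV. (\<Prod>\<kappa>\<in>UNIV. eps (\<lambda>c. x (\<kappa>, c))) * (\<Prod>v\<in>UNIV. L (case_prod q v) $ x v))"
    unfolding contraction_def
  proof (rule sum.reindex_bij_witness[of _ "\<lambda>x. \<lambda>t\<in>T. x (?i t)" "\<lambda>x v. x (case_prod q v)"])
    fix x assume "x \<in> PiE ({} \<union> T) (\<lambda>_. UNIV :: 'N set)"
    then show "(\<lambda>t\<in>T. x (case_prod q (?i t))) = x"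
      by (auto simp: T q fun_eq_iff PiE_def extensional_def restrict_def)
    show "(\<Prod>\<kappa>\<in>UNIV. eps (\<lambda>c. x (case_prod q (\<kappa>, c)))) * (\<Prod>v\<in>UNIV. L (case_prod q v) $ x (case_prod q v)) =
        (\<Prod>\<kappa>\<in>UNIV. eps (\<lambda>c. x (q \<kappa> c))) * (\<Prod>r\<in>{}. M r $ x (p r) $ x r) * (\<Prod>t\<in>T. L t $ x t)"
      unfolding T by (subst prod.reindex[OF inj]) simp
  next
    fix x :: "'k \<times> 'N \<Rightarrow> 'N"
    show "(\<lambda>v. (\<lambda>t\<in>T. x (?i t)) (case_prod q v)) = x"
      by (auto simp: T q fun_eq_iff)
  qed (auto simp: T)
  also have "\<dots> = (\<Prod>\<kappa>\<in>UNIV. det (\<chi> c. L (q \<kappa> c)))"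
    by (subst prod_det) (auto simp: PiE_UNIV_domain split_def)
  finally show ?thesis .
qed

lemma matpow_add: "matpow B (r + s) = matpow B r ** matpow B s"
  by (induct r) (simp_all add: matrix_mul_assoc)

text \<open>Each of the three moves removes one matrix and leads again to powers of \<open>X\<close>
  and to rows of A X^e, hence the induction on \<open>card R\<close> with arbitrary exponents. The
  resulting exponents and row labels are chosen before \<open>X\<close> and
  \<open>A\<close>.\<close>

lemma contraction_eq_traces_dets:
  assumes "network (q :: 'k::finite \<Rightarrow> 'N::finite \<Rightarrow> 's) p R T"
  shows "\<exists>ms a' e'. \<forall>X (A :: complex ^ 'N ^ 'n).
    contraction q p R T (\<lambda>r. matpow X (m r)) (\<lambda>t. (A ** matpow X (e t)) $ a t) =
    (\<Prod>m\<leftarrow>ms. trace (matpow X m)) * (\<Prod>\<kappa>\<in>(UNIV :: 'k set). det (\<chi> c. (A ** matpow X (e' \<kappa> c)) $ a' \<kappa> c))"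
  using assms
proof (induct "card R" arbitrary: p R T m e a)
  case 0
  then have "R = {}" by (auto simp: network_def)
  then have "contraction q p R T (\<lambda>r. matpow X (m r)) (\<lambda>t. (A ** matpow X (e t)) $ a t) =
      (\<Prod>m\<leftarrow>[]. trace (matpow X m)) *
        (\<Prod>\<kappa>\<in>(UNIV :: 'k set). det (\<chi> c. (A ** matpow X (e (q \<kappa> c))) $ a (q \<kappa> c)))"
    for X and A :: "complex ^ 'N ^ 'n"
    using 0 contraction_base by simp
  note base = this
  show ?case by (intro exI allI) (rule base)
next
  case (Suc n)
  have fin: "finite R" using Suc.prems unfolding network_def by blast
  have "R \<noteq> {}" using Suc.hyps(2) by auto
  then obtain r where r: "r \<in> R" by blast
  then have "p r \<in> R \<union> T" using Suc.prems unfolding network_def by blast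
  \<comment> \<open>The start of the wire that ends at \<open>M r\<close> decides which move
    applies.\<close>
  then consider "p r = r" | "p r \<in> R" "p r \<noteq> r" | "p r \<in> T" by auto
  then show ?case
  proof cases
    case 1
    have "n = card (R - {r})" using Suc.hyps(2) r fin by simp
    from Suc.hyps(1)[OF this network_loop[OF Suc.prems r 1], of m e a]
    obtain ms a' e' where "\<forall>X A. contraction q p (R - {r}) T (\<lambda>r. matpow X (m r)) (\<lambda>t. (A ** matpow X (e t)) $ a t) =
      (\<Prod>m\<leftarrow>ms. trace (matpow X m)) * (\<Prod>\<kappa>\<in>(UNIV :: 'k set). det (\<chi> c. (A ** matpow X (e' \<kappa> c)) $ a' \<kappa> c))"
      by blast
    then show ?thesis
      by (intro exI[of _ "m r # ms"] exI[of _ a'] exI[of _ e'])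
        (simp add: contraction_loop[OF Suc.prems r 1] mult.assoc)
  next
    case 2
    have "n = card (R - {p r})" using Suc.hyps(2) 2 fin by simp
    note IH = Suc.hyps(1)[OF this network_merge[OF Suc.prems r refl 2], of "m(r := m (p r) + m r)" e a]
    have "(\<lambda>r. matpow X (m r))(r := matpow X (m (p r)) ** matpow X (m r)) =
        (\<lambda>r'. matpow X ((m(r := m (p r) + m r)) r'))" for X :: "complex ^ 'N ^ 'N"
      by (auto simp: matpow_add)
    then show ?thesis
      using IH by (simp only: contraction_merge[OF Suc.prems r refl 2])
  next
    case 3
    have "n = card (R - {r})" using Suc.hyps(2) r fin by simp
    note IH = Suc.hyps(1)[OF this network_absorb[OF Suc.prems r refl 3],
        of m "e(r := e (p r) + m r)" "a(r := a (p r))"]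
    have "(\<lambda>t. (A ** matpow X (e t)) $ a t)(r := \<chi> j. \<Sum>i\<in>UNIV. (A ** matpow X (e (p r))) $ a (p r) $ i * matpow X (m r) $ i $ j) =
        (\<lambda>t. (A ** matpow X ((e(r := e (p r) + m r)) t)) $ (a(r := a (p r))) t)"
      for X and A :: "complex ^ 'N ^ 'n"
      by (auto simp: matpow_add matrix_mul_assoc fun_eq_iff vec_eq_iff)
        (simp add: matrix_matrix_mult_def)
    then show ?thesis
      using IH by (simp only: contraction_absorb[OF Suc.prems r refl 3])
  qed
qed

section \<open>The Omega process\<close>

lemma sum_PiE_permute:
  fixes F :: "('s \<Rightarrow> 'b) \<Rightarrow> 'c::comm_monoid_add"
  assumes "\<beta> permutes S"
  shows "(\<Sum>x\<in>PiE S (\<lambda>_. UNIV). F x) = (\<Sum>x\<in>PiE S (\<lambda>_. UNIV). F (restrict (x \<circ> \<beta>) S))"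
proof (rule sum.reindex_bij_witness[of _ "\<lambda>x. restrict (x \<circ> \<beta>) S" "\<lambda>x. restrict (x \<circ> inv \<beta>) S"])
  have \<beta>: "\<beta> v \<in> S \<longleftrightarrow> v \<in> S" "inv \<beta> v \<in> S \<longleftrightarrow> v \<in> S" "\<beta> (inv \<beta> v) = v" "inv \<beta> (\<beta> v) = v" for v
    using assms permutes_in_image[OF assms] permutes_in_image[OF permutes_inv[OF assms]]
      permutes_inverses[OF assms] by auto
  fix x assume "x \<in> PiE S (\<lambda>_. UNIV :: 'b set)"
  then show eq: "restrict (restrict (x \<circ> inv \<beta>) S \<circ> \<beta>) S = x"
    "restrict (restrict (x \<circ> \<beta>) S \<circ> inv \<beta>) S = x"
    by (auto simp: fun_eq_iff PiE_def extensional_def \<beta>)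
  then show "F (restrict (restrict (x \<circ> inv \<beta>) S \<circ> \<beta>) S) = F x" by simp
qed auto

definition block_eps :: "'b set \<Rightarrow> ('b \<times> 'N::finite \<Rightarrow> 'N) \<Rightarrow> complex" where
  "block_eps B x = (\<Prod>b\<in>B. eps (\<lambda>c. x (b, c)))"

lemma block_eps_cong: "(\<And>v. v \<in> B \<times> UNIV \<Longrightarrow> x v = y v) \<Longrightarrow> block_eps B x = block_eps B y"
  unfolding block_eps_def by (intro prod.cong arg_cong[of _ _ eps]) auto

lemma block_eps_restrict [simp]: "block_eps B (restrict x (B \<times> UNIV)) = block_eps B x"
  by (rule block_eps_cong) simp

text \<open>Realness makes the squares in \<open>polarize_det_power\<close> nonnegative.\<close>

lemma block_eps_real: "block_eps B x = of_real (Re (block_eps B x))"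
proof -
  have "eps z \<in> \<real>" for z :: "'b \<Rightarrow> 'b" by (simp add: eps_eq_sign)
  then have "block_eps B x \<in> \<real>" unfolding block_eps_def by (intro prod_in_Reals)
  then show ?thesis by (simp add: of_real_Re)
qed

text \<open>Up to a scalar, \<open>polarize B G\<close> is the pairing of \<open>G\<close>, homogeneous of degree \<open>card B * N\<close>,
  with \<open>det ^ card B\<close>, that is Cayley's Omega process. The alternating sum over \<open>U\<close> extracts the
  multilinear part of \<open>G\<close> at the matrix units chosen by \<open>x\<close>.\<close>

definition unit_sum :: "('b \<times> 'N::finite \<Rightarrow> 'N) \<Rightarrow> ('b \<times> 'N) set \<Rightarrow> complex ^ 'N ^ 'N" where
  "unit_sum x U = (\<chi> z c. \<Sum>q\<in>U. if x q = z \<and> snd q = c then 1 else 0)"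

definition polarize :: "'b set \<Rightarrow> (complex ^ 'N ^ 'N \<Rightarrow> complex) \<Rightarrow> complex" where
  "polarize B G = (\<Sum>x\<in>PiE (B \<times> UNIV) (\<lambda>_. UNIV :: 'N::finite set). block_eps B x *
     (\<Sum>U\<in>Pow (B \<times> UNIV). (- 1) ^ card (B \<times> UNIV - U) * G (unit_sum x U)))"

lemma polarize_sum: "polarize B (\<lambda>g. \<Sum>i\<in>I. c i * G i g) = (\<Sum>i\<in>I. c i * polarize B (G i))"
proof -
  have "polarize B (\<lambda>g. \<Sum>i\<in>I. c i * G i g) = (\<Sum>x\<in>PiE (B \<times> UNIV) (\<lambda>_. UNIV). \<Sum>i\<in>I. c i * (block_eps B x *
     (\<Sum>U\<in>Pow (B \<times> UNIV). (- 1) ^ card (B \<times> UNIV - U) * G i (unit_sum x U))))"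
    unfolding polarize_def sum_distrib_left
    by (rule sum.cong[OF refl], subst sum.swap) (simp add: mult_ac)
  also have "\<dots> = (\<Sum>i\<in>I. c i * polarize B (G i))"
    unfolding polarize_def by (subst sum.swap) (simp add: sum_distrib_left)
  finally show ?thesis .
qed

lemma polarize_mult_right: "polarize B (\<lambda>g. G g * c) = polarize B G * c"
  using polarize_sum[of B "\<lambda>_. c" "\<lambda>_. G" "{()}"] by (simp add: mult.commute)

text \<open>By Ryser's formula the alternating sum over \<open>U\<close> of a product of linear
  forms is a permanent. Here \<open>\<beta>\<close> assigns to each form \<open>v\<close> the matrix
  unit at which it is evaluated, the one in row \<open>x (\<beta> v)\<close> and column
  \<open>snd (\<beta> v)\<close>.\<close>

lemma polarize_linear_forms:
  fixes u :: "'b \<times> 'N::finite \<Rightarrow> 'N \<Rightarrow> complex"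
  assumes "finite B"
  shows "polarize B (\<lambda>g. \<Prod>v\<in>B \<times> UNIV. \<Sum>z\<in>UNIV. u v z * g $ z $ col v) =
    (\<Sum>x\<in>PiE (B \<times> UNIV) (\<lambda>_. UNIV). block_eps B x *
      (\<Sum>\<beta> | \<beta> permutes B \<times> UNIV. \<Prod>v\<in>B \<times> UNIV. if snd (\<beta> v) = col v then u v (x (\<beta> v)) else 0))"
proof -
  have fin: "finite (B \<times> (UNIV :: 'N set))" using assms by simp
  have "(\<Sum>z\<in>UNIV. u v z * unit_sum x U $ z $ col v) =
      (\<Sum>q\<in>U. if snd q = col v then u v (x q) else 0)" for v and x :: "'b \<times> 'N \<Rightarrow> 'N" and U
  proof -
    have "(\<Sum>z\<in>UNIV. u v z * unit_sum x U $ z $ col v) =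
        (\<Sum>q\<in>U. \<Sum>z\<in>UNIV. u v z * (if x q = z \<and> snd q = col v then 1 else 0))"
      by (simp add: unit_sum_def sum_distrib_left) (rule sum.swap)
    also have "\<dots> = (\<Sum>q\<in>U. \<Sum>z\<in>UNIV. if z = x q then (if snd q = col v then u v (x q) else 0) else 0)"
      by (intro sum.cong) auto
    finally show ?thesis by simp
  qed
  then show ?thesis
    unfolding polarize_def by (simp only: permanent_by_inclusion_exclusion[OF fin])
qed

text \<open>Up to a scalar this is the pairing of a power of the determinant with itself. Averaged
  over the permutations that preserve columns, it becomes a sum of squares of real numbers, one of
  which is positive.\<close>

lemma polarize_det_power:
  assumes B: "finite (B :: 'b set)"
  shows "polarize B (\<lambda>g :: complex ^ 'N ^ ('N::finite). det g ^ card B) \<noteq> 0"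
proof -
  let ?S = "B \<times> (UNIV :: 'N set)"
  let ?W = "PiE ?S (\<lambda>_. UNIV :: 'N set)"
  let ?E = "block_eps B :: ('b \<times> 'N \<Rightarrow> 'N) \<Rightarrow> complex"
  \<comment> \<open>Only these permutations will contribute: a linear form in column
    \<open>snd v\<close> of \<open>g\<close> vanishes at the matrix units of every other
    column.\<close>
  define \<Gamma> where "\<Gamma> = {\<beta>. \<beta> permutes ?S \<and> (\<forall>v\<in>?S. snd (\<beta> v) = snd v)}"
  have fin: "finite ?S" "finite ?W" using B by (auto simp: finite_PiE)
  have fin\<Gamma>: "finite \<Gamma>"
    using finite_permutations[OF fin(1)] by (rule rev_finite_subset) (auto simp: \<Gamma>_def)
  have "id \<in> \<Gamma>" by (simp add: \<Gamma>_def permutes_id)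
  have \<Gamma>_comp: "\<gamma> \<circ> \<beta> \<in> \<Gamma>" if "\<gamma> \<in> \<Gamma>" "\<beta> \<in> \<Gamma>" for \<gamma> \<beta>
  proof -
    have perm: "\<gamma> permutes ?S" "\<beta> permutes ?S" and snd: "\<forall>v\<in>?S. snd (\<gamma> v) = snd v" "\<forall>v\<in>?S. snd (\<beta> v) = snd v"
      using that unfolding \<Gamma>_def by blast+
    have "snd ((\<gamma> \<circ> \<beta>) v) = snd v" if "v \<in> ?S" for v
    proof -
      have "\<beta> v \<in> ?S" using that permutes_in_image[OF perm(2)] by blast
      from bspec[OF snd(1) this] bspec[OF snd(2) that] show ?thesis by simp
    qed
    then show ?thesis using permutes_compose[OF perm(2,1)] unfolding \<Gamma>_def mem_Collect_eq
      by (intro conjI ballI)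
  qed
  have \<Gamma>_inv: "inv \<gamma> \<in> \<Gamma>" if "\<gamma> \<in> \<Gamma>" for \<gamma>
  proof -
    have perm: "\<gamma> permutes ?S" and snd: "\<forall>v\<in>?S. snd (\<gamma> v) = snd v"
      using that unfolding \<Gamma>_def by blast+
    have "snd (inv \<gamma> v) = snd v" if "v \<in> ?S" for v
    proof -
      have "inv \<gamma> v \<in> ?S" using that permutes_in_image[OF permutes_inv[OF perm]] by blast
      from bspec[OF snd this] show ?thesis by (simp add: permutes_inverses(1)[OF perm])
    qed
    then show ?thesis using permutes_inv[OF perm] unfolding \<Gamma>_def mem_Collect_eq
      by (intro conjI ballI)
  qed
  \<comment> \<open>The linear forms are single entries of \<open>g\<close>. For given
    \<open>x\<close> and \<open>\<beta> \<in> \<Gamma>\<close> exactly one \<open>y\<close>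
    contributes, the restriction of \<open>x \<circ> \<beta>\<close>.\<close>
  have E_eq: "(\<Sum>y\<in>?W. ?E y * (\<Prod>v\<in>?S. if snd (\<beta> v) = snd v then (if x (\<beta> v) = y v then 1 else 0) else 0)) =
      (if \<beta> \<in> \<Gamma> then ?E (x \<circ> \<beta>) else 0)" if \<beta>: "\<beta> permutes ?S" for x \<beta>
  proof (cases "\<beta> \<in> \<Gamma>")
    case True
    have "(\<Prod>v\<in>?S. if snd (\<beta> v) = snd v then (if x (\<beta> v) = y v then 1 else (0::complex)) else 0) =
        (if y = restrict (x \<circ> \<beta>) ?S then 1 else 0)" if "y \<in> ?W" for y
    proof -
      have "(\<Prod>v\<in>?S. if snd (\<beta> v) = snd v then (if x (\<beta> v) = y v then 1 else (0::complex)) else 0) =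
          (\<Prod>v\<in>?S. if x (\<beta> v) = y v then 1 else 0)"
        using True by (intro prod.cong) (auto simp: \<Gamma>_def)
      also have "\<dots> = (if \<forall>v\<in>?S. x (\<beta> v) = y v then 1 else 0)"
        using fin(1) by (rule prod_if_one_zero)
      also have "(\<forall>v\<in>?S. x (\<beta> v) = y v) \<longleftrightarrow> y = restrict (x \<circ> \<beta>) ?S"
        using that by (auto simp: fun_eq_iff PiE_def extensional_def)
      finally show ?thesis .
    qed
    then have "(\<Sum>y\<in>?W. ?E y * (\<Prod>v\<in>?S. if snd (\<beta> v) = snd v then (if x (\<beta> v) = y v then 1 else 0) else 0)) =
        (\<Sum>y\<in>?W. if y = restrict (x \<circ> \<beta>) ?S then ?E y else 0)"
      by (intro sum.cong) auto
    then show ?thesis using fin True by simp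
  next
    case False
    then obtain v where v: "v \<in> ?S" "snd (\<beta> v) \<noteq> snd v" using \<beta> unfolding \<Gamma>_def by blast
    have "(\<Prod>v\<in>?S. if snd (\<beta> v) = snd v then (if x (\<beta> v) = y v then 1 else (0::complex)) else 0) = 0" for y
      using fin(1) by (rule prod_zero) (rule bexI[OF _ v(1)], simp add: v(2))
    then show ?thesis using False by simp
  qed
  have "det g ^ card B = (\<Sum>y\<in>?W. ?E y * (\<Prod>v\<in>?S. \<Sum>z\<in>UNIV. (if z = y v then 1 else 0) * g $ z $ snd v))"
    for g :: "complex ^ 'N ^ 'N"
  proof -
    have "det g ^ card B = (\<Prod>b\<in>B. det g)" by simp
    also have "\<dots> = (\<Sum>y\<in>?W. ?E y * (\<Prod>v\<in>?S. g $ y v $ snd v))"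
      unfolding prod_det_columns[OF B] block_eps_def ..
    finally show ?thesis by (simp add: if_distrib[of "\<lambda>t. t * _"] cong: if_cong)
  qed
  then have "polarize B (\<lambda>g :: complex ^ 'N ^ 'N. det g ^ card B) =
      (\<Sum>y\<in>?W. ?E y * (\<Sum>x\<in>?W. ?E x * (\<Sum>\<beta> | \<beta> permutes ?S.
        \<Prod>v\<in>?S. if snd (\<beta> v) = snd v then (if x (\<beta> v) = y v then 1 else 0) else 0)))"
    by (simp only: polarize_sum polarize_linear_forms[OF B])
  also have "\<dots> = (\<Sum>x\<in>?W. ?E x * (\<Sum>\<beta> | \<beta> permutes ?S. \<Sum>y\<in>?W. ?E y *
        (\<Prod>v\<in>?S. if snd (\<beta> v) = snd v then (if x (\<beta> v) = y v then 1 else 0) else 0)))"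
    unfolding sum_distrib_left
    by (subst sum.swap, rule sum.cong[OF refl], subst sum.swap) (simp add: mult_ac)
  also have "\<dots> = (\<Sum>x\<in>?W. ?E x * (\<Sum>\<beta> | \<beta> permutes ?S. if \<beta> \<in> \<Gamma> then ?E (x \<circ> \<beta>) else 0))"
    by (intro sum.cong refl arg_cong2[of _ _ _ _ "(*)"] E_eq) simp
  also have "\<dots> = (\<Sum>x\<in>?W. ?E x * (\<Sum>\<beta>\<in>\<Gamma>. ?E (x \<circ> \<beta>)))"
    using fin by (subst sum.inter_filter[symmetric]) (auto simp: \<Gamma>_def finite_permutations intro!: sum.cong)
  finally have C: "polarize B (\<lambda>g :: complex ^ 'N ^ 'N. det g ^ card B) =
      (\<Sum>x\<in>?W. ?E x * (\<Sum>\<beta>\<in>\<Gamma>. ?E (x \<circ> \<beta>)))" (is "?C = _") .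
  \<comment> \<open>Relabelling \<open>x\<close> by \<open>\<gamma>\<close> puts
    \<open>\<gamma>\<close> into the first factor, while the inner sum is unchanged because
    \<open>\<Gamma>\<close> is a group. Summing over \<open>\<gamma>\<close> then turns the product
    into a square.\<close>
  have shift: "?C = (\<Sum>x\<in>?W. ?E (x \<circ> \<gamma>) * (\<Sum>\<beta>\<in>\<Gamma>. ?E (x \<circ> \<beta>)))" if \<gamma>: "\<gamma> \<in> \<Gamma>" for \<gamma>
  proof -
    have perm: "\<gamma> permutes ?S" using \<gamma> by (simp add: \<Gamma>_def)
    have reindex: "(\<Sum>\<beta>\<in>\<Gamma>. ?E (x \<circ> (\<gamma> \<circ> \<beta>))) = (\<Sum>\<beta>\<in>\<Gamma>. ?E (x \<circ> \<beta>))" for x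
      using \<gamma> permutes_inv_o[OF perm]
      by (intro sum.reindex_bij_witness[of _ "\<lambda>\<beta>. inv \<gamma> \<circ> \<beta>" "\<lambda>\<beta>. \<gamma> \<circ> \<beta>"])
        (auto simp: \<Gamma>_comp \<Gamma>_inv permutes_inv_o[OF perm] simp flip: comp_assoc)
    have "?C = (\<Sum>x\<in>?W. ?E (x \<circ> \<gamma>) * (\<Sum>\<beta>\<in>\<Gamma>. ?E (restrict (x \<circ> \<gamma>) ?S \<circ> \<beta>)))"
      unfolding C by (subst sum_PiE_permute[OF perm]) simp
    also have "\<dots> = (\<Sum>x\<in>?W. ?E (x \<circ> \<gamma>) * (\<Sum>\<beta>\<in>\<Gamma>. ?E (x \<circ> (\<gamma> \<circ> \<beta>))))"
    proof (intro sum.cong refl arg_cong2[of _ _ _ _ "(*)"] block_eps_cong)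
      fix x \<beta> v assume "\<beta> \<in> \<Gamma>" "v \<in> ?S"
      then have "\<beta> v \<in> ?S" by (simp only: \<Gamma>_def mem_Collect_eq permutes_in_image)
      then show "(restrict (x \<circ> \<gamma>) ?S \<circ> \<beta>) v = (x \<circ> (\<gamma> \<circ> \<beta>)) v" by simp
    qed
    finally show ?thesis unfolding reindex .
  qed
  have "of_nat (card \<Gamma>) * ?C = (\<Sum>\<gamma>\<in>\<Gamma>. ?C)" by simp
  also have "\<dots> = (\<Sum>\<gamma>\<in>\<Gamma>. \<Sum>x\<in>?W. ?E (x \<circ> \<gamma>) * (\<Sum>\<beta>\<in>\<Gamma>. ?E (x \<circ> \<beta>)))"
    using shift by (intro sum.cong) auto
  also have "\<dots> = (\<Sum>x\<in>?W. (\<Sum>\<gamma>\<in>\<Gamma>. ?E (x \<circ> \<gamma>))\<^sup>2)"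
    by (subst sum.swap) (simp add: power2_eq_square flip: sum_distrib_right)
  also have "\<dots> = of_real (\<Sum>x\<in>?W. (\<Sum>\<gamma>\<in>\<Gamma>. Re (?E (x \<circ> \<gamma>)))\<^sup>2)"
    by (subst block_eps_real) simp
  finally have sq: "of_nat (card \<Gamma>) * ?C = of_real (\<Sum>x\<in>?W. (\<Sum>\<gamma>\<in>\<Gamma>. Re (?E (x \<circ> \<gamma>)))\<^sup>2)" .
  \<comment> \<open>This assignment is the identity on every block and is not changed by members of
    \<open>\<Gamma>\<close>, so all its \<open>card \<Gamma>\<close> terms equal 1 and its square is
    positive.\<close>
  let ?x = "restrict snd ?S"
  have "?E (?x \<circ> \<gamma>) = 1" if "\<gamma> \<in> \<Gamma>" for \<gamma>
  proof -
    have "(?x \<circ> \<gamma>) v = snd v" if "v \<in> ?S" for v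
    proof -
      have perm: "\<gamma> permutes ?S" and snd: "\<forall>v\<in>?S. snd (\<gamma> v) = snd v"
        using \<open>\<gamma> \<in> \<Gamma>\<close> unfolding \<Gamma>_def by blast+
      have "\<gamma> v \<in> ?S" using that by (simp only: permutes_in_image[OF perm])
      then show ?thesis using bspec[OF snd that] by simp
    qed
    then have eq: "?E (?x \<circ> \<gamma>) = ?E snd" by (rule block_eps_cong)
    show ?thesis
      unfolding eq by (simp add: block_eps_def eps_eq_sign permutes_id[unfolded id_def])
  qed
  then have "(\<Sum>\<gamma>\<in>\<Gamma>. Re (?E (?x \<circ> \<gamma>))) = of_nat (card \<Gamma>)" by simp
  moreover have "card \<Gamma> \<noteq> 0" using \<open>id \<in> \<Gamma>\<close> fin\<Gamma> by auto
  ultimately have "0 < (\<Sum>\<gamma>\<in>\<Gamma>. Re (?E (?x \<circ> \<gamma>)))\<^sup>2" by simp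
  also have "\<dots> \<le> (\<Sum>x\<in>?W. (\<Sum>\<gamma>\<in>\<Gamma>. Re (?E (x \<circ> \<gamma>)))\<^sup>2)"
    using fin by (intro member_le_sum[of ?x ?W "\<lambda>x. (\<Sum>\<gamma>\<in>\<Gamma>. Re (?E (x \<circ> \<gamma>)))\<^sup>2"]) auto
  finally have "of_nat (card \<Gamma>) * ?C \<noteq> 0" unfolding sq by (simp only: of_real_eq_0_iff)
  then show ?thesis by simp
qed

text \<open>Labels of the k + d factors of det^(k+d). Paired with \<open>UNIV\<close> they index
  both the slots of the tensors of the pairing and the linear forms in \<open>g\<close>: as forms,
  those tagged \<open>Inl\<close> are the rows of A g, and those tagged \<open>Inr s\<close> come
  from the determinant for the \<open>s\<close>-th copy of \<open>X\<close>.\<close>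

definition blocks :: "nat \<Rightarrow> ('k + nat) set" where
  "blocks d = range Inl \<union> Inr ` {..<d}"

definition matrix_wires :: "nat \<Rightarrow> (('k + nat) \<times> 'N) set" where
  "matrix_wires d = Inr ` {..<d} \<times> UNIV"

definition row_wires :: "(('k + nat) \<times> 'N) set" where
  "row_wires = range Inl \<times> UNIV"

lemma finite_wires [simp]:
  "finite (blocks d :: ('k::finite + nat) set)"
  "finite (matrix_wires d :: (('k::finite + nat) \<times> 'N::finite) set)"
  "finite (row_wires :: (('k::finite + nat) \<times> 'N::finite) set)"
  by (simp_all add: blocks_def matrix_wires_def row_wires_def)

lemma wires_Un: "blocks d \<times> UNIV = matrix_wires d \<union> row_wires"
  and wires_Int: "matrix_wires d \<inter> row_wires = {}"
  by (auto simp: blocks_def matrix_wires_def row_wires_def)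

lemma card_blocks: "card (blocks d :: ('k::finite + nat) set) = CARD('k) + d"
  unfolding blocks_def by (subst card_Un_disjoint) (auto simp: card_image)

lemma prod_matrix_wires: "(\<Prod>v\<in>matrix_wires d. h v) = (\<Prod>v\<in>{..<d} \<times> UNIV. h (Inr (fst v), snd v))"
  unfolding matrix_wires_def
  by (rule prod.reindex_bij_witness[of _ "\<lambda>v. (Inr (fst v), snd v)" "\<lambda>v. (projr (fst v), snd v)"]) auto

lemma prod_row_wires: "(\<Prod>v\<in>row_wires. h v) = (\<Prod>v\<in>UNIV. h (Inl (fst v), snd v))"
  unfolding row_wires_def
  by (rule prod.reindex_bij_witness[of _ "\<lambda>v. (Inl (fst v), snd v)" "\<lambda>v. (projl (fst v), snd v)"]) auto

section \<open>Cancellation of pairs of antisymmetric tensors\<close>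

lemma block_eps_blocks:
  "block_eps (blocks d :: ('k::finite + nat) set) x =
    (\<Prod>\<kappa>\<in>UNIV. eps (\<lambda>c. x (Inl \<kappa>, c))) * block_eps {..<d} (\<lambda>v. x (Inr (fst v), snd v))"
  unfolding block_eps_def blocks_def
  by (subst prod.union_disjoint) (auto simp: prod.reindex)

text \<open>The rule \<epsilon> \<epsilon> = det \<delta> in every block. Once the permutations
  \<open>\<sigma>\<close> are chosen, \<open>y\<close> is determined by \<open>x\<close>, which is
  how the indices \<open>y\<close> get eliminated.\<close>

lemma block_eps_mult:
  fixes y :: "'b \<times> 'N::finite \<Rightarrow> 'N"
  assumes "finite B" and y: "y \<in> PiE (B \<times> UNIV) (\<lambda>_. UNIV)"
  shows "block_eps B y * block_eps B x = (\<Sum>\<sigma>\<in>PiE B (\<lambda>_. {\<pi>. \<pi> permutes UNIV}).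
    (\<Prod>b\<in>B. of_int (sign (\<sigma> b))) * (if y = (\<lambda>v\<in>B \<times> UNIV. x (fst v, \<sigma> (fst v) (snd v))) then 1 else 0))"
proof -
  have "block_eps B y * block_eps B x =
      (\<Prod>b\<in>B. \<Sum>\<pi> | \<pi> permutes UNIV. of_int (sign \<pi>) *
        (if (\<lambda>c. y (b, c)) = (\<lambda>c. x (b, c)) \<circ> \<pi> then 1 else 0))"
    unfolding block_eps_def by (simp only: eps_mult flip: prod.distrib)
  also have "\<dots> = (\<Sum>\<sigma>\<in>PiE B (\<lambda>_. {\<pi>. \<pi> permutes UNIV}). \<Prod>b\<in>B. of_int (sign (\<sigma> b)) *
        (if (\<lambda>c. y (b, c)) = (\<lambda>c. x (b, c)) \<circ> \<sigma> b then 1 else 0))"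
    using assms by (subst prod_sum_PiE) (auto simp: finite_permutations)
  also have "\<dots> = (\<Sum>\<sigma>\<in>PiE B (\<lambda>_. {\<pi>. \<pi> permutes UNIV}).
    (\<Prod>b\<in>B. of_int (sign (\<sigma> b))) * (if y = (\<lambda>v\<in>B \<times> UNIV. x (fst v, \<sigma> (fst v) (snd v))) then 1 else 0))"
  proof (rule sum.cong[OF refl])
    fix \<sigma> :: "'b \<Rightarrow> 'N \<Rightarrow> 'N"
    have "(\<forall>b\<in>B. (\<lambda>c. y (b, c)) = (\<lambda>c. x (b, c)) \<circ> \<sigma> b) \<longleftrightarrow>
        y = (\<lambda>v\<in>B \<times> UNIV. x (fst v, \<sigma> (fst v) (snd v)))"
      using y by (auto simp: fun_eq_iff PiE_def extensional_def)
    then show "(\<Prod>b\<in>B. of_int (sign (\<sigma> b)) * (if (\<lambda>c. y (b, c)) = (\<lambda>c. x (b, c)) \<circ> \<sigma> b then 1 else 0)) =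
        (\<Prod>b\<in>B. of_int (sign (\<sigma> b))) * (if y = (\<lambda>v\<in>B \<times> UNIV. x (fst v, \<sigma> (fst v) (snd v))) then 1 else (0::complex))"
      by (simp only: prod.distrib prod_if_one_zero[OF \<open>finite B\<close>])
  qed
  finally show ?thesis .
qed

text \<open>The tensors in \<open>y\<close>, which will come from Cramer's rule, cancel against the
  tensors tagged \<open>Inr\<close> in \<open>x\<close>. Relabelling \<open>x\<close> by
  \<open>inv \<beta>\<close> lets the wire \<open>v\<close> start at the matrix or row
  \<open>v\<close>; only the tensors tagged \<open>Inl\<close> remain.\<close>

lemma sum_block_eps_pair:
  fixes M :: "('k::finite + nat) \<times> 'N::finite \<Rightarrow> complex ^ 'N ^ 'N" and L :: "_ \<Rightarrow> complex ^ 'N"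
  assumes \<beta>: "\<beta> permutes blocks d \<times> UNIV"
  shows "(\<Sum>x\<in>PiE (blocks d \<times> UNIV) (\<lambda>_. UNIV). block_eps (blocks d) x *
      (\<Sum>y\<in>PiE ({..<d} \<times> UNIV) (\<lambda>_. UNIV). block_eps {..<d} y *
        ((\<Prod>v\<in>matrix_wires d. M v $ y (projr (fst v), snd v) $ x (\<beta> v)) * (\<Prod>v\<in>row_wires. L v $ x (\<beta> v))))) =
    (\<Sum>\<sigma>\<in>PiE {..<d} (\<lambda>_. {\<pi>. \<pi> permutes UNIV}). (\<Prod>s<d. of_int (sign (\<sigma> s))) *
      contraction (\<lambda>\<kappa> c. inv \<beta> (Inl \<kappa>, c))
        (\<lambda>v. inv \<beta> (Inr (projr (fst v)), \<sigma> (projr (fst v)) (snd v))) (matrix_wires d) row_wires M L)"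
proof -
  let ?S = "blocks d \<times> UNIV :: (('k + nat) \<times> 'N) set"
  let ?Y = "PiE ({..<d} \<times> UNIV) (\<lambda>_. UNIV) :: (nat \<times> 'N \<Rightarrow> 'N) set"
  let ?PI = "PiE {..<d} (\<lambda>_. {\<pi>. \<pi> permutes UNIV}) :: (nat \<Rightarrow> 'N \<Rightarrow> 'N) set"
  let ?E = "\<lambda>x :: ('k + nat) \<times> 'N \<Rightarrow> 'N. \<Prod>\<kappa>\<in>UNIV. eps (\<lambda>c. x (Inl \<kappa>, c))"
  let ?W = "\<lambda>x y. (\<Prod>v\<in>matrix_wires d. M v $ y (projr (fst v), snd v) $ x (\<beta> v)) * (\<Prod>v\<in>row_wires. L v $ x (\<beta> v))"
  let ?s = "\<lambda>\<sigma>. (\<Prod>s<d. of_int (sign (\<sigma> s))) :: complex"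
  \<comment> \<open>The only \<open>y\<close> that the Kronecker deltas leave.\<close>
  let ?y = "\<lambda>\<sigma> x. \<lambda>v\<in>{..<d} \<times> UNIV. x (Inr (fst v) :: 'k + nat, \<sigma> (fst v) (snd v))"
  have finY: "finite ?Y" by (simp add: finite_PiE)
  have "block_eps (blocks d) x * (\<Sum>y\<in>?Y. block_eps {..<d} y * ?W x y) =
      (\<Sum>\<sigma>\<in>?PI. ?s \<sigma> * (?E x * ?W x (?y \<sigma> x)))" for x
  proof -
    have "block_eps (blocks d) x * (\<Sum>y\<in>?Y. block_eps {..<d} y * ?W x y) =
        ?E x * (\<Sum>y\<in>?Y. (block_eps {..<d} y * block_eps {..<d} (\<lambda>v. x (Inr (fst v), snd v))) * ?W x y)"
      by (simp add: block_eps_blocks sum_distrib_left mult_ac)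
    also have "(\<Sum>y\<in>?Y. (block_eps {..<d} y * block_eps {..<d} (\<lambda>v. x (Inr (fst v), snd v))) * ?W x y) =
        (\<Sum>y\<in>?Y. \<Sum>\<sigma>\<in>?PI. if y = ?y \<sigma> x then ?s \<sigma> * ?W x y else 0)"
      by (intro sum.cong refl, subst block_eps_mult)
        (auto simp: sum_distrib_right intro!: sum.cong)
    also have "\<dots> = (\<Sum>\<sigma>\<in>?PI. ?s \<sigma> * ?W x (?y \<sigma> x))"
      by (subst sum.swap, rule sum.cong[OF refl], subst sum.delta[OF finY]) auto
    finally show ?thesis by (simp only: sum_distrib_left mult_ac)
  qed
  then have "(\<Sum>x\<in>PiE ?S (\<lambda>_. UNIV). block_eps (blocks d) x * (\<Sum>y\<in>?Y. block_eps {..<d} y * ?W x y)) =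
      (\<Sum>\<sigma>\<in>?PI. ?s \<sigma> * (\<Sum>x\<in>PiE ?S (\<lambda>_. UNIV). ?E x * ?W x (?y \<sigma> x)))"
    by (simp only: sum_distrib_left) (rule sum.swap)
  also have "\<dots> = (\<Sum>\<sigma>\<in>?PI. ?s \<sigma> * contraction (\<lambda>\<kappa> c. inv \<beta> (Inl \<kappa>, c))
        (\<lambda>v. inv \<beta> (Inr (projr (fst v)), \<sigma> (projr (fst v)) (snd v))) (matrix_wires d) row_wires M L)"
  proof (intro sum.cong refl arg_cong2[of _ _ _ _ "(*)"])
    fix \<sigma>
    have inv: "inv \<beta> permutes ?S" using \<beta> by (rule permutes_inv)
    show "(\<Sum>x\<in>PiE ?S (\<lambda>_. UNIV). ?E x * ?W x (?y \<sigma> x)) = contraction (\<lambda>\<kappa> c. inv \<beta> (Inl \<kappa>, c))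
        (\<lambda>v. inv \<beta> (Inr (projr (fst v)), \<sigma> (projr (fst v)) (snd v))) (matrix_wires d) row_wires M L"
      unfolding contraction_def wires_Un[symmetric] sum_PiE_permute[OF inv, of "\<lambda>x. ?E x * ?W x (?y \<sigma> x)"]
    proof (rule sum.cong[OF refl])
      fix x :: "('k + nat) \<times> 'N \<Rightarrow> 'N"
      let ?x = "restrict (x \<circ> inv \<beta>) ?S"
      have x: "?x v = x (inv \<beta> v)" if "v \<in> ?S" for v using that by simp
      have x\<beta>: "?x (\<beta> v) = x v" if "v \<in> ?S" for v
      proof -
        have "\<beta> v \<in> ?S" using that by (simp only: permutes_in_image[OF \<beta>])
        then show ?thesis by (simp only: x permutes_inverses(2)[OF \<beta>])
      qed
      have "?E ?x = (\<Prod>\<kappa>\<in>UNIV. eps (\<lambda>c. x (inv \<beta> (Inl \<kappa>, c))))"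
        by (simp add: blocks_def)
      moreover have "(\<Prod>v\<in>matrix_wires d. M v $ ?y \<sigma> ?x (projr (fst v), snd v) $ ?x (\<beta> v)) =
          (\<Prod>v\<in>matrix_wires d. M v $ x (inv \<beta> (Inr (projr (fst v)), \<sigma> (projr (fst v)) (snd v))) $ x v)"
      proof (rule prod.cong[OF refl])
        fix v :: "('k + nat) \<times> 'N" assume v: "v \<in> matrix_wires d"
        then have "v \<in> ?S" by (simp only: wires_Un Un_iff) simp
        then have "?x (\<beta> v) = x v" by (rule x\<beta>)
        moreover have "?y \<sigma> ?x (projr (fst v), snd v) = x (inv \<beta> (Inr (projr (fst v)), \<sigma> (projr (fst v)) (snd v)))"
          using v by (auto simp: matrix_wires_def blocks_def)
        ultimately show "M v $ ?y \<sigma> ?x (projr (fst v), snd v) $ ?x (\<beta> v) =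
            M v $ x (inv \<beta> (Inr (projr (fst v)), \<sigma> (projr (fst v)) (snd v))) $ x v"
          by (simp only:)
      qed
      moreover have "(\<Prod>v\<in>row_wires. L v $ ?x (\<beta> v)) = (\<Prod>v\<in>row_wires. L v $ x v)"
      proof (rule prod.cong[OF refl])
        fix v :: "('k + nat) \<times> 'N" assume "v \<in> row_wires"
        then have "v \<in> ?S" by (simp only: wires_Un Un_iff) simp
        then show "L v $ ?x (\<beta> v) = L v $ x v" by (simp only: x\<beta>)
      qed
      ultimately show "?E ?x * ?W ?x (?y \<sigma> ?x) = (\<Prod>\<kappa>\<in>UNIV. eps (\<lambda>c. x (inv \<beta> (Inl \<kappa>, c)))) *
          (\<Prod>v\<in>matrix_wires d. M v $ x (inv \<beta> (Inr (projr (fst v)), \<sigma> (projr (fst v)) (snd v))) $ x v) *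
          (\<Prod>v\<in>row_wires. L v $ x v)"
        by (simp only: mult.assoc)
    qed
  qed
  finally show ?thesis .
qed

text \<open>The \<open>Inr\<close> slots, permuted by the \<open>\<sigma> s\<close>, and the
  \<open>Inl\<close> slots together exhaust all slots, and the bijection \<open>inv \<beta>\<close>
  sends each of them to its wire.\<close>

lemma network_of_permutations:
  fixes \<beta> :: "('k::finite + nat) \<times> 'N::finite \<Rightarrow> _"
  assumes \<beta>: "\<beta> permutes blocks d \<times> UNIV" and \<sigma>: "\<And>s. s < d \<Longrightarrow> \<sigma> s permutes (UNIV :: 'N set)"
  shows "network (\<lambda>\<kappa> c. inv \<beta> (Inl \<kappa>, c))
    (\<lambda>v. inv \<beta> (Inr (projr (fst v)), \<sigma> (projr (fst v)) (snd v))) (matrix_wires d) row_wires"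
proof -
  let ?p = "\<lambda>v :: ('k + nat) \<times> 'N. (Inr (projr (fst v)) :: 'k + nat, \<sigma> (projr (fst v)) (snd v))"
  have inv: "inv \<beta> permutes blocks d \<times> UNIV" using \<beta> by (rule permutes_inv)
  have inj: "inj (inv \<beta>)" using inv by (rule permutes_inj)
  have "inj_on ?p (matrix_wires d)"
  proof (rule inj_onI)
    fix v w assume v: "v \<in> matrix_wires d" and w: "w \<in> matrix_wires d" and eq: "?p v = ?p w"
    obtain s c where s: "v = (Inr s, c)" "s < d" using v by (auto simp: matrix_wires_def)
    obtain s' c' where s': "w = (Inr s', c')" using w by (auto simp: matrix_wires_def)
    have "s' = s" "\<sigma> s c' = \<sigma> s c" using eq s s' by auto
    then show "v = w" using injD[OF permutes_inj[OF \<sigma>[OF s(2)]]] s s' by blast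
  qed
  then have "inj_on (inv \<beta> \<circ> ?p) (matrix_wires d)"
    by (rule comp_inj_on[OF _ inj_on_subset[OF inj subset_UNIV]])
  moreover have p: "?p ` matrix_wires d = matrix_wires d"
  proof (intro equalityI subsetI)
    fix v :: "('k + nat) \<times> 'N" assume "v \<in> matrix_wires d"
    then obtain s c where v: "v = (Inr s, c)" "s < d" by (auto simp: matrix_wires_def)
    obtain c' where "c = \<sigma> s c'" using permutes_surj[OF \<sigma>[OF v(2)]] by (metis surjD)
    then show "v \<in> ?p ` matrix_wires d"
      using v by (intro image_eqI[of _ _ "(Inr s, c')"]) (auto simp: matrix_wires_def)
  qed (auto simp: matrix_wires_def)
  moreover have r: "range (\<lambda>(\<kappa>, c). (Inl \<kappa>, c)) = (row_wires :: (('k + nat) \<times> 'N) set)"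
    by (auto simp: row_wires_def image_iff)
  moreover have "inj (\<lambda>(\<kappa>, c). inv \<beta> (Inl \<kappa>, c))"
    by (auto intro!: injI dest!: injD[OF inj])
  moreover have "(\<lambda>v. inv \<beta> (?p v)) ` matrix_wires d = inv \<beta> ` matrix_wires d"
    by (subst (2) p[symmetric]) (simp add: image_image)
  moreover have "range (\<lambda>(\<kappa>, c). inv \<beta> (Inl \<kappa>, c)) = inv \<beta> ` row_wires"
    unfolding r[symmetric] by (simp add: image_image split_def)
  moreover have "inv \<beta> ` matrix_wires d \<inter> inv \<beta> ` row_wires = {}"
    by (simp only: wires_Int image_empty flip: image_Int[OF inj])
  moreover have "inv \<beta> ` matrix_wires d \<union> inv \<beta> ` row_wires = matrix_wires d \<union> row_wires"
    using permutes_image[OF inv] unfolding wires_Un by (simp only: image_Un)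
  ultimately show ?thesis
    unfolding network_def by (simp only: wires_Int finite_wires o_def)
qed

section \<open>The first fundamental theorem\<close>

text \<open>By Cramer's rule this is \<open>det g\<close> times \<open>g\<^sup>-\<^sup>1 X g\<close> when \<open>g\<close> is invertible.\<close>

definition adj_conj :: "complex ^ 'N ^ 'N \<Rightarrow> complex ^ 'N ^ 'N \<Rightarrow> complex ^ 'N ^ ('N::finite)" where
  "adj_conj g X = (\<chi> i j. det (\<chi> z c. if c = i then (X ** g) $ z $ j else g $ z $ c))"

lemma matrix_inv_mult:
  assumes "invertible (g :: complex ^ 'N ^ ('N::finite))"
  shows "matrix_inv g ** g = mat 1" "g ** matrix_inv g = mat 1"
  using assms someI_ex[of "\<lambda>h. g ** h = mat 1 \<and> h ** g = mat 1"]
  by (auto simp: invertible_def matrix_inv_def)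

lemma matrix_inv_eqI:
  fixes g :: "complex ^ 'N ^ ('N::finite)"
  assumes "g ** h = mat 1" "h ** g = mat 1"
  shows "matrix_inv g = h"
proof -
  have "invertible g" using assms by (auto simp: invertible_def)
  then have "matrix_inv g ** (g ** h) = h" by (simp add: matrix_mul_assoc matrix_inv_mult)
  then show ?thesis using assms by simp
qed

text \<open>Cramer's rule for the matrix \<open>g\<close> and the columns of \<open>X ** g\<close>
  as right-hand sides; the solutions are the columns of g^-1 X g.\<close>

lemma adj_conj_invertible:
  assumes "invertible g"
  shows "adj_conj g X = mscale (det g) (matrix_inv g ** X ** g)"
proof -
  let ?Z = "matrix_inv g ** X ** g"
  have "g ** ?Z = X ** g"
    by (simp add: matrix_mul_assoc matrix_inv_mult[OF assms])
  then have col: "(X ** g) $ z $ j = (g *v column j ?Z) $ z" for z j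
    by (simp add: vec_eq_iff matrix_matrix_mult_def matrix_vector_mult_def column_def)
  then have "adj_conj g X $ i $ j = column j ?Z $ i * det g" for i j
    unfolding adj_conj_def by (simp only: vec_lambda_beta col cramer_lemma)
  then show ?thesis by (simp add: vec_eq_iff column_def)
qed

lemma polyfun_on_line:
  assumes "polyfun \<phi>"
  shows "\<exists>p. \<forall>t. \<phi> (X + mscale t Y) A = poly p t"
proof -
  obtain f where f: "\<And>X A. \<phi> X A = peval f X A" using assms unfolding polyfun_def by blast
  have "\<exists>q. \<forall>t. var_val (X + mscale t Y) A v = poly q t" for v
  proof (cases v)
    case (XVar i j)
    then show ?thesis by (intro exI[of _ "[:X $ i $ j, Y $ i $ j:]"]) simp
  next
    case (AVar a i)
    then show ?thesis by (intro exI[of _ "[:A $ a $ i:]"]) simp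
  qed
  then obtain q where q: "\<And>v t. var_val (X + mscale t Y) A v = poly (q v) t" by metis
  have "\<phi> (X + mscale t Y) A = poly (\<Sum>\<mu>\<in>Poly_Mapping.keys f. smult (Poly_Mapping.lookup f \<mu>)
      (\<Prod>v\<in>UNIV. q v ^ Poly_Mapping.lookup \<mu> v)) t" for t
    by (simp add: f peval_mono_eval mono_eval_def q poly_sum poly_prod)
  then show ?thesis by blast
qed

text \<open>Every matrix lies on a line through the identity matrix, and \<open>det\<close> is a nonzero polynomial on
  that line.\<close>

lemma polyfun_eq_on_invertible:
  fixes \<phi> :: "complex ^ 'N ^ ('N::finite) \<Rightarrow> complex ^ 'N ^ ('p::finite) \<Rightarrow> complex"
  assumes "polyfun \<phi>" and "polyfun \<psi>"
    and eq: "\<And>g. invertible g \<Longrightarrow> \<phi> g A = \<psi> g A"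
  shows "\<phi> g A = \<psi> g A"
proof -
  let ?l = "\<lambda>t. g + mscale t (mat 1 - g)"
  have "polyfun (\<lambda>X (A :: complex ^ 'N ^ 'p). det X)"
    by (intro polyfun_intros)
  then obtain p q r where p: "\<And>t. \<phi> (?l t) A = poly p t" and q: "\<And>t. \<psi> (?l t) A = poly q t"
    and r: "\<And>t. det (?l t) = poly r t"
    using polyfun_on_line[of \<phi>] polyfun_on_line[of \<psi>] polyfun_on_line[of "\<lambda>X (A :: complex ^ 'N ^ 'p). det X"] assms(1,2)
    by metis
  \<comment> \<open>The factor \<open>r\<close> takes care of the parameters at which the matrix is
    singular; as a nonzero polynomial it can be cancelled afterwards.\<close>
  have "poly ((p - q) * r) t = 0" for t
  proof (cases "det (?l t) = 0")
    case False
    then show ?thesis using eq[of "?l t"] p q by (simp add: invertible_det_nz)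
  qed (simp add: r)
  then have "(p - q) * r = 0" using poly_all_0_iff_0 by blast
  moreover have "?l 1 = mat 1" by (simp add: vec_eq_iff)
  then have "r \<noteq> 0" using r[of 1] by auto
  ultimately have "p = q" by simp
  then have "\<phi> (?l 0) A = \<psi> (?l 0) A" using p q by simp
  moreover have "?l 0 = g" by (simp add: vec_eq_iff)
  ultimately show ?thesis by simp
qed

text \<open>There are as many pairs of a variable and a number below its exponent as elements of
  \<open>T\<close>. A monomial thus becomes a product with repetitions over whatever labels a
  network needs.\<close>

lemma prod_power_index:
  fixes e :: "'v \<Rightarrow> nat"
  assumes "finite V" "finite T" and "(\<Sum>v\<in>V. e v) = card T"
  shows "\<exists>w. \<forall>x :: 'v \<Rightarrow> complex. (\<Prod>v\<in>V. x v ^ e v) = (\<Prod>t\<in>T. x (w t))"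
proof -
  let ?I = "Sigma V (\<lambda>v. {..<e v})"
  have "card ?I = card T" using assms by simp
  then obtain b where b: "bij_betw b T ?I"
    using assms finite_same_card_bij[of T ?I] by auto
  have "(\<Prod>v\<in>V. x v ^ e v) = (\<Prod>t\<in>T. x (fst (b t)))" for x :: "'v \<Rightarrow> complex"
  proof -
    have "(\<Prod>v\<in>V. x v ^ e v) = (\<Prod>(v, n)\<in>?I. x v)"
      using assms by (subst prod.Sigma[symmetric]) auto
    also have "\<dots> = (\<Prod>t\<in>T. x (fst (b t)))"
      using prod.reindex_bij_betw[OF b, of "\<lambda>(v, n). x v"] by (simp add: split_def)
    finally show ?thesis .
  qed
  then show ?thesis by (intro exI[of _ "fst \<circ> b"]) simp
qed

lemma mono_eval_as_product:
  fixes \<mu> :: "('N::finite, 'n::finite) var \<Rightarrow>\<^sub>0 nat"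
  assumes "Xdegree \<mu> = d" "Adegree \<mu> = CARD('k::finite) * CARD('N)"
  shows "\<exists>i j a l. \<forall>X A. mono_eval \<mu> X A =
    (\<Prod>s<d. X $ i s $ j s) * (\<Prod>t\<in>(UNIV :: ('k \<times> 'N) set). A $ a t $ l t)"
proof -
  have X: "(\<Sum>v\<in>UNIV. Poly_Mapping.lookup \<mu> (XVar (fst v) (snd v))) = card {..<d}"
    using assms(1) by (simp add: Xdegree_def sum.cartesian_product split_def flip: UNIV_Times_UNIV)
  have A: "(\<Sum>v\<in>UNIV. Poly_Mapping.lookup \<mu> (AVar (fst v) (snd v))) = card (UNIV :: ('k \<times> 'N) set)"
    using assms(2) by (simp add: Adegree_def sum.cartesian_product split_def flip: UNIV_Times_UNIV)
  obtain w where w: "\<And>x :: 'N \<times> 'N \<Rightarrow> complex. (\<Prod>v\<in>UNIV. x v ^ Poly_Mapping.lookup \<mu> (XVar (fst v) (snd v))) = (\<Prod>s<d. x (w s))"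
    using prod_power_index[OF _ _ X] by auto
  obtain w' where w': "\<And>x :: 'n \<times> 'N \<Rightarrow> complex. (\<Prod>v\<in>UNIV. x v ^ Poly_Mapping.lookup \<mu> (AVar (fst v) (snd v))) = (\<Prod>t\<in>(UNIV :: ('k \<times> 'N) set). x (w' t))"
    using prod_power_index[OF _ _ A] by auto
  have "mono_eval \<mu> X A = (\<Prod>s<d. X $ fst (w s) $ snd (w s)) *
      (\<Prod>t\<in>(UNIV :: ('k \<times> 'N) set). A $ fst (w' t) $ snd (w' t))" for X A
    using w[of "\<lambda>v. X $ fst v $ snd v"] w'[of "\<lambda>v. A $ fst v $ snd v"]
    by (simp add: mono_eval_def prod_UNIV_var prod.cartesian_product split_def)
  then show ?thesis
    by (intro exI[of _ "\<lambda>s. fst (w s)"] exI[of _ "\<lambda>s. snd (w s)"]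
        exI[of _ "\<lambda>t. fst (w' t)"] exI[of _ "\<lambda>t. snd (w' t)"]) blast
qed

text \<open>The property \<open>P\<close> stands for membership in the span of the generators. It is
  later instantiated with the existence of a lift to a weight 1 covariant, so that lifts have to be
  constructed for generators only.\<close>

locale closed_under_traces_dets =
  fixes P :: "(complex ^ 'N ^ 'N \<Rightarrow> complex ^ 'N ^ 'n \<Rightarrow> complex) \<Rightarrow> bool"
    and k_type :: "'k::finite itself"
  assumes P_add: "P \<phi> \<Longrightarrow> P \<psi> \<Longrightarrow> P (\<lambda>X A. \<phi> X A + \<psi> X A)"
    and P_scale: "P \<phi> \<Longrightarrow> P (\<lambda>X (A :: complex ^ ('N::finite) ^ ('n::finite)). c * \<phi> X A)"
    and P_generator: "P (\<lambda>X A. (\<Prod>m\<leftarrow>ms. trace (matpow X m)) *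
      (\<Prod>\<kappa>\<in>(UNIV :: 'k set). det (\<chi> c. (A ** matpow X (e \<kappa> c)) $ a \<kappa> c)))"
begin

lemma P_zero: "P (\<lambda>X A. 0)"
  using P_scale[OF P_generator, of 0] by simp

lemma P_sum: "(\<And>i. i \<in> I \<Longrightarrow> P (\<phi> i)) \<Longrightarrow> P (\<lambda>X A. \<Sum>i\<in>I. \<phi> i X A)"
  by (induct I rule: infinite_finite_induct) (simp_all add: P_zero P_add)

lemma P_contraction:
  assumes "network (q :: 'k \<Rightarrow> 'N \<Rightarrow> 's) p R T"
  shows "P (\<lambda>X A. contraction q p R T (\<lambda>r. matpow X (m r)) (\<lambda>t. (A ** matpow X (e t)) $ a t))"
proof -
  obtain ms a' e' where "\<forall>X (A :: complex ^ 'N ^ 'n).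
      contraction q p R T (\<lambda>r. matpow X (m r)) (\<lambda>t. (A ** matpow X (e t)) $ a t) =
      (\<Prod>m\<leftarrow>ms. trace (matpow X m)) * (\<Prod>\<kappa>\<in>(UNIV :: 'k set). det (\<chi> c. (A ** matpow X (e' \<kappa> c)) $ a' \<kappa> c))"
    using contraction_eq_traces_dets[OF assms] by blast
  then show ?thesis using P_generator by simp
qed

text \<open>Expanding the determinants in \<open>adj_conj\<close> over \<open>y\<close> turns the
  monomial into a combination of products of linear forms in \<open>g\<close>. Polarization replaces
  each product by a sum over matchings \<open>\<beta>\<close>, and the cancellation of tensors makes
  each matching a combination of networks.\<close>

lemma P_polarize_monomial:
  fixes a :: "'k \<times> 'N \<Rightarrow> 'n"
  shows "P (\<lambda>X A. polarize (blocks d :: ('k + nat) set)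
    (\<lambda>g. (\<Prod>s<d. adj_conj g X $ i s $ j s) * (\<Prod>t\<in>UNIV. (A ** g) $ a t $ l t)))"
proof -
  let ?B = "blocks d :: ('k + nat) set"
  let ?S = "?B \<times> UNIV :: (('k + nat) \<times> 'N) set"
  let ?Y = "PiE ({..<d} \<times> UNIV) (\<lambda>_. UNIV) :: (nat \<times> 'N \<Rightarrow> 'N) set"
  let ?PI = "PiE {..<d} (\<lambda>_. {\<pi>. \<pi> permutes UNIV}) :: (nat \<Rightarrow> 'N \<Rightarrow> 'N) set"
  let ?R = "matrix_wires d :: (('k + nat) \<times> 'N) set"
  \<comment> \<open>Column \<open>i s\<close> of the \<open>s\<close>-th determinant carries
    \<open>X\<close>, the others the identity matrix. Writing these as powers with exponents 1 and
    0, and the rows of \<open>A\<close> with exponent 0, gives the form that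
    \<open>P_contraction\<close> treats.\<close>
  define m where "m v = (if snd v = i (projr (fst v)) then 1 else 0 :: nat)" for v :: "('k + nat) \<times> 'N"
  define a' where "a' v = a (projl (fst v), snd v)" for v :: "('k + nat) \<times> 'N"
  define M where "M X v = matpow X (m v)" for X :: "complex ^ 'N ^ 'N" and v :: "('k + nat) \<times> 'N"
  define L where "L X A v = (A ** matpow X 0) $ a' v" for X and A :: "complex ^ 'N ^ 'n" and v
  \<comment> \<open>The column of \<open>g\<close> that the form \<open>v\<close> involves. In the
    replaced column \<open>i s\<close> it is \<open>j s\<close>, because column \<open>j s\<close>
    of \<open>X ** g\<close> stands there.\<close>
  define col where "col v = (case fst v of Inr s \<Rightarrow> if snd v = i s then j s else snd v | Inl \<kappa> \<Rightarrow> l (\<kappa>, snd v))"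
    for v :: "('k + nat) \<times> 'N"
  define u where "u X A y v z = (if v \<in> ?R then M X v $ y (projr (fst v), snd v) $ z else L X A v $ z)"
    for X :: "complex ^ 'N ^ 'N" and A y v z
  \<comment> \<open>The condition that the columns match concerns \<open>\<beta>\<close> alone, so
    it enters as a scalar coefficient.\<close>
  define K where "K \<beta> = (\<Prod>v\<in>?S. if snd (\<beta> v) = col v then 1 else (0 :: complex))"
    for \<beta> :: "('k + nat) \<times> 'N \<Rightarrow> ('k + nat) \<times> 'N"
  have prodS: "(\<Prod>v\<in>?S. h v) = (\<Prod>v\<in>?R. h v) * (\<Prod>v\<in>row_wires. h v)" for h :: "_ \<Rightarrow> complex"
    unfolding wires_Un by (rule prod.union_disjoint) (auto simp: wires_Int)
  have row: "v \<notin> ?R" if "v \<in> row_wires" for v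
    using that wires_Int[of d] by blast
  have G: "(\<Prod>s<d. adj_conj g X $ i s $ j s) * (\<Prod>t\<in>UNIV. (A ** g) $ a t $ l t) =
      (\<Sum>y\<in>?Y. block_eps {..<d} y * (\<Prod>v\<in>?S. \<Sum>z\<in>UNIV. u X A y v z * g $ z $ col v))" for g X A
  proof -
    have "(\<Prod>s<d. adj_conj g X $ i s $ j s) = (\<Sum>y\<in>?Y. block_eps {..<d} y *
        (\<Prod>v\<in>{..<d} \<times> UNIV. if snd v = i (fst v) then (X ** g) $ y v $ j (fst v) else g $ y v $ snd v))"
      unfolding adj_conj_def by (simp add: prod_det_columns block_eps_def)
    moreover have "(\<Prod>v\<in>?R. \<Sum>z\<in>UNIV. u X A y v z * g $ z $ col v) =
        (\<Prod>v\<in>{..<d} \<times> UNIV. if snd v = i (fst v) then (X ** g) $ y v $ j (fst v) else g $ y v $ snd v)" for y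
      unfolding prod_matrix_wires
    proof (rule prod.cong[OF refl])
      fix v :: "nat \<times> 'N" assume "v \<in> {..<d} \<times> UNIV"
      then have "(Inr (fst v), snd v) \<in> ?R" by (auto simp: matrix_wires_def)
      then have "(\<Sum>z\<in>UNIV. u X A y (Inr (fst v), snd v) z * g $ z $ col (Inr (fst v), snd v)) =
          (matpow X (m (Inr (fst v), snd v)) ** g) $ y v $ col (Inr (fst v), snd v)"
        by (simp add: u_def M_def matrix_matrix_mult_def)
      then show "(\<Sum>z\<in>UNIV. u X A y (Inr (fst v), snd v) z * g $ z $ col (Inr (fst v), snd v)) =
          (if snd v = i (fst v) then (X ** g) $ y v $ j (fst v) else g $ y v $ snd v)"
        by (simp add: m_def col_def)
    qed
    moreover have "(\<Prod>v\<in>row_wires. \<Sum>z\<in>UNIV. u X A y v z * g $ z $ col v) =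
        (\<Prod>t\<in>UNIV. (A ** g) $ a t $ l t)" for y
      unfolding prod_row_wires
    proof (rule prod.cong[OF refl])
      fix v :: "'k \<times> 'N"
      have "(Inl (fst v), snd v) \<notin> ?R" by (auto simp: matrix_wires_def)
      then show "(\<Sum>z\<in>UNIV. u X A y (Inl (fst v), snd v) z * g $ z $ col (Inl (fst v), snd v)) =
          (A ** g) $ a v $ l v"
        by (simp add: u_def L_def a'_def col_def) (simp add: matrix_matrix_mult_def)
    qed
    ultimately show ?thesis
      by (simp only: prodS sum_distrib_right mult.assoc)
  qed
  have split: "(\<Prod>v\<in>?S. if snd (\<beta> v) = col v then u X A y v (x (\<beta> v)) else 0) =
      K \<beta> * ((\<Prod>v\<in>?R. M X v $ y (projr (fst v), snd v) $ x (\<beta> v)) * (\<Prod>v\<in>row_wires. L X A v $ x (\<beta> v)))"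
    for \<beta> X A y x
  proof -
    have "(\<Prod>v\<in>?S. if snd (\<beta> v) = col v then u X A y v (x (\<beta> v)) else 0) =
        K \<beta> * (\<Prod>v\<in>?S. u X A y v (x (\<beta> v)))"
      unfolding K_def by (subst prod.distrib[symmetric], rule prod.cong) auto
    then show ?thesis
      unfolding prodS by (simp add: u_def row cong: prod.cong)
  qed
  have "polarize ?B (\<lambda>g. (\<Prod>s<d. adj_conj g X $ i s $ j s) * (\<Prod>t\<in>UNIV. (A ** g) $ a t $ l t)) =
      (\<Sum>\<beta> | \<beta> permutes ?S. K \<beta> * (\<Sum>\<sigma>\<in>?PI. (\<Prod>s<d. of_int (sign (\<sigma> s))) *
        contraction (\<lambda>\<kappa> c. inv \<beta> (Inl \<kappa>, c))
          (\<lambda>v. inv \<beta> (Inr (projr (fst v)), \<sigma> (projr (fst v)) (snd v))) ?R row_wires (M X) (L X A)))" for X A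
  proof -
    have "polarize ?B (\<lambda>g. (\<Prod>s<d. adj_conj g X $ i s $ j s) * (\<Prod>t\<in>UNIV. (A ** g) $ a t $ l t)) =
        (\<Sum>y\<in>?Y. block_eps {..<d} y * (\<Sum>x\<in>PiE ?S (\<lambda>_. UNIV). block_eps ?B x *
          (\<Sum>\<beta> | \<beta> permutes ?S. K \<beta> * ((\<Prod>v\<in>?R. M X v $ y (projr (fst v), snd v) $ x (\<beta> v)) *
            (\<Prod>v\<in>row_wires. L X A v $ x (\<beta> v))))))"
      by (simp only: G polarize_sum polarize_linear_forms finite_wires split)
    also have "\<dots> = (\<Sum>\<beta> | \<beta> permutes ?S. K \<beta> * (\<Sum>x\<in>PiE ?S (\<lambda>_. UNIV). block_eps ?B x *
        (\<Sum>y\<in>?Y. block_eps {..<d} y * ((\<Prod>v\<in>?R. M X v $ y (projr (fst v), snd v) $ x (\<beta> v)) *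
            (\<Prod>v\<in>row_wires. L X A v $ x (\<beta> v))))))"
      unfolding sum_distrib_left
      by (subst sum.swap, subst (2) sum.swap, subst sum.swap) (simp only: mult.left_commute)
    finally show ?thesis by (simp add: sum_block_eps_pair)
  qed
  moreover have "P (\<lambda>X A. contraction (\<lambda>\<kappa> c. inv \<beta> (Inl \<kappa>, c))
      (\<lambda>v. inv \<beta> (Inr (projr (fst v)), \<sigma> (projr (fst v)) (snd v))) ?R row_wires (M X) (L X A))"
    if "\<beta> permutes ?S" "\<sigma> \<in> ?PI" for \<beta> \<sigma>
    unfolding M_def L_def using that by (intro P_contraction network_of_permutations) auto
  ultimately show ?thesis
    by (simp only:) (intro P_sum P_scale, simp)
qed

end

section \<open>Bihomogeneous components of covariants\<close>

lemma mscale_matmul: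
  "mscale c M ** N = mscale c (M ** N)" "M ** mscale c N = mscale c (M ** N)"
  by (simp_all add: vec_eq_iff matrix_matrix_mult_def sum_distrib_left mult_ac)

lemma det_mscale_1: "det (mscale c (mat 1) :: complex ^ 'N ^ ('N::finite)) = c ^ CARD('N)"
  by (subst det_diagonal) (simp_all add: mat_def)

lemma invertible_matrix_inv:
  assumes "invertible (g :: complex ^ 'N ^ ('N::finite))"
  shows "invertible (matrix_inv g)" "matrix_inv (matrix_inv g) = g"
    "det (matrix_inv g) = inverse (det g)"
proof -
  note inv = matrix_inv_mult[OF assms]
  show "invertible (matrix_inv g)" using inv unfolding invertible_def by blast
  show "matrix_inv (matrix_inv g) = g" using inv by (intro matrix_inv_eqI) auto
  have "det (matrix_inv g) * det g = 1" using inv det_mul[of "matrix_inv g" g] by simp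
  then show "det (matrix_inv g) = inverse (det g)"
    by (metis inverse_unique mult.commute)
qed

lemma covariantsD:
  "f \<in> covariants l \<Longrightarrow> invertible g \<Longrightarrow>
    peval f (g ** X ** matrix_inv g) (A ** matrix_inv g) = det g powi (- int l) * peval f X A"
  by (simp add: covariants_def)

definition bihomogeneous_part ::
  "nat \<Rightarrow> nat \<Rightarrow> ('N::finite, 'n::finite) cpoly \<Rightarrow> complex ^ 'N ^ 'N \<Rightarrow> complex ^ 'N ^ 'n \<Rightarrow> complex" where
  "bihomogeneous_part d e f X A = (\<Sum>\<mu>\<in>{\<mu>\<in>Poly_Mapping.keys f. Xdegree \<mu> = d \<and> Adegree \<mu> = e}.
     Poly_Mapping.lookup f \<mu> * mono_eval \<mu> X A)"

text \<open>Conjugation commutes with scaling \<open>X\<close> by \<open>t\<close>, so covariance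
  can be compared coefficient by coefficient in \<open>t\<close>.\<close>

lemma covariant_Xpart:
  fixes g :: "complex ^ 'N ^ ('N::finite)"
  assumes f: "f \<in> covariants l" and g: "invertible g"
  shows "(\<Sum>\<mu>\<in>{\<mu>\<in>Poly_Mapping.keys f. Xdegree \<mu> = d}.
      Poly_Mapping.lookup f \<mu> * mono_eval \<mu> (g ** X ** matrix_inv g) (A ** matrix_inv g)) =
    det g powi (- int l) * (\<Sum>\<mu>\<in>{\<mu>\<in>Poly_Mapping.keys f. Xdegree \<mu> = d}.
      Poly_Mapping.lookup f \<mu> * mono_eval \<mu> X A)"
proof -
  let ?c = "\<lambda>\<mu>. Poly_Mapping.lookup f \<mu> * mono_eval \<mu> (g ** X ** matrix_inv g) (A ** matrix_inv g) -
    det g powi (- int l) * (Poly_Mapping.lookup f \<mu> * mono_eval \<mu> X A)"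
  have "(\<Sum>\<mu>\<in>{\<mu>\<in>Poly_Mapping.keys f. Xdegree \<mu> = d}. ?c \<mu>) = (if d = 0 then 0 else 0)"
  proof (rule sum_monomials_coeff)
    fix t :: complex
    have "peval f (mscale t (g ** X ** matrix_inv g)) (A ** matrix_inv g) =
        det g powi (- int l) * peval f (mscale t X) A"
      using covariantsD[OF f g, of "mscale t X"] by (simp add: mscale_matmul)
    then show "(\<Sum>\<mu>\<in>Poly_Mapping.keys f. ?c \<mu> * t ^ Xdegree \<mu>) = 0 * t ^ 0"
      by (simp add: peval_mono_eval mono_eval_scale_X left_diff_distrib right_diff_distrib sum_subtractf
          sum_distrib_left mult_ac)
  qed simp
  then show ?thesis by (simp add: sum_subtractf sum_distrib_left)
qed

text \<open>The scalar matrix with entry 1/t fixes \<open>X\<close>, takes \<open>A\<close> to t A,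
  and its determinant to the power -l is t^(l N). Covariance therefore forces degree l N in
  \<open>A\<close>.\<close>

lemma covariant_Xpart_eq_bihomogeneous_part:
  assumes f: "(f :: ('N::finite, 'n::finite) cpoly) \<in> covariants l"
  shows "(\<Sum>\<mu>\<in>{\<mu>\<in>Poly_Mapping.keys f. Xdegree \<mu> = d}. Poly_Mapping.lookup f \<mu> * mono_eval \<mu> X A) =
    bihomogeneous_part d (l * CARD('N)) f X A"
proof -
  let ?K = "{\<mu>\<in>Poly_Mapping.keys f. Xdegree \<mu> = d}"
  let ?h = "\<Sum>\<mu>\<in>?K. Poly_Mapping.lookup f \<mu> * mono_eval \<mu> X A"
  have "(\<Sum>\<mu>\<in>{\<mu>\<in>?K. Adegree \<mu> = l * CARD('N)}. Poly_Mapping.lookup f \<mu> * mono_eval \<mu> X A) =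
      (if l * CARD('N) = l * CARD('N) then ?h else 0)"
  proof (rule sum_monomials_coeff)
    fix t :: complex assume t: "t \<noteq> 0"
    let ?g = "mscale (inverse t) (mat 1) :: complex ^ 'N ^ 'N"
    have inv: "?g ** mscale t (mat 1) = mat 1" "mscale t (mat 1) ** ?g = mat 1"
      using t by (simp_all add: vec_eq_iff add: mscale_matmul)
    then have g: "invertible ?g" "matrix_inv ?g = mscale t (mat 1)"
      by (auto simp: invertible_def intro: matrix_inv_eqI)
    have "?g ** X ** mscale t (mat 1) = X" "A ** mscale t (mat 1) = mscale t A"
      using t by (simp_all add: vec_eq_iff add: mscale_matmul)
    moreover have "det ?g powi (- int l) = t ^ (l * CARD('N))"
      using t by (simp add: det_mscale_1 power_int_minus power_inverse flip: power_mult)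
        (simp add: mult.commute)
    ultimately have "(\<Sum>\<mu>\<in>?K. Poly_Mapping.lookup f \<mu> * mono_eval \<mu> X (mscale t A)) = t ^ (l * CARD('N)) * ?h"
      using covariant_Xpart[OF f g(1), where d = d and X = X and A = A] by (simp add: g(2))
    then show "(\<Sum>\<mu>\<in>?K. Poly_Mapping.lookup f \<mu> * mono_eval \<mu> X A * t ^ Adegree \<mu>) = ?h * t ^ (l * CARD('N))"
      by (simp add: mono_eval_scale_A mult_ac)
  qed simp
  then show ?thesis by (simp add: bihomogeneous_part_def conj_assoc)
qed

lemma peval_eq_sum_bihomogeneous_parts:
  assumes "(f :: ('N::finite, 'n::finite) cpoly) \<in> covariants l"
  shows "peval f X A = (\<Sum>d\<in>Xdegree ` Poly_Mapping.keys f. bihomogeneous_part d (l * CARD('N)) f X A)"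
  unfolding peval_mono_eval covariant_Xpart_eq_bihomogeneous_part[OF assms, symmetric]
  by (rule sum.image_gen) simp

text \<open>For invertible \<open>g\<close> this is covariance under g^-1 together with degree
  \<open>d\<close> in \<open>X\<close>. Both sides are polynomial in \<open>g\<close>, so it extends
  to singular \<open>g\<close>; this matters because polarization evaluates at sums of matrix
  units.\<close>

lemma bihomogeneous_part_adj_conj:
  assumes f: "(f :: ('N::finite, 'n::finite) cpoly) \<in> covariants l"
  shows "bihomogeneous_part d (l * CARD('N)) f (adj_conj g X) (A ** g) =
    det g ^ (l + d) * bihomogeneous_part d (l * CARD('N)) f X A"
proof -
  let ?h = "bihomogeneous_part d (l * CARD('N)) f"
  have inv: "?h (adj_conj g X) (A ** g) = det g ^ (l + d) * ?h X A" if g: "invertible g" for g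
  proof -
    have "det g \<noteq> 0" using g by (simp add: invertible_det_nz)
    have "?h (adj_conj g X) (A ** g) = det g ^ d * ?h (matrix_inv g ** X ** g) (A ** g)"
      by (simp add: adj_conj_invertible[OF g] bihomogeneous_part_def mono_eval_scale_X
          sum_distrib_left mult_ac)
    also have "?h (matrix_inv g ** X ** g) (A ** g) = det g ^ l * ?h X A"
      using covariant_Xpart[OF f invertible_matrix_inv(1)[OF g], where d = d and X = X and A = A] \<open>det g \<noteq> 0\<close>
      by (simp add: invertible_matrix_inv[OF g] covariant_Xpart_eq_bihomogeneous_part[OF f]
          power_int_minus power_inverse)
    finally show ?thesis by (simp add: power_add)
  qed
  \<comment> \<open>In these uses of \<open>polyfun\<close> the matrix variable is \<open>g\<close>,
    while \<open>X\<close> and \<open>A\<close> are constants.\<close>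
  have adj: "polyfun (\<lambda>g (B :: complex ^ 'N ^ 'n). adj_conj g X $ i $ j)" for i j
  proof -
    have "polyfun (\<lambda>g (B :: complex ^ 'N ^ 'n). if c = i then (X ** g) $ z $ j else g $ z $ c)" for z c
      by (cases "c = i") (auto intro!: polyfun_intros)
    then show ?thesis unfolding adj_conj_def by (auto intro!: polyfun_intros)
  qed
  have "polyfun (\<lambda>g (B :: complex ^ 'N ^ 'n). var_val (adj_conj g X) (A ** g) v)" for v
    using adj by (cases v) (auto intro!: polyfun_intros)
  then have "polyfun (\<lambda>g (B :: complex ^ 'N ^ 'n). ?h (adj_conj g X) (A ** g))"
    unfolding bihomogeneous_part_def mono_eval_def by (intro polyfun_intros)
  moreover have "polyfun (\<lambda>g (B :: complex ^ 'N ^ 'n). det g ^ (l + d) * ?h X A)"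
    by (intro polyfun_intros)
  ultimately show ?thesis
    using inv by (rule polyfun_eq_on_invertible)
qed

context closed_under_traces_dets
begin

text \<open>Polarizing \<open>bihomogeneous_part_adj_conj\<close> in \<open>g\<close> gives a
  nonzero constant times the component on one side and polarized monomials on the other.\<close>

lemma P_bihomogeneous_part:
  assumes f: "f \<in> covariants CARD('k)"
  shows "P (bihomogeneous_part d (CARD('k) * CARD('N)) f)"
proof -
  let ?B = "blocks d :: ('k + nat) set"
  let ?h = "bihomogeneous_part d (CARD('k) * CARD('N)) f"
  let ?Q = "{\<mu>\<in>Poly_Mapping.keys f. Xdegree \<mu> = d \<and> Adegree \<mu> = CARD('k) * CARD('N)}"
  let ?C = "polarize ?B (\<lambda>g :: complex ^ 'N ^ 'N. det g ^ card ?B)"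
  have C: "?C \<noteq> 0" by (rule polarize_det_power) simp
  have "?C * ?h X A = (\<Sum>\<mu>\<in>?Q. Poly_Mapping.lookup f \<mu> *
      polarize ?B (\<lambda>g. mono_eval \<mu> (adj_conj g X) (A ** g)))" for X A
  proof -
    have "?C * ?h X A = polarize ?B (\<lambda>g. ?h (adj_conj g X) (A ** g))"
      by (simp only: bihomogeneous_part_adj_conj[OF f] card_blocks polarize_mult_right)
    then show ?thesis by (simp only: bihomogeneous_part_def polarize_sum)
  qed
  moreover have "P (\<lambda>X A. polarize ?B (\<lambda>g. mono_eval \<mu> (adj_conj g X) (A ** g)))"
    if "\<mu> \<in> ?Q" for \<mu>
  proof -
    have "Xdegree \<mu> = d" "Adegree \<mu> = CARD('k) * CARD('N)" using that by auto
    from mono_eval_as_product[OF this] obtain i j a l where "\<And>X A. mono_eval \<mu> X A =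
        (\<Prod>s<d. X $ i s $ j s) * (\<Prod>t\<in>(UNIV :: ('k \<times> 'N) set). A $ a t $ l t)"
      by blast
    then show ?thesis by (simp add: P_polarize_monomial)
  qed
  ultimately have "P (\<lambda>X A. ?C * ?h X A)"
    by (simp only:) (intro P_sum P_scale)
  from P_scale[OF this, of "inverse ?C"] C show ?thesis
    by (simp flip: mult.assoc)
qed

theorem P_covariant:
  assumes "f \<in> covariants CARD('k)"
  shows "P (peval f)"
proof -
  have "peval f = (\<lambda>X A. \<Sum>d\<in>Xdegree ` Poly_Mapping.keys f. bihomogeneous_part d (CARD('k) * CARD('N)) f X A)"
    by (intro ext peval_eq_sum_bihomogeneous_parts[OF assms])
  then show ?thesis by (simp only:) (intro P_sum P_bihomogeneous_part assms)
qed

end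

section \<open>Restriction to inflated matrices\<close>

text \<open>The Kronecker product of \<open>B\<close> with the identity matrix of size k; the second
  component of an index is its colour.\<close>

definition inflate :: "'a::zero ^ 'm ^ 'p \<Rightarrow> 'a ^ ('m::finite \<times> 'k::finite) ^ ('p::finite \<times> 'k)" where
  "inflate B = (\<chi> u v. if snd u = snd v then B $ fst u $ fst v else 0)"

lemma inflate_nth [simp]: "inflate B $ u $ v = (if snd u = snd v then B $ fst u $ fst v else 0)"
  by (simp add: inflate_def)

lemma sum_UNIV_prod: "(\<Sum>w\<in>UNIV. h w) = (\<Sum>i\<in>UNIV. \<Sum>j\<in>UNIV. h (i, j))"
  by (simp add: sum.cartesian_product)

lemma inflate_mult: "inflate (B ** C) = inflate B ** (inflate C :: complex ^ ('m::finite \<times> 'k::finite) ^ _)"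
proof -
  have "(\<Sum>w\<in>UNIV. inflate B $ u $ w * inflate C $ w $ v) = (inflate (B ** C) :: complex ^ ('m \<times> 'k) ^ _) $ u $ v" for u v
  proof -
    have "(\<Sum>w\<in>UNIV. inflate B $ u $ w * inflate C $ w $ v) =
        (\<Sum>i\<in>UNIV. \<Sum>j\<in>UNIV. if j = snd u then (if snd u = snd v then B $ fst u $ i * C $ i $ fst v else 0) else 0)"
      unfolding sum_UNIV_prod by (intro sum.cong refl) auto
    then show ?thesis by (simp add: matrix_matrix_mult_def)
  qed
  then show ?thesis unfolding vec_eq_iff matrix_matrix_mult_def[of "inflate B"] by simp
qed

lemma inflate_mat_1 [simp]: "inflate (mat 1) = mat 1"
  by (auto simp: vec_eq_iff mat_def prod_eq_iff)

lemma inflate_add: "inflate (B + C) = inflate B + inflate (C :: complex ^ 'm::finite ^ 'p::finite)"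
  by (simp add: vec_eq_iff)

lemma inflate_mscale: "inflate (mscale c B) = mscale c (inflate B)"
  by (simp add: vec_eq_iff)

lemma inflate_matpow: "inflate (matpow X r) = matpow (inflate (X :: complex ^ 'm ^ 'm::finite)) r"
  by (induct r) (simp_all add: inflate_mult)

lemma det_inflate:
  "det (inflate g :: complex ^ ('m::finite \<times> 'k::finite) ^ ('m \<times> 'k)) = det g ^ CARD('k)"
  using det_block[of "\<lambda>_ :: 'k. g"] by (simp add: inflate_def)

lemma trace_inflate:
  "trace (inflate B :: complex ^ ('m::finite \<times> 'k::finite) ^ ('m \<times> 'k)) = of_nat CARD('k) * trace B"
  unfolding trace_def sum_UNIV_prod by (simp add: sum_distrib_left)

lemma inflate_invertible:
  fixes g :: "complex ^ 'm ^ ('m::finite)"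
  assumes "invertible g"
  shows "invertible (inflate g :: complex ^ ('m \<times> 'k::finite) ^ ('m \<times> 'k))"
    and "matrix_inv (inflate g :: complex ^ ('m \<times> 'k) ^ ('m \<times> 'k)) = inflate (matrix_inv g)"
proof -
  have "inflate g ** (inflate (matrix_inv g) :: complex ^ ('m \<times> 'k) ^ ('m \<times> 'k)) = mat 1"
    "inflate (matrix_inv g) ** (inflate g :: complex ^ ('m \<times> 'k) ^ ('m \<times> 'k)) = mat 1"
    by (simp_all add: matrix_inv_mult[OF assms] flip: inflate_mult)
  then show "invertible (inflate g :: complex ^ ('m \<times> 'k) ^ ('m \<times> 'k))"
    and "matrix_inv (inflate g :: complex ^ ('m \<times> 'k) ^ ('m \<times> 'k)) = inflate (matrix_inv g)"
    by (auto simp: invertible_def intro: matrix_inv_eqI)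
qed

text \<open>Restriction to the points (X \<otimes> 1, A \<otimes> 1). Values determine it by
  \<open>peval_inject\<close>, and it exists because inflated matrices have polynomial
  entries.\<close>

definition deflate ::
  "('m::finite \<times> 'k::finite, 'p::finite \<times> 'k) cpoly \<Rightarrow> ('m, 'p) cpoly" where
  "deflate F = (THE f. \<forall>X A. peval f X A = peval F (inflate X) (inflate A))"

lemma peval_deflate [simp]: "peval (deflate F) X A = peval F (inflate X) (inflate A)"
proof -
  have "polyfun (\<lambda>X A. var_val (inflate X) (inflate A) v)" for v :: "('a \<times> 'c, 'b \<times> 'c) var"
  proof (cases v)
    case (XVar u w)
    then show ?thesis by (cases "snd u = snd w") (auto intro!: polyfun_intros)
  next
    case (AVar u w)
    then show ?thesis by (cases "snd u = snd w") (auto intro!: polyfun_intros)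
  qed
  then have "polyfun (\<lambda>X A. peval F (inflate X) (inflate A))"
    unfolding peval_mono_eval mono_eval_def by (intro polyfun_intros)
  then obtain f where "\<forall>X A. peval f X A = peval F (inflate X) (inflate A)"
    unfolding polyfun_def by metis
  then have "\<exists>!f. \<forall>X A. peval f X A = peval F (inflate X) (inflate A)"
    by (metis peval_inject)
  from theI'[OF this] show ?thesis unfolding deflate_def by blast
qed

lemma deflate_add: "deflate (F + G) = deflate F + deflate G"
  and deflate_diff: "deflate (F - G) = deflate F - deflate G"
  and deflate_pscale: "deflate (pscale c F) = pscale c (deflate F)"
  and deflate_0: "deflate 0 = 0"
  by (rule peval_inject, simp)+

text \<open>The weight changes from 1 to k because det(g \<otimes> 1) = det(g)^k.\<close>

lemma deflate_covariants:
  assumes "(F :: ('m::finite \<times> 'k::finite, 'p::finite \<times> 'k) cpoly) \<in> covariants 1"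
  shows "deflate F \<in> covariants CARD('k)"
proof -
  have "peval F (inflate (g ** X ** matrix_inv g)) (inflate (A ** matrix_inv g)) =
      det g powi (- int CARD('k)) * peval F (inflate X) (inflate A)"
    if g: "invertible g" for g :: "complex ^ 'm ^ 'm" and X A
    using covariantsD[OF assms inflate_invertible(1)[OF g]]
    by (simp add: inflate_mult inflate_invertible(2)[OF g] det_inflate power_int_minus)
  then show ?thesis by (simp add: covariants_def)
qed

lemma deflate_Xhomogeneous: "Xhomogeneous d F \<Longrightarrow> Xhomogeneous d (deflate F)"
  by (simp add: Xhomogeneous_iff inflate_mscale)

section \<open>The current algebra action as directional derivatives\<close>

text \<open>The tangent vector to the space of matrices \<open>A\<close> through which \<open>x\<close> acts at \<open>(X, A)\<close>.\<close>

definition gl_dir ::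
  "complex poly ^ 'p ^ 'p \<Rightarrow> complex ^ 'm ^ 'm \<Rightarrow> complex ^ 'm ^ 'p \<Rightarrow> complex ^ ('m::finite) ^ ('p::finite)" where
  "gl_dir x X A = (\<chi> b j. \<Sum>a\<in>UNIV. \<Sum>r\<le>degree (x $ a $ b). coeff (x $ a $ b) r * (A ** matpow X r) $ a $ j)"

lemma peval_gl_act:
  "peval (gl_act x f) X A =
    (\<Sum>b\<in>UNIV. \<Sum>j\<in>UNIV. gl_dir x X A $ b $ j * peval (pderiv_var (AVar b j) f) X A)"
proof -
  let ?D = "\<lambda>b j. peval (pderiv_var (AVar b j) f) X A"
  have "(\<Sum>r\<le>degree (x $ a $ b). coeff (x $ a $ b) r * (\<Sum>i\<in>UNIV. \<Sum>j\<in>UNIV. A $ a $ i * matpow X r $ i $ j * ?D b j)) =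
      (\<Sum>j\<in>UNIV. (\<Sum>r\<le>degree (x $ a $ b). coeff (x $ a $ b) r * (A ** matpow X r) $ a $ j) * ?D b j)" for a b
  proof -
    have *: "(\<Sum>i\<in>UNIV. \<Sum>j\<in>UNIV. A $ a $ i * matpow X r $ i $ j * ?D b j) =
        (\<Sum>j\<in>UNIV. (A ** matpow X r) $ a $ j * ?D b j)" for r
      by (subst sum.swap) (simp add: matrix_matrix_mult_def sum_distrib_right)
    show ?thesis
      unfolding * by (simp only: sum_distrib_left sum_distrib_right mult.assoc) (rule sum.swap)
  qed
  then have "peval (gl_act x f) X A = (\<Sum>a\<in>UNIV. \<Sum>b\<in>UNIV. \<Sum>j\<in>UNIV.
      (\<Sum>r\<le>degree (x $ a $ b). coeff (x $ a $ b) r * (A ** matpow X r) $ a $ j) * ?D b j)"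
    by (simp add: gl_act_def E_act_def)
  also have "\<dots> = (\<Sum>b\<in>UNIV. \<Sum>j\<in>UNIV. \<Sum>a\<in>UNIV.
      (\<Sum>r\<le>degree (x $ a $ b). coeff (x $ a $ b) r * (A ** matpow X r) $ a $ j) * ?D b j)"
    by (subst sum.swap, rule sum.cong[OF refl], rule sum.swap)
  finally show ?thesis by (simp add: gl_dir_def sum_distrib_right)
qed

lemma gl_act_derivative:
  "((\<lambda>t. peval f X (A + mscale t (gl_dir x X A))) has_field_derivative peval (gl_act x f) X A) (at 0)"
  unfolding peval_gl_act by (rule has_field_derivative_peval)

lemma matpow_conj:
  assumes "invertible (g :: complex ^ 'm ^ ('m::finite))"
  shows "matpow (g ** X ** matrix_inv g) r = g ** matpow X r ** matrix_inv g"
proof (induct r)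
  case 0
  show ?case by (simp add: matrix_inv_mult[OF assms])
next
  case (Suc r)
  have "matpow (g ** X ** matrix_inv g) (Suc r) = g ** X ** (matrix_inv g ** g) ** matpow X r ** matrix_inv g"
    by (simp only: matpow.simps Suc matrix_mul_assoc)
  then show ?case by (simp add: matrix_inv_mult[OF assms] matrix_mul_assoc)
qed

lemma gl_dir_conj:
  assumes g: "invertible (g :: complex ^ 'm ^ ('m::finite))"
  shows "gl_dir x (g ** X ** matrix_inv g) (A ** matrix_inv g) = gl_dir x X A ** matrix_inv g"
proof -
  have "A ** matrix_inv g ** matpow (g ** X ** matrix_inv g) r = A ** matpow X r ** matrix_inv g" for r
  proof -
    have "A ** matrix_inv g ** matpow (g ** X ** matrix_inv g) r =
        A ** (matrix_inv g ** g) ** matpow X r ** matrix_inv g"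
      by (simp only: matpow_conj[OF g] matrix_mul_assoc)
    then show ?thesis by (simp add: matrix_inv_mult[OF g])
  qed
  moreover have "(\<Sum>a\<in>UNIV. \<Sum>r\<le>degree (x $ a $ b). coeff (x $ a $ b) r * (A ** matpow X r ** h) $ a $ j) =
      (\<Sum>i\<in>UNIV. (\<Sum>a\<in>UNIV. \<Sum>r\<le>degree (x $ a $ b). coeff (x $ a $ b) r * (A ** matpow X r) $ a $ i) * h $ i $ j)"
    for b j and h :: "complex ^ 'm ^ 'm"
  proof -
    have "(A ** matpow X r ** h) $ a $ j = (\<Sum>i\<in>UNIV. (A ** matpow X r) $ a $ i * h $ i $ j)" for a r
      by (simp add: matrix_matrix_mult_def[of "A ** _"])
    then show ?thesis
      unfolding sum_distrib_right
      by (simp only: sum_distrib_left, subst (2) sum.swap, subst sum.swap) (simp only: mult.assoc)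
  qed
  ultimately show ?thesis
    by (simp add: vec_eq_iff gl_dir_def matrix_matrix_mult_def[of "gl_dir x X A"]
        matrix_matrix_mult_def[of "vec_lambda _"])
qed

lemma matrix_add_rdistrib: "(B + C) ** D = B ** D + C ** (D :: complex ^ 'm ^ 'n::finite)"
  by (simp add: vec_eq_iff matrix_matrix_mult_def distrib_right sum.distrib)

text \<open>The direction \<open>gl_dir\<close> is equivariant, so \<open>g\<close> carries the line
  through \<open>A\<close> to the line through A g^-1; covariance is differentiated along
  it.\<close>

lemma gl_act_covariants:
  assumes f: "f \<in> covariants l"
  shows "gl_act x f \<in> covariants l"
  unfolding covariants_def
proof (intro CollectI allI impI)
  fix g :: "complex ^ 'a ^ 'a" and X and A :: "complex ^ 'a ^ 'b"
  assume g: "invertible g"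
  let ?X = "g ** X ** matrix_inv g" and ?A = "A ** matrix_inv g"
  have "?A + mscale t (gl_dir x ?X ?A) = (A + mscale t (gl_dir x X A)) ** matrix_inv g" for t
    by (simp add: gl_dir_conj[OF g] matrix_add_rdistrib mscale_matmul)
  then have "((\<lambda>t. det g powi (- int l) * peval f X (A + mscale t (gl_dir x X A))) has_field_derivative
      peval (gl_act x f) ?X ?A) (at 0)"
    using gl_act_derivative[of f ?X ?A x] by (simp add: covariantsD[OF f g])
  moreover have "((\<lambda>t. det g powi (- int l) * peval f X (A + mscale t (gl_dir x X A))) has_field_derivative
      det g powi (- int l) * peval (gl_act x f) X A) (at 0)"
    by (intro DERIV_cmult gl_act_derivative)
  ultimately show "peval (gl_act x f) ?X ?A = det g powi (- int l) * peval (gl_act x f) X A"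
    by (rule DERIV_unique)
qed

lemma gl_n_act_covariants: "f \<in> covariants l \<Longrightarrow> gl_n_act x f \<in> covariants l"
  by (simp add: gl_n_act_def gl_act_covariants)

lemma sum_degree_superset:
  "degree p \<le> d \<Longrightarrow> (\<Sum>r\<le>degree p. coeff p r * h r) = (\<Sum>r\<le>d. coeff p r * (h r :: complex))"
  by (intro sum.mono_neutral_left) (auto simp: coeff_eq_0)

text \<open>The action of \<open>gl_n_act\<close> is tangent to the space of inflated matrices,
  which is why restriction to that space is equivariant.\<close>

lemma gl_dir_kronecker_left:
  "gl_dir (kronecker x (mat 1)) (inflate X) (inflate A :: complex ^ ('m::finite \<times> 'k::finite) ^ ('p::finite \<times> 'k)) =
    inflate (gl_dir x X A)"
proof -
  have "(\<Sum>a\<in>UNIV. \<Sum>c\<in>UNIV. \<Sum>r\<le>degree (x $ a $ b * (mat 1 $ c $ e :: complex poly)).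
      coeff (x $ a $ b * mat 1 $ c $ e) r * (inflate (A ** matpow X r) :: complex ^ ('m \<times> 'k) ^ ('p \<times> 'k)) $ (a, c) $ (j, e')) =
    (\<Sum>a\<in>UNIV. \<Sum>c\<in>UNIV. if c = e then (\<Sum>r\<le>degree (x $ a $ b). coeff (x $ a $ b) r *
       (if e = e' then (A ** matpow X r) $ a $ j else 0)) else 0)" for b e j e'
    by (cases "e = e'"; intro sum.cong refl) (auto simp: mat_def)
  then show ?thesis
    unfolding vec_eq_iff gl_dir_def
    by (simp add: kronecker_def sum_UNIV_prod flip: inflate_mult inflate_matpow)
qed

lemma deflate_gl_n_act:
  fixes F :: "('m::finite \<times> 'k::finite, 'p::finite \<times> 'k) cpoly"
  shows "deflate (gl_n_act x F) = gl_act x (deflate F)"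
proof (rule peval_inject)
  fix X :: "complex ^ 'm ^ 'm" and A :: "complex ^ 'm ^ 'p"
  have "((\<lambda>t. peval F (inflate X) (inflate A + mscale t (inflate (gl_dir x X A)))) has_field_derivative
      peval (gl_n_act x F) (inflate X) (inflate A)) (at 0)"
    unfolding gl_n_act_def gl_dir_kronecker_left[symmetric] by (rule gl_act_derivative)
  moreover have "((\<lambda>t. peval F (inflate X) (inflate A + mscale t (inflate (gl_dir x X A)))) has_field_derivative
      peval (gl_act x (deflate F)) X A) (at 0)"
    using gl_act_derivative[of "deflate F" X A x] by (simp add: inflate_add inflate_mscale)
  ultimately show "peval (deflate (gl_n_act x F)) X A = peval (gl_act x (deflate F)) X A"
    unfolding peval_deflate by (rule DERIV_unique)
qed

section \<open>Vanishing of the derivative in traceless directions\<close>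

lemma has_field_derivative_det_one:
  fixes Y :: "complex ^ 'n ^ ('n::finite)"
  shows "((\<lambda>t. det (mat 1 + mscale t Y)) has_field_derivative trace Y) (at 0)"
proof -
  let ?d = "\<lambda>p. \<Sum>i\<in>UNIV. Y $ i $ p i * (\<Prod>j\<in>UNIV - {i}. mat 1 $ j $ p j)"
  have "((\<lambda>t. \<Prod>i\<in>UNIV. (mat 1 + mscale t Y) $ i $ p i) has_field_derivative ?d p) (at 0)" for p :: "'n \<Rightarrow> 'n"
  proof -
    have "((\<lambda>t. (mat 1 + mscale t Y) $ i $ p i) has_field_derivative Y $ i $ p i) (at 0)" for i
      by (auto intro!: derivative_eq_intros)
    from has_field_derivative_prod[of UNIV, OF this] show ?thesis by simp
  qed
  then have "((\<lambda>t. det (mat 1 + mscale t Y)) has_field_derivative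
      (\<Sum>p | p permutes UNIV. of_int (sign p) * ?d p)) (at 0)"
    unfolding det_def by (intro DERIV_sum DERIV_cmult)
  also have "(\<Sum>p | p permutes UNIV. of_int (sign p) * ?d p) = (\<Sum>p\<in>{id}. of_int (sign p) * ?d p)"
  proof (rule sum.mono_neutral_right)
    show "\<forall>p\<in>{p. p permutes UNIV} - {id}. of_int (sign p) * ?d p = 0"
    proof
      fix p :: "'n \<Rightarrow> 'n" assume p: "p \<in> {p. p permutes UNIV} - {id}"
      then obtain j where j: "p j \<noteq> j" by (auto simp: fun_eq_iff)
      \<comment> \<open>A permutation that moves \<open>j\<close> also moves \<open>p j\<close>, and
        at least one of these two points differs from \<open>i\<close>.\<close>
      have zero: "(\<Prod>j\<in>UNIV - {i}. mat 1 $ j $ p j) = (0 :: complex)" for i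
      proof -
        have "p (p j) \<noteq> p j" using j p permutes_inj[of p UNIV] by (auto dest: injD)
        then obtain j' where "j' \<noteq> i" "p j' \<noteq> j'" using j by (metis (full_types))
        then show ?thesis by (intro prod_zero) (auto simp: mat_def intro!: bexI[of _ j'])
      qed
      show "of_int (sign p) * ?d p = 0" by (simp only: zero) simp
    qed
  qed (auto simp: finite_permutations permutes_id)
  also have "\<dots> = trace Y" by (simp add: trace_def mat_def)
  finally show ?thesis .
qed

text \<open>At \<open>t\<close> near 0 the matrix \<open>1 + t Y\<close> stabilizes \<open>X\<close>, so that covariance determines the
  derivative of \<open>f\<close> in the direction \<open>A Y\<close>.\<close>

lemma covariant_derivative_stabilizer:
  fixes X Y :: "complex ^ 'm ^ ('m::finite)" and A :: "complex ^ 'm ^ ('p::finite)"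
  assumes f: "f \<in> covariants 1" and comm: "X ** Y = Y ** X"
  shows "((\<lambda>t. peval f X (A + mscale t (A ** Y))) has_field_derivative trace Y * peval f X A) (at 0)"
proof -
  let ?h = "\<lambda>t. mat 1 + mscale t Y"
  have det: "((\<lambda>t. det (?h t)) has_field_derivative trace Y) (at 0)"
    by (rule has_field_derivative_det_one)
  have "mscale 0 Y = 0" by (simp add: vec_eq_iff)
  then have "((\<lambda>t. det (?h t)) \<longlongrightarrow> 1) (nhds 0)"
    using DERIV_isCont[OF det] tendsto_at_iff_tendsto_nhds[of "\<lambda>t. det (?h t)" 0]
    by (simp add: isCont_def)
  then have "eventually (\<lambda>t. det (?h t) \<noteq> 0) (nhds 0)"
    by (rule tendsto_imp_eventually_ne) simp
  \<comment> \<open>Covariance is applied to the inverse of \<open>?h t\<close>, available for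
    \<open>t\<close> near 0. The derivative at 0 also depends on the value at 0, hence the filter
    \<open>nhds\<close>.\<close>
  then have "eventually (\<lambda>t. det (?h t) * peval f X A = peval f X (A + mscale t (A ** Y))) (nhds 0)"
  proof eventually_elim
    case (elim t)
    then have inv: "invertible (?h t)" by (simp add: invertible_det_nz)
    note g = invertible_matrix_inv[OF inv]
    have "?h t ** X = X ** ?h t"
      by (simp add: matrix_add_rdistrib matrix_add_ldistrib mscale_matmul comm)
    then have "matrix_inv (?h t) ** X ** ?h t = (matrix_inv (?h t) ** ?h t) ** X"
      by (simp flip: matrix_mul_assoc)
    then have "matrix_inv (?h t) ** X ** ?h t = X" by (simp add: matrix_inv_mult[OF inv])
    moreover have "A ** ?h t = A + mscale t (A ** Y)"
      by (simp add: matrix_add_ldistrib mscale_matmul)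
    ultimately show ?case
      using covariantsD[OF f g(1), of X A] elim by (simp add: g power_int_minus)
  qed
  moreover have "((\<lambda>t. det (?h t) * peval f X A) has_field_derivative trace Y * peval f X A) (at 0)"
    using det by (rule DERIV_cmult_right)
  ultimately show ?thesis by (simp add: DERIV_cong_ev)
qed

lemma deflate_sl_k_act:
  fixes F :: "('m::finite \<times> 'k::finite, 'p::finite \<times> 'k) cpoly"
  assumes y: "y \<in> sl_current" and F: "F \<in> covariants 1"
  shows "deflate (sl_k_act y F) = 0"
proof (rule peval_inject)
  fix X :: "complex ^ 'm ^ 'm" and A :: "complex ^ 'm ^ 'p"
  let ?X = "inflate X :: complex ^ ('m \<times> 'k) ^ ('m \<times> 'k)"
  let ?A = "inflate A :: complex ^ ('m \<times> 'k) ^ ('p \<times> 'k)"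
  \<comment> \<open>A common degree bound makes the range of \<open>r\<close> independent of the
    entry of \<open>y\<close>, so that sums can be exchanged.\<close>
  define d where "d = Max (range (\<lambda>v. degree (y $ fst v $ snd v)))"
  have d: "degree (y $ a $ b) \<le> d" for a b
    unfolding d_def by (rule Max_ge) (auto intro: rev_image_eqI[of "(a, b)"])
  \<comment> \<open>The sum over \<open>r\<close> of X^r \<otimes> y_r^T, where y_r is the
    z^r-coefficient of \<open>y\<close>. By its definition \<open>gl_dir\<close> multiplies A
    \<otimes> 1 by 1 \<otimes> y_r^T from the left; this factor commutes past to the right.\<close>
  define Y :: "complex ^ ('m \<times> 'k) ^ ('m \<times> 'k)" where
    "Y = (\<chi> u v. \<Sum>r\<le>d. coeff (y $ snd v $ snd u) r * matpow X r $ fst u $ fst v)"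
  have dir: "gl_dir (kronecker (mat 1) y) ?X ?A = ?A ** Y"
  proof -
    have "gl_dir (kronecker (mat 1) y) ?X ?A $ (b, e) $ (j, e') = (?A ** Y) $ (b, e) $ (j, e')" for b e j e'
    proof -
      have "gl_dir (kronecker (mat 1) y) ?X ?A $ (b, e) $ (j, e') =
          (\<Sum>a\<in>UNIV. \<Sum>c\<in>UNIV. \<Sum>r\<le>degree (mat 1 $ a $ b * y $ c $ e).
            coeff (mat 1 $ a $ b * y $ c $ e) r * (inflate (A ** matpow X r) :: complex ^ ('m \<times> 'k) ^ ('p \<times> 'k)) $ (a, c) $ (j, e'))"
        by (simp add: gl_dir_def kronecker_def sum_UNIV_prod flip: inflate_mult inflate_matpow)
      also have "\<dots> = (\<Sum>a\<in>UNIV. \<Sum>c\<in>UNIV. if c = e' then (if a = b then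
            (\<Sum>r\<le>degree (y $ c $ e). coeff (y $ c $ e) r * (A ** matpow X r) $ a $ j) else 0) else 0)"
        by (intro sum.cong refl) (auto simp: mat_def)
      also have "\<dots> = (\<Sum>r\<le>d. coeff (y $ e' $ e) r * (A ** matpow X r) $ b $ j)"
        by (simp add: sum_degree_superset[OF d])
      also have "\<dots> = (\<Sum>i\<in>UNIV. A $ b $ i * (\<Sum>r\<le>d. coeff (y $ e' $ e) r * matpow X r $ i $ j))"
        unfolding matrix_matrix_mult_def vec_lambda_beta sum_distrib_left
        by (subst sum.swap) (simp only: mult.left_commute)
      also have "\<dots> = (\<Sum>i\<in>UNIV. \<Sum>c\<in>UNIV. if c = e then A $ b $ i * (\<Sum>r\<le>d. coeff (y $ e' $ c) r * matpow X r $ i $ j) else 0)"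
        by simp
      also have "\<dots> = (?A ** Y) $ (b, e) $ (j, e')"
        unfolding matrix_matrix_mult_def vec_lambda_beta sum_UNIV_prod
        by (intro sum.cong refl) (auto simp: Y_def)
      finally show ?thesis .
    qed
    then show ?thesis by (simp add: vec_eq_iff)
  qed
  have comm: "?X ** Y = Y ** ?X"
  proof -
    have comm: "X ** matpow X r = matpow X r ** X" for r
    proof (induct r)
      case (Suc r)
      then show ?case by (metis matpow.simps(2) matrix_mul_assoc)
    qed simp
    have "(?X ** Y) $ (i, e) $ (j, e') = (Y ** ?X) $ (i, e) $ (j, e')" for i e j e'
    proof -
      have "(?X ** Y) $ (i, e) $ (j, e') =
          (\<Sum>s\<in>UNIV. \<Sum>c\<in>UNIV. if c = e then X $ i $ s * (\<Sum>r\<le>d. coeff (y $ e' $ c) r * matpow X r $ s $ j) else 0)"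
        unfolding matrix_matrix_mult_def vec_lambda_beta sum_UNIV_prod
        by (intro sum.cong refl) (auto simp: Y_def)
      also have "\<dots> = (\<Sum>r\<le>d. coeff (y $ e' $ e) r * (X ** matpow X r) $ i $ j)"
        unfolding matrix_matrix_mult_def vec_lambda_beta sum_distrib_left
        by (subst (2) sum.swap) (simp add: mult.left_commute)
      also have "\<dots> = (\<Sum>s\<in>UNIV. \<Sum>c\<in>UNIV. if c = e' then (\<Sum>r\<le>d. coeff (y $ c $ e) r * matpow X r $ i $ s) * X $ s $ j else 0)"
        unfolding comm unfolding matrix_matrix_mult_def vec_lambda_beta sum_distrib_left sum_distrib_right
        by (subst sum.swap) (simp add: mult.assoc)
      also have "\<dots> = (Y ** ?X) $ (i, e) $ (j, e')"
        unfolding matrix_matrix_mult_def vec_lambda_beta sum_UNIV_prod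
        by (intro sum.cong refl) (auto simp: Y_def)
      finally show ?thesis .
    qed
    then show ?thesis by (simp add: vec_eq_iff)
  qed
  have "trace Y = (\<Sum>i\<in>UNIV. \<Sum>c\<in>UNIV. \<Sum>r\<le>d. coeff (y $ c $ c) r * matpow X r $ i $ i)"
    unfolding trace_def sum_UNIV_prod by (simp add: Y_def)
  also have "\<dots> = (\<Sum>i\<in>UNIV. \<Sum>r\<le>d. (\<Sum>c\<in>UNIV. coeff (y $ c $ c) r) * matpow X r $ i $ i)"
    by (rule sum.cong[OF refl], subst sum.swap) (simp only: sum_distrib_right)
  finally have "trace Y = (\<Sum>i\<in>UNIV. \<Sum>r\<le>d. (\<Sum>c\<in>UNIV. coeff (y $ c $ c) r) * matpow X r $ i $ i)" .
  moreover have "(\<Sum>c\<in>UNIV. coeff (y $ c $ c) r) = 0" for r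
  proof -
    have "(\<Sum>c\<in>UNIV. y $ c $ c) = 0" using y by (simp add: sl_current_def trace_def)
    then show ?thesis by (simp flip: coeff_sum)
  qed
  ultimately have "trace Y = 0" by simp
  then have "((\<lambda>t. peval F ?X (?A + mscale t (?A ** Y))) has_field_derivative 0) (at 0)"
    using covariant_derivative_stabilizer[OF F comm, of ?A] by simp
  moreover have "((\<lambda>t. peval F ?X (?A + mscale t (?A ** Y))) has_field_derivative peval (sl_k_act y F) ?X ?A) (at 0)"
    unfolding sl_k_act_def dir[symmetric] by (rule gl_act_derivative)
  ultimately show "peval (deflate (sl_k_act y F)) X A = peval 0 X A"
    by (auto dest: DERIV_unique)
qed

section \<open>Lifting the generators\<close>

lemma polyfun_trace [polyfun_intros]:
  "(\<And>i j. polyfun (\<lambda>X A. M X A $ i $ j)) \<Longrightarrow> polyfun (\<lambda>X A. trace (M X A))"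
  unfolding trace_def by (intro polyfun_intros) auto

lemma trace_conj:
  assumes "invertible (g :: complex ^ 'm ^ ('m::finite))"
  shows "trace (g ** B ** matrix_inv g) = trace B"
proof -
  have "trace (g ** B ** matrix_inv g) = trace (matrix_inv g ** (g ** B))"
    by (rule trace_mul_sym)
  then show ?thesis by (simp add: matrix_mul_assoc matrix_inv_mult[OF assms])
qed

text \<open>A single determinant of size \<open>kN\<close> on the big space restricts to a product of \<open>k\<close>
  determinants of size \<open>N\<close>, because its matrix becomes block diagonal.\<close>

lemma traces_dets_lift:
  fixes a :: "'k::finite \<Rightarrow> 'm::finite \<Rightarrow> 'p::finite"
  shows "\<exists>F :: ('m \<times> 'k, 'p \<times> 'k) cpoly. F \<in> covariants 1 \<and>
    (\<forall>X A. peval F (inflate X) (inflate A) = (\<Prod>m\<leftarrow>ms. trace (matpow X m)) *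
      (\<Prod>\<kappa>\<in>UNIV. det (\<chi> c. (A ** matpow X (e \<kappa> c)) $ a \<kappa> c)))"
proof -
  define D where "D X A = (\<chi> u. (A ** matpow X (e (snd u) (fst u))) $ (a (snd u) (fst u), snd u))"
    for X :: "complex ^ ('m \<times> 'k) ^ ('m \<times> 'k)" and A :: "complex ^ ('m \<times> 'k) ^ ('p \<times> 'k)"
  \<comment> \<open>Each trace of an inflated matrix carries an extra factor k, which the power of
    1/k removes.\<close>
  define \<phi> where "\<phi> X A = inverse (of_nat CARD('k)) ^ length ms * ((\<Prod>m\<leftarrow>ms. trace (matpow X m)) * det (D X A))" for X A
  have "polyfun \<phi>"
    unfolding \<phi>_def D_def by (intro polyfun_intros) (simp, intro polyfun_intros)
  then obtain F where F: "\<And>X A. peval F X A = \<phi> X A" unfolding polyfun_def by metis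
  have "\<phi> (g ** X ** matrix_inv g) (A ** matrix_inv g) = det g powi (- int 1) * \<phi> X A"
    if g: "invertible g" for g X A
  proof -
    have "A ** matrix_inv g ** matpow (g ** X ** matrix_inv g) r = A ** matpow X r ** matrix_inv g" for r
    proof -
      have "A ** matrix_inv g ** matpow (g ** X ** matrix_inv g) r =
          A ** (matrix_inv g ** g) ** matpow X r ** matrix_inv g"
        by (simp only: matpow_conj[OF g] matrix_mul_assoc)
      then show ?thesis by (simp add: matrix_inv_mult[OF g])
    qed
    then have "D (g ** X ** matrix_inv g) (A ** matrix_inv g) = D X A ** matrix_inv g"
      by (simp add: D_def vec_eq_iff matrix_matrix_mult_def[of "vec_lambda _"]
          matrix_matrix_mult_def[of "A ** _"])
    then show ?thesis
      by (simp add: \<phi>_def det_mul invertible_matrix_inv[OF g] matpow_conj[OF g] trace_conj[OF g]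
          power_int_minus)
  qed
  then have "F \<in> covariants 1" by (simp add: covariants_def F)
  moreover have "\<phi> (inflate X) (inflate A) = (\<Prod>m\<leftarrow>ms. trace (matpow X m)) *
      (\<Prod>\<kappa>\<in>UNIV. det (\<chi> c. (A ** matpow X (e \<kappa> c)) $ a \<kappa> c))" for X A
  proof -
    have "D (inflate X) (inflate A) = (\<chi> u v. if snd u = snd v
        then (\<chi> c. (A ** matpow X (e (snd u) c)) $ a (snd u) c) $ fst u $ fst v else 0)"
      by (simp add: D_def vec_eq_iff flip: inflate_mult inflate_matpow)
    then have "det (D (inflate X) (inflate A)) =
        (\<Prod>\<kappa>\<in>UNIV. det (\<chi> c. (A ** matpow X (e \<kappa> c)) $ a \<kappa> c))"
      using det_block[of "\<lambda>\<kappa>. \<chi> c. (A ** matpow X (e \<kappa> c)) $ a \<kappa> c"] by simp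
    moreover have "(\<Prod>m\<leftarrow>ms. trace (matpow (inflate X :: complex ^ ('m \<times> 'k) ^ ('m \<times> 'k)) m)) =
        of_nat CARD('k) ^ length ms * (\<Prod>m\<leftarrow>ms. trace (matpow X m))"
      by (induct ms) (simp_all add: trace_inflate flip: inflate_matpow)
    ultimately show ?thesis by (simp add: \<phi>_def field_simps)
  qed
  ultimately show ?thesis using F by metis
qed

lemma covariants_add: "f \<in> covariants l \<Longrightarrow> g \<in> covariants l \<Longrightarrow> f + g \<in> covariants l"
  and covariants_pscale: "f \<in> covariants l \<Longrightarrow> pscale c f \<in> covariants l"
  by (auto simp: covariants_def distrib_left)

text \<open>Having a lift to a weight 1 covariant is preserved by sums and scalar multiples, so the
  fundamental theorem reduces the claim to \<open>traces_dets_lift\<close>.\<close>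

lemma deflate_surjective:
  assumes "f \<in> covariants CARD('k::finite)"
  shows "\<exists>F :: ('m::finite \<times> 'k, 'p::finite \<times> 'k) cpoly. F \<in> covariants 1 \<and> deflate F = f"
proof -
  interpret closed_under_traces_dets
    "\<lambda>\<phi>. \<exists>F :: ('m \<times> 'k, 'p \<times> 'k) cpoly. F \<in> covariants 1 \<and>
      (\<forall>X A. peval F (inflate X) (inflate A) = \<phi> X A)" "TYPE('k)"
  proof
    fix \<phi> \<psi> :: "complex ^ 'm ^ 'm \<Rightarrow> complex ^ 'm ^ 'p \<Rightarrow> complex"
    assume "\<exists>F :: ('m \<times> 'k, 'p \<times> 'k) cpoly. F \<in> covariants 1 \<and> (\<forall>X A. peval F (inflate X) (inflate A) = \<phi> X A)"
      and "\<exists>F :: ('m \<times> 'k, 'p \<times> 'k) cpoly. F \<in> covariants 1 \<and> (\<forall>X A. peval F (inflate X) (inflate A) = \<psi> X A)"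
    then show "\<exists>F :: ('m \<times> 'k, 'p \<times> 'k) cpoly. F \<in> covariants 1 \<and>
        (\<forall>X A. peval F (inflate X) (inflate A) = \<phi> X A + \<psi> X A)"
      by (metis covariants_add peval_add)
  next
    fix c and \<phi> :: "complex ^ 'm ^ 'm \<Rightarrow> complex ^ 'm ^ 'p \<Rightarrow> complex"
    assume "\<exists>F :: ('m \<times> 'k, 'p \<times> 'k) cpoly. F \<in> covariants 1 \<and> (\<forall>X A. peval F (inflate X) (inflate A) = \<phi> X A)"
    then show "\<exists>F :: ('m \<times> 'k, 'p \<times> 'k) cpoly. F \<in> covariants 1 \<and>
        (\<forall>X A. peval F (inflate X) (inflate A) = c * \<phi> X A)"
      by (metis covariants_pscale peval_pscale)
  qed (rule traces_dets_lift)
  from P_covariant[OF assms] obtain F :: "('m \<times> 'k, 'p \<times> 'k) cpoly"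
    where "F \<in> covariants 1" "\<And>X A. peval F (inflate X) (inflate A) = peval f X A" by blast
  then show ?thesis by (intro exI[of _ F] conjI peval_inject) auto
qed

section \<open>Descent to the coinvariants\<close>

lemma deflate_sl_image:
  assumes "F \<in> sl_image 1"
  shows "deflate F = 0"
  using assms unfolding sl_image_def
  by (rule cpoly.span_induct)
    (auto simp: cpoly.subspace_def deflate_0 deflate_add deflate_pscale deflate_sl_k_act)

lemma coinv_rel_refl: "f \<in> covariants l \<Longrightarrow> f \<in> coinv_rel l `` {f}"
  by (simp add: coinv_rel_def sl_image_def cpoly.span_zero)

lemma deflate_coinv_rel: "g \<in> coinv_rel 1 `` {f} \<Longrightarrow> deflate g = deflate f"
  using deflate_sl_image[of "f - g"] by (auto simp: coinv_rel_def deflate_diff)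

text \<open>An arbitrary representative may be chosen, since \<open>deflate\<close> is constant on
  each class in \<open>coinvariants 1\<close>.\<close>

definition coinv_map ::
  "('m::finite \<times> 'k::finite, 'p::finite \<times> 'k) cpoly set \<Rightarrow> ('m, 'p) cpoly" where
  "coinv_map S = deflate (SOME f. f \<in> S)"

lemma coinv_map_eq:
  assumes "f \<in> S" "\<And>g. g \<in> S \<Longrightarrow> deflate g = w"
  shows "coinv_map S = w"
  using assms unfolding coinv_map_def by (metis someI)

lemma coinv_map_class: "f \<in> covariants 1 \<Longrightarrow> coinv_map (coinv_rel 1 `` {f}) = deflate f"
  using coinv_rel_refl deflate_coinv_rel by (intro coinv_map_eq)

lemma coinvariantsE:
  assumes "S \<in> coinvariants 1"
  obtains f where "f \<in> S" "f \<in> covariants 1" "\<And>g. g \<in> S \<Longrightarrow> g \<in> covariants 1 \<and> deflate g = coinv_map S"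
proof -
  obtain f where f: "f \<in> covariants 1" "S = coinv_rel 1 `` {f}"
    using assms unfolding coinvariants_def by (rule quotientE)
  show ?thesis
  proof
    show "f \<in> S" "f \<in> covariants 1" using f coinv_rel_refl by auto
    show "g \<in> covariants 1 \<and> deflate g = coinv_map S" if "g \<in> S" for g
    proof
      have g: "g \<in> coinv_rel 1 `` {f}" using that f(2) by simp
      then show "g \<in> covariants 1" by (simp add: coinv_rel_def del: One_nat_def)
      show "deflate g = coinv_map S"
        using deflate_coinv_rel[OF g] coinv_map_class[OF f(1)] f(2) by simp
    qed
  qed
qed

lemma coinv_map_add:
  assumes S: "S \<in> coinvariants 1" and T: "T \<in> coinvariants 1"
  shows "coinv_map (coinv_add 1 S T) = coinv_map S + coinv_map T"
proof -
  obtain f where f: "f \<in> S" "f \<in> covariants 1" "\<And>g. g \<in> S \<Longrightarrow> g \<in> covariants 1 \<and> deflate g = coinv_map S"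
    using S by (rule coinvariantsE) blast
  obtain g where g: "g \<in> T" "g \<in> covariants 1" "\<And>h. h \<in> T \<Longrightarrow> h \<in> covariants 1 \<and> deflate h = coinv_map T"
    using T by (rule coinvariantsE) blast
  show ?thesis
  proof (rule coinv_map_eq)
    have "f + g \<in> coinv_rel 1 `` {f + g}"
      by (intro coinv_rel_refl covariants_add f g)
    then show "f + g \<in> coinv_add 1 S T"
      unfolding coinv_add_def by (rule UN_I[OF f(1) UN_I[OF g(1)]])
    fix h assume "h \<in> coinv_add 1 S T"
    then obtain f' g' where h: "f' \<in> S" "g' \<in> T" "h \<in> coinv_rel 1 `` {f' + g'}"
      unfolding coinv_add_def by blast
    show "deflate h = coinv_map S + coinv_map T"
      using deflate_coinv_rel[OF h(3)] f(3)[OF h(1)] g(3)[OF h(2)] by (simp add: deflate_add)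
  qed
qed

text \<open>Common treatment of scaling and of the action of gl_n[z]. All members of the union have
  the same image under \<open>deflate\<close>, so the argument does not go through well-definedness
  of the induced operation on classes.\<close>

lemma coinv_map_union:
  assumes S: "S \<in> coinvariants 1"
    and cov: "\<And>f. f \<in> covariants 1 \<Longrightarrow> op f \<in> covariants 1"
    and defl: "\<And>f. deflate (op f) = op' (deflate f)"
  shows "coinv_map (\<Union>f\<in>S. coinv_rel 1 `` {op f}) = op' (coinv_map S)"
proof -
  obtain f where f: "f \<in> S" "f \<in> covariants 1" "\<And>g. g \<in> S \<Longrightarrow> g \<in> covariants 1 \<and> deflate g = coinv_map S"
    using S by (rule coinvariantsE) blast
  show ?thesis
  proof (rule coinv_map_eq)
    show "op f \<in> (\<Union>f\<in>S. coinv_rel 1 `` {op f})"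
      by (intro UN_I[OF f(1)] coinv_rel_refl cov f(2))
    fix h assume "h \<in> (\<Union>f\<in>S. coinv_rel 1 `` {op f})"
    then obtain g where h: "g \<in> S" "h \<in> coinv_rel 1 `` {op g}" by blast
    show "deflate h = op' (coinv_map S)"
      using deflate_coinv_rel[OF h(2)] f(3)[OF h(1)] by (simp add: defl)
  qed
qed

theorem theoremC:
  "\<exists>\<Phi> :: ('N::finite \<times> 'k::finite, 'n::finite \<times> 'k) cpoly set \<Rightarrow> ('N, 'n) cpoly.
     (\<forall>S\<in>coinvariants 1. \<forall>T\<in>coinvariants 1. \<Phi> (coinv_add 1 S T) = \<Phi> S + \<Phi> T) \<and>
     (\<forall>c. \<forall>S\<in>coinvariants 1. \<Phi> (coinv_scale 1 c S) = pscale c (\<Phi> S)) \<and>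
     (\<forall>d. \<Phi> ` coinvariants_degree 1 d \<subseteq> covariants_degree CARD('k) d) \<and>
     (\<forall>x :: complex poly ^ 'n ^ 'n. \<forall>S\<in>coinvariants 1.
        \<Phi> (coinv_gl_act 1 x S) = gl_act x (\<Phi> S)) \<and>
     \<Phi> ` coinvariants 1 = covariants CARD('k)"
proof (intro exI[of _ coinv_map] conjI ballI allI)
  show "coinv_map (coinv_add 1 S T) = coinv_map S + coinv_map T"
    if "S \<in> coinvariants 1" "T \<in> coinvariants 1"
    for S T :: "('N \<times> 'k, 'n \<times> 'k) cpoly set"
    using that by (rule coinv_map_add)
  show "coinv_map (coinv_scale 1 c S) = pscale c (coinv_map S)"
    if "S \<in> coinvariants 1" for c and S :: "('N \<times> 'k, 'n \<times> 'k) cpoly set"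
    unfolding coinv_scale_def using that covariants_pscale deflate_pscale by (rule coinv_map_union)
  show "coinv_map (coinv_gl_act 1 x S) = gl_act x (coinv_map S)"
    if "S \<in> coinvariants 1" for x and S :: "('N \<times> 'k, 'n \<times> 'k) cpoly set"
    unfolding coinv_gl_act_def using that gl_n_act_covariants deflate_gl_n_act by (rule coinv_map_union)
  show "coinv_map ` (coinvariants_degree 1 d :: ('N \<times> 'k, 'n \<times> 'k) cpoly set set) \<subseteq>
      covariants_degree CARD('k) d" for d
    by (auto simp: coinvariants_degree_def covariants_degree_def coinv_map_class deflate_covariants
        deflate_Xhomogeneous simp del: One_nat_def)
  show "coinv_map ` (coinvariants 1 :: ('N \<times> 'k, 'n \<times> 'k) cpoly set set) = covariants CARD('k)"
  proof (intro equalityI subsetI)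
    fix f :: "('N, 'n) cpoly"
    assume "f \<in> coinv_map ` (coinvariants 1 :: ('N \<times> 'k, 'n \<times> 'k) cpoly set set)"
    then obtain S :: "('N \<times> 'k, 'n \<times> 'k) cpoly set" where "S \<in> coinvariants 1" "f = coinv_map S"
      by blast
    then show "f \<in> covariants CARD('k)"
      by (metis coinvariantsE deflate_covariants)
  next
    fix f :: "('N, 'n) cpoly" assume "f \<in> covariants CARD('k)"
    then obtain F :: "('N \<times> 'k, 'n \<times> 'k) cpoly" where F: "F \<in> covariants 1" "deflate F = f"
      using deflate_surjective by blast
    then have "coinv_rel 1 `` {F} \<in> coinvariants 1"
      unfolding coinvariants_def by (intro quotientI)
    with F show "f \<in> coinv_map ` (coinvariants 1 :: ('N \<times> 'k, 'n \<times> 'k) cpoly set set)"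
      by (intro image_eqI[of _ _ "coinv_rel 1 `` {F}"]) (simp_all add: coinv_map_class del: One_nat_def)
  qed
qed

end
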